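(* Assume the basic framework described in the context for $(T,\mathcal A,\phi)$, $X$, $K$, $d$, with $M_*\ge1$ such that $d$ is $M_*$-adapted. Let $\Omega=\{(\Omega_m,E_m)\}_{m\ge0}$ be a proper system of horizontal networks, and let $N_1\ge0$, $N_2$ be integers. If $N_2\ge N_1+M_*$, then $$\overline I_{\mathcal M}(N_1,N_2,\Omega)=\underline I_{\mathcal M}(N_1,N_2,\Omega)=\dim_{AR}(X,d).$$
   Context: Setting. $T$ is a countably infinite set, $\mathcal A:T\times T\to\{0,1\}$ is symmetric and vanishes on the diagonal, the graph on $T$ with edges $\{(w,v):\mathcal A(w,v)=1\}$ is a locally finite tree, and $\phi\in T$ is a fixed root. For $w\in T$: $|w|$ is the tree distance from $\phi$ to $w$; $(T)_m=\{w:|w|=m\}$; $\pi(w)$ is the neighbour of $w$ on the geodesic from $\phi$ to $w$ ($\pi(\phi)=\phi$); $S(w)$ is the set of neighbours of $w$ other than $\pi(w)$; $T_w$ is the set of $v$ such that $w$ lies on the geodesic from $\phi$ to $v$; $S^k(w)=\{v\in T_w:|v|=|w|+k\}$, and $S^k(A)=\bigcup_{w\in A}S^k(w)$ for $A\subseteq T$. $\Sigma$ is the set of infinite geodesic rays $([\omega]_0=\phi,[\omega]_1,\ldots)$ of the tree from $\phi$. $(X,\mathcal O)$ is a compact metrizable space with no isolated point. A partition $K$ assigns to each $w\in T$ a nonempty compact $K_w\subseteq X$ with $K_\phi=X$, $K_w=\bigcup_{v\in S(w)}K_v$, and $\bigcap_mK_{[\omega]_m}$ a single point for all $\omega\in\Sigma$.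 It is minimal if $K_w\setminus\bigcup_{v\in(T)_{|w|},v\ne w}K_v\ne\emptyset$ for all $w$. Weight functions. A weight function is $g:T\to(0,1]$ with $g(\phi)=1$, $g(\pi(w))\ge g(w)$, $\lim_m\sup_{(T)_m}g=0$. $\Lambda^g_s=\{w:g(\pi(w))>s\ge g(w)\}$ for $s\in(0,1)$, $\Lambda^g_s=\{\phi\}$ for $s\ge1$. $U^g_M(x,s)$ is the set of $y$ for which there are $w(1),\ldots,w(M+1)\in\Lambda^g_s$ with $x\in K_{w(1)}$, $y\in K_{w(M+1)}$, $K_{w(i)}\cap K_{w(i+1)}\ne\emptyset$. $g$ is exponential if there are $m\ge0$, $c_1\in(0,1)$ with $g(v)\le c_1g(w)$ for $v\in T_w$, $|v|\ge|w|+m$, and $c_2\in(0,1)$ with $g(v)\ge c_2g(w)$ for $v\in S(w)$; uniformly finite if $\sup_{s\in(0,1],w\in\Lambda^g_s}\#\{v\in\Lambda^g_s:K_v\cap K_w\ne\emptyset\}<\infty$; thick if there are $M\ge1,\alpha>0$ such that for all $s\in(0,1]$, $w\in\Lambda^g_s$, $K_w\supseteq U^g_M(x,\alpha s)$ for some $x\in K_w$. $\mathcal D(X,\mathcal O)$: metrics inducing $\mathcal O$ with $\operatorname{diam}(X,d)=1$; $B_d(x,r)$ open balls; $g_d(w)=\operatorname{diam}(K_w,d)$. $d$ is $M$-adapted if there are $\alpha_1,\alpha_2>0$ with $U^{g_d}_M(x,\alpha_1r)\subseteq B_d(x,r)\subseteq U^{g_d}_M(x,\alpha_2r)$ for all $x\in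 X,r>0$. Basic framework. $K$ is minimal, $\sup_{w}\#(S(w))<\infty$, $d\in\mathcal D(X,\mathcal O)$ is $M_*$-adapted for some fixed $M_*\ge1$, $g_d$ is exponential, thick and uniformly finite, and there are $r\in(0,1)$, $c_1,c_2>0$ with $c_1r^{|w|}\le g_d(w)\le c_2r^{|w|}$ for all $w\in T$. For $w\in T$ and $M\ge1$, $\Gamma_M(w)$ is the set of $u\in(T)_{|w|}$ for which there are $w(1)=w,\ldots,w(M+1)=u$ in $(T)_{|w|}$ with $K_{w(i)}\cap K_{w(i+1)}\neq\emptyset$; $\Gamma_0(w)=\{w\}$. $J^h_{N,m}=\{(w,u):w,u\in(T)_m,u\in\Gamma_N(w)\}$, $J^h_N=\bigcup_mJ^h_{N,m}$. Proper system of horizontal networks: a sequence of non-directed graphs $\{(\Omega_m,E_m)\}_{m\ge0}$ such that for some integers $N,L_0,L_1,L_2\ge1$ (indices): (N1) $\Omega_m=A_m\cup V_m$ with $A_m\subseteq(T)_m$, $V_m\subseteq X$. (N2) For $m\ge0$, $w\in(T)_m$, $\Omega_{m,w}:=(\{w\}\cap A_m)\cup(V_m\cap K_w)\ne\emptyset$. (N3) $\#(E_m(u,v))\le L_0$ for all $m$ and $u,v\in(T)_m$, where $E_m(u,v)=\{(x,y)\in E_m:x\in\Omega_{m,u},y\in\Omega_{m,v}\}$. (N4) For every $(x,y)\in E_m$ there is $(u,v)\in J^h_{N,m}$ with $x\in\Omega_{m,u}$, $y\in\Omega_{m,v}$. (N5) For every $(u,v)\in J^h_{L_1}$, $x\in\Omega_{|u|,u}$,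 $y\in\Omega_{|u|,v}$, there are $(x_1,\ldots,x_n)$ and $(w(1),\ldots,w(n))$ with $w(i)\in\Gamma_{L_2}(u)$ for all $i$, $(x_i,x_{i+1})\in E_{|u|}(w(i),w(i+1))$ for $i<n$, $x_1=x$, $x_n=y$, $w(1)=u$, $w(n)=v$. For $U\subseteq(T)_m$, $\Omega_m(U)=\bigcup_{v\in U}\Omega_{m,v}$; $\Omega^k(w,n)=\Omega_{|w|+k}(S^k(\Gamma_n(w)))$ and $\Omega^{k,c}(w,n)=\Omega_{|w|+k}((T)_{|w|+k}\setminus S^k(\Gamma_n(w)))$. $p$-moduli ($p>0$). For a non-directed graph $(V,E)$ and disjoint $U_1,U_2\subseteq V$, $\mathcal C(V,E,U_1,U_2)$ is the set of sequences $(x(1),\ldots,x(m))$, $m\ge1$, in $V$ for which there are $x(0)\in U_1$, $x(m+1)\in U_2$ with $(x(i),x(i+1))\in E$ for $0\le i\le m$. $\mathrm{Mod}_p(V,E,U_1,U_2)=\inf\sum_{x\in V}f(x)^p$ over all $f:V\to[0,\infty)$ with $\sum_{i=1}^mf(x(i))\ge1$ for all $(x(1),\ldots,x(m))\in\mathcal C(V,E,U_1,U_2)$. Put $\mathcal M_{p,k}(N_1,N_2,\Omega)=\sup_{w\in T}\mathrm{Mod}_p(\Omega_{|w|+k},E_{|w|+k},\Omega^k(w,N_1),\Omega^{k,c}(w,N_2))$; $\overline{\mathcal M}_p$ and $\underline{\mathcal M}_p$ are its $\limsup$ and $\liminf$ as $k\to\infty$; $\overline I_{\mathcal M}(N_1,N_2,\Omega)=\inf\{p>0:\overline{\mathcal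 M}_p(N_1,N_2,\Omega)=0\}$, $\underline I_{\mathcal M}(N_1,N_2,\Omega)=\inf\{p>0:\underline{\mathcal M}_p(N_1,N_2,\Omega)=0\}$. $\dim_{AR}(X,d)$ is the infimum of all $\alpha>0$ for which there are a metric $\rho$ on $X$ quasisymmetric to $d$ and a Borel regular measure $\mu$ on $X$ that is $\alpha$-Ahlfors regular with respect to $\rho$. $\rho$ is quasisymmetric to $d$ if there is a homeomorphism $h$ of $[0,\infty)$ with $h(0)=0$ such that for any $t>0$, $\rho(x,z)<h(t)\rho(x,y)$ whenever $d(x,z)<t\,d(x,y)$; $\mu$ is $\alpha$-Ahlfors regular with respect to $\rho$ if there are $C_1,C_2>0$ with $C_1r^\alpha\le\mu(B_\rho(x,r))\le C_2r^\alpha$ for all $x\in X$, $r\in[0,\operatorname{diam}(X,\rho)]$. *)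

theory Defs
  imports "HOL-Analysis.Analysis"
begin

section \<open>Rooted trees\<close>

text \<open>
  The vertex set T is the universe of the type \<open>'t\<close>; the adjacency matrix with entries 0, 1 is
  the predicate \<open>A\<close>, and \<open>\<phi>\<close> is the root.
\<close>

definition simple_path :: "('t \<Rightarrow> 't \<Rightarrow> bool) \<Rightarrow> 't \<Rightarrow> 't \<Rightarrow> 't list \<Rightarrow> bool" where
  "simple_path A w v xs \<longleftrightarrow>
     xs \<noteq> [] \<and> hd xs = w \<and> last xs = v \<and> successively A xs \<and> distinct xs"

definition locally_finite_tree :: "('t \<Rightarrow> 't \<Rightarrow> bool) \<Rightarrow> bool" where
  "locally_finite_tree A \<longleftrightarrow>
     (\<forall>w v. A w v \<longleftrightarrow> A v w) \<and> (\<forall>w. \<not> A w w) \<and>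
     (\<forall>w v. \<exists>!xs. simple_path A w v xs) \<and>
     (\<forall>w. finite {v. A w v})"

definition geodesic :: "('t \<Rightarrow> 't \<Rightarrow> bool) \<Rightarrow> 't \<Rightarrow> 't \<Rightarrow> 't list" where
  "geodesic A w v = (THE xs. simple_path A w v xs)"

definition height :: "('t \<Rightarrow> 't \<Rightarrow> bool) \<Rightarrow> 't \<Rightarrow> 't \<Rightarrow> nat" where
  "height A \<phi> w = length (geodesic A \<phi> w) - 1"

definition level :: "('t \<Rightarrow> 't \<Rightarrow> bool) \<Rightarrow> 't \<Rightarrow> nat \<Rightarrow> 't set" where
  "level A \<phi> m = {w. height A \<phi> w = m}"

definition parent :: "('t \<Rightarrow> 't \<Rightarrow> bool) \<Rightarrow> 't \<Rightarrow> 't \<Rightarrow> 't" where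
  "parent A \<phi> w = (if w = \<phi> then \<phi> else last (butlast (geodesic A \<phi> w)))"

definition children :: "('t \<Rightarrow> 't \<Rightarrow> bool) \<Rightarrow> 't \<Rightarrow> 't \<Rightarrow> 't set" where
  "children A \<phi> w = {v. A w v} - {parent A \<phi> w}"

definition subtree :: "('t \<Rightarrow> 't \<Rightarrow> bool) \<Rightarrow> 't \<Rightarrow> 't \<Rightarrow> 't set" where
  "subtree A \<phi> w = {v. w \<in> set (geodesic A \<phi> v)}"

definition desc :: "('t \<Rightarrow> 't \<Rightarrow> bool) \<Rightarrow> 't \<Rightarrow> nat \<Rightarrow> 't \<Rightarrow> 't set" where
  "desc A \<phi> k w = {v \<in> subtree A \<phi> w. height A \<phi> v = height A \<phi> w + k}"

definition descs :: "('t \<Rightarrow> 't \<Rightarrow> bool) \<Rightarrow> 't \<Rightarrow> nat \<Rightarrow> 't set \<Rightarrow> 't set" where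
  "descs A \<phi> k W = (\<Union>w\<in>W. desc A \<phi> k w)"

text \<open>A sequence is a geodesic ray from the root iff all its initial segments are geodesics.\<close>

definition rays :: "('t \<Rightarrow> 't \<Rightarrow> bool) \<Rightarrow> 't \<Rightarrow> (nat \<Rightarrow> 't) set" where
  "rays A \<phi> = {\<omega>. \<omega> 0 = \<phi> \<and> (\<forall>n. simple_path A \<phi> (\<omega> n) (map \<omega> [0..<Suc n]))}"


section \<open>Partitions\<close>

definition tree_partition ::
  "('t \<Rightarrow> 't \<Rightarrow> bool) \<Rightarrow> 't \<Rightarrow> 'x topology \<Rightarrow> ('t \<Rightarrow> 'x set) \<Rightarrow> bool" where
  "tree_partition A \<phi> X K \<longleftrightarrow>
     (\<forall>w. K w \<noteq> {} \<and> compactin X (K w)) \<and>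
     K \<phi> = topspace X \<and>
     (\<forall>w. K w = (\<Union>v\<in>children A \<phi> w. K v)) \<and>
     (\<forall>\<omega>\<in>rays A \<phi>. \<exists>x. (\<Inter>m. K (\<omega> m)) = {x})"

definition minimal_partition ::
  "('t \<Rightarrow> 't \<Rightarrow> bool) \<Rightarrow> 't \<Rightarrow> ('t \<Rightarrow> 'x set) \<Rightarrow> bool" where
  "minimal_partition A \<phi> K \<longleftrightarrow>
     (\<forall>w. K w - (\<Union>v\<in>level A \<phi> (height A \<phi> w) - {w}. K v) \<noteq> {})"


section \<open>Weight functions\<close>

definition Lam :: "('t \<Rightarrow> 't \<Rightarrow> bool) \<Rightarrow> 't \<Rightarrow> ('t \<Rightarrow> real) \<Rightarrow> real \<Rightarrow> 't set" where
  "Lam A \<phi> g s = (if s \<ge> 1 then {\<phi>} else {w. g (parent A \<phi> w) > s \<and> s \<ge> g w})"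

definition weight_nbhd ::
  "('t \<Rightarrow> 't \<Rightarrow> bool) \<Rightarrow> 't \<Rightarrow> ('t \<Rightarrow> 'x set) \<Rightarrow> ('t \<Rightarrow> real) \<Rightarrow> nat \<Rightarrow> 'x \<Rightarrow> real \<Rightarrow> 'x set" where
  "weight_nbhd A \<phi> K g M x s =
     {y. \<exists>w :: nat \<Rightarrow> 't. (\<forall>i\<in>{1..M+1}. w i \<in> Lam A \<phi> g s) \<and>
           x \<in> K (w 1) \<and> y \<in> K (w (M+1)) \<and>
           (\<forall>i\<in>{1..M}. K (w i) \<inter> K (w (i+1)) \<noteq> {})}"

definition exponential :: "('t \<Rightarrow> 't \<Rightarrow> bool) \<Rightarrow> 't \<Rightarrow> ('t \<Rightarrow> real) \<Rightarrow> bool" where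
  "exponential A \<phi> g \<longleftrightarrow>
     (\<exists>m::nat. \<exists>c1. 0 < c1 \<and> c1 < 1 \<and>
        (\<forall>w. \<forall>v\<in>subtree A \<phi> w. height A \<phi> v \<ge> height A \<phi> w + m \<longrightarrow> g v \<le> c1 * g w)) \<and>
     (\<exists>c2. 0 < c2 \<and> c2 < 1 \<and> (\<forall>w. \<forall>v\<in>children A \<phi> w. g v \<ge> c2 * g w))"

definition uniformly_finite ::
  "('t \<Rightarrow> 't \<Rightarrow> bool) \<Rightarrow> 't \<Rightarrow> ('t \<Rightarrow> 'x set) \<Rightarrow> ('t \<Rightarrow> real) \<Rightarrow> bool" where
  "uniformly_finite A \<phi> K g \<longleftrightarrow>
     (\<exists>C::nat. \<forall>s\<in>{0<..1}. \<forall>w\<in>Lam A \<phi> g s.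
        finite {v \<in> Lam A \<phi> g s. K v \<inter> K w \<noteq> {}} \<and>
        card {v \<in> Lam A \<phi> g s. K v \<inter> K w \<noteq> {}} \<le> C)"

definition thick ::
  "('t \<Rightarrow> 't \<Rightarrow> bool) \<Rightarrow> 't \<Rightarrow> ('t \<Rightarrow> 'x set) \<Rightarrow> ('t \<Rightarrow> real) \<Rightarrow> bool" where
  "thick A \<phi> K g \<longleftrightarrow>
     (\<exists>M\<ge>1. \<exists>\<alpha>>0. \<forall>s\<in>{0<..1}. \<forall>w\<in>Lam A \<phi> g s.
        \<exists>x\<in>K w. weight_nbhd A \<phi> K g M x (\<alpha> * s) \<subseteq> K w)"


section \<open>Metrics\<close>

text \<open>Meaningful for sets that are bounded with respect to \<open>d\<close>, since \<open>SUP\<close> is taken in the reals.\<close>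

definition mdiam :: "('x \<Rightarrow> 'x \<Rightarrow> real) \<Rightarrow> 'x set \<Rightarrow> real" where
  "mdiam d S = (if S = {} then 0 else SUP (x,y)\<in>S \<times> S. d x y)"

definition compatible_metric :: "'x topology \<Rightarrow> ('x \<Rightarrow> 'x \<Rightarrow> real) \<Rightarrow> bool" where
  "compatible_metric X d \<longleftrightarrow>
     Metric_space (topspace X) d \<and> Metric_space.mtopology (topspace X) d = X \<and>
     mdiam d (topspace X) = 1"

definition diam_weight :: "('t \<Rightarrow> 'x set) \<Rightarrow> ('x \<Rightarrow> 'x \<Rightarrow> real) \<Rightarrow> 't \<Rightarrow> real" where
  "diam_weight K d w = mdiam d (K w)"

definition adapted ::
  "('t \<Rightarrow> 't \<Rightarrow> bool) \<Rightarrow> 't \<Rightarrow> 'x topology \<Rightarrow> ('t \<Rightarrow> 'x set) \<Rightarrow> nat \<Rightarrow> ('x \<Rightarrow> 'x \<Rightarrow> real) \<Rightarrow> bool" where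
  "adapted A \<phi> X K M d \<longleftrightarrow>
     (\<exists>\<alpha>1>0. \<exists>\<alpha>2>0. \<forall>x\<in>topspace X. \<forall>r>0.
        weight_nbhd A \<phi> K (diam_weight K d) M x (\<alpha>1 * r) \<subseteq> Metric_space.mball (topspace X) d x r \<and>
        Metric_space.mball (topspace X) d x r \<subseteq> weight_nbhd A \<phi> K (diam_weight K d) M x (\<alpha>2 * r))"


section \<open>Ahlfors regular conformal dimension\<close>

definition quasisymmetric ::
  "'x set \<Rightarrow> ('x \<Rightarrow> 'x \<Rightarrow> real) \<Rightarrow> ('x \<Rightarrow> 'x \<Rightarrow> real) \<Rightarrow> bool" where
  "quasisymmetric S d \<rho> \<longleftrightarrow>
     (\<exists>h h' :: real \<Rightarrow> real. homeomorphism {0..} {0..} h h' \<and> h 0 = 0 \<and>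
        (\<forall>t>0. \<forall>x\<in>S. \<forall>y\<in>S. \<forall>z\<in>S. d x z < t * d x y \<longrightarrow> \<rho> x z < h t * \<rho> x y))"

abbreviation borel_sets :: "'x topology \<Rightarrow> 'x set set" where
  "borel_sets X \<equiv> sigma_sets (topspace X) {U. openin X U}"

text \<open>
  Every Borel set is measurable and every measurable set has a Borel hull of the same measure.
\<close>

definition borel_regular :: "'x topology \<Rightarrow> 'x measure \<Rightarrow> bool" where
  "borel_regular X \<mu> \<longleftrightarrow>
     space \<mu> = topspace X \<and> borel_sets X \<subseteq> sets \<mu> \<and>
     (\<forall>S\<in>sets \<mu>. \<exists>B\<in>borel_sets X. S \<subseteq> B \<and> emeasure \<mu> B = emeasure \<mu> S)"

definition Ahlfors_regular ::
  "'x set \<Rightarrow> ('x \<Rightarrow> 'x \<Rightarrow> real) \<Rightarrow> 'x measure \<Rightarrow> real \<Rightarrow> bool" where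
  "Ahlfors_regular S \<rho> \<mu> \<alpha> \<longleftrightarrow>
     (\<exists>C1>0. \<exists>C2>0. \<forall>x\<in>S. \<forall>r\<in>{0..mdiam \<rho> S}.
        ennreal (C1 * r powr \<alpha>) \<le> emeasure \<mu> (Metric_space.mball S \<rho> x r) \<and>
        emeasure \<mu> (Metric_space.mball S \<rho> x r) \<le> ennreal (C2 * r powr \<alpha>))"

definition dim_AR :: "'x set \<Rightarrow> ('x \<Rightarrow> 'x \<Rightarrow> real) \<Rightarrow> ereal" where
  "dim_AR S d = Inf {ereal \<alpha> | \<alpha>. \<alpha> > 0 \<and>
     (\<exists>\<rho> \<mu>. Metric_space S \<rho> \<and> quasisymmetric S d \<rho> \<and>
        borel_regular (Metric_space.mtopology S \<rho>) \<mu> \<and> Ahlfors_regular S \<rho> \<mu> \<alpha>)}"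


section \<open>Horizontal networks\<close>

definition Gam ::
  "('t \<Rightarrow> 't \<Rightarrow> bool) \<Rightarrow> 't \<Rightarrow> ('t \<Rightarrow> 'x set) \<Rightarrow> nat \<Rightarrow> 't \<Rightarrow> 't set" where
  "Gam A \<phi> K M w =
     {u. \<exists>v :: nat \<Rightarrow> 't. v 1 = w \<and> v (M+1) = u \<and>
           (\<forall>i\<in>{1..M+1}. v i \<in> level A \<phi> (height A \<phi> w)) \<and>
           (\<forall>i\<in>{1..M}. K (v i) \<inter> K (v (i+1)) \<noteq> {})}"

definition Jh ::
  "('t \<Rightarrow> 't \<Rightarrow> bool) \<Rightarrow> 't \<Rightarrow> ('t \<Rightarrow> 'x set) \<Rightarrow> nat \<Rightarrow> nat \<Rightarrow> ('t \<times> 't) set" where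
  "Jh A \<phi> K N m = {(w,u). w \<in> level A \<phi> m \<and> u \<in> level A \<phi> m \<and> u \<in> Gam A \<phi> K N w}"

text \<open>
  A network is given by the vertex parts \<open>Am m\<close> in T and \<open>Vm m\<close> in X, and the edge sets \<open>E m\<close>.
  The vertex set is their disjoint union, edges are ordered pairs of vertices.
\<close>

definition net_verts :: "(nat \<Rightarrow> 't set) \<Rightarrow> (nat \<Rightarrow> 'x set) \<Rightarrow> nat \<Rightarrow> ('t + 'x) set" where
  "net_verts Am Vm m = Inl ` Am m \<union> Inr ` Vm m"

definition net_cell ::
  "('t \<Rightarrow> 'x set) \<Rightarrow> (nat \<Rightarrow> 't set) \<Rightarrow> (nat \<Rightarrow> 'x set) \<Rightarrow> nat \<Rightarrow> 't \<Rightarrow> ('t + 'x) set" where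
  "net_cell K Am Vm m w = Inl ` ({w} \<inter> Am m) \<union> Inr ` (Vm m \<inter> K w)"

definition net_cells ::
  "('t \<Rightarrow> 'x set) \<Rightarrow> (nat \<Rightarrow> 't set) \<Rightarrow> (nat \<Rightarrow> 'x set) \<Rightarrow> nat \<Rightarrow> 't set \<Rightarrow> ('t + 'x) set" where
  "net_cells K Am Vm m U = (\<Union>v\<in>U. net_cell K Am Vm m v)"

definition net_edges ::
  "('t \<Rightarrow> 'x set) \<Rightarrow> (nat \<Rightarrow> 't set) \<Rightarrow> (nat \<Rightarrow> 'x set) \<Rightarrow> (nat \<Rightarrow> (('t + 'x) \<times> ('t + 'x)) set)
     \<Rightarrow> nat \<Rightarrow> 't \<Rightarrow> 't \<Rightarrow> (('t + 'x) \<times> ('t + 'x)) set" where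
  "net_edges K Am Vm E m u v =
     {(x,y) \<in> E m. x \<in> net_cell K Am Vm m u \<and> y \<in> net_cell K Am Vm m v}"

definition nondirected_graph :: "'v set \<Rightarrow> ('v \<times> 'v) set \<Rightarrow> bool" where
  "nondirected_graph V E \<longleftrightarrow> E \<subseteq> V \<times> V \<and> sym E"

definition proper_system ::
  "('t \<Rightarrow> 't \<Rightarrow> bool) \<Rightarrow> 't \<Rightarrow> 'x topology \<Rightarrow> ('t \<Rightarrow> 'x set) \<Rightarrow>
   (nat \<Rightarrow> 't set) \<Rightarrow> (nat \<Rightarrow> 'x set) \<Rightarrow> (nat \<Rightarrow> (('t + 'x) \<times> ('t + 'x)) set) \<Rightarrow> bool" where
  "proper_system A \<phi> X K Am Vm E \<longleftrightarrow>
     (\<forall>m. nondirected_graph (net_verts Am Vm m) (E m)) \<and>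
     (\<exists>N\<ge>1. \<exists>L0\<ge>1. \<exists>L1\<ge>1. \<exists>L2\<ge>1.
        (\<forall>m. Am m \<subseteq> level A \<phi> m \<and> Vm m \<subseteq> topspace X) \<and>
        (\<forall>m. \<forall>w\<in>level A \<phi> m. net_cell K Am Vm m w \<noteq> {}) \<and>
        (\<forall>m. \<forall>u\<in>level A \<phi> m. \<forall>v\<in>level A \<phi> m.
           finite (net_edges K Am Vm E m u v) \<and> card (net_edges K Am Vm E m u v) \<le> L0) \<and>
        (\<forall>m. \<forall>(x,y)\<in>E m. \<exists>(u,v)\<in>Jh A \<phi> K N m.
           x \<in> net_cell K Am Vm m u \<and> y \<in> net_cell K Am Vm m v) \<and>
        (\<forall>m. \<forall>(u,v)\<in>Jh A \<phi> K L1 m. \<forall>x\<in>net_cell K Am Vm m u. \<forall>y\<in>net_cell K Am Vm m v.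
           \<exists>n\<ge>1. \<exists>(xs :: nat \<Rightarrow> 't + 'x) (ws :: nat \<Rightarrow> 't).
             (\<forall>i\<in>{1..n}. ws i \<in> Gam A \<phi> K L2 u) \<and>
             (\<forall>i\<in>{1..<n}. (xs i, xs (i+1)) \<in> net_edges K Am Vm E m (ws i) (ws (i+1))) \<and>
             xs 1 = x \<and> xs n = y \<and> ws 1 = u \<and> ws n = v))"

definition net_inner ::
  "('t \<Rightarrow> 't \<Rightarrow> bool) \<Rightarrow> 't \<Rightarrow> ('t \<Rightarrow> 'x set) \<Rightarrow> (nat \<Rightarrow> 't set) \<Rightarrow> (nat \<Rightarrow> 'x set) \<Rightarrow>
   nat \<Rightarrow> 't \<Rightarrow> nat \<Rightarrow> ('t + 'x) set" where
  "net_inner A \<phi> K Am Vm k w n =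
     net_cells K Am Vm (height A \<phi> w + k) (descs A \<phi> k (Gam A \<phi> K n w))"

definition net_outer ::
  "('t \<Rightarrow> 't \<Rightarrow> bool) \<Rightarrow> 't \<Rightarrow> ('t \<Rightarrow> 'x set) \<Rightarrow> (nat \<Rightarrow> 't set) \<Rightarrow> (nat \<Rightarrow> 'x set) \<Rightarrow>
   nat \<Rightarrow> 't \<Rightarrow> nat \<Rightarrow> ('t + 'x) set" where
  "net_outer A \<phi> K Am Vm k w n =
     net_cells K Am Vm (height A \<phi> w + k)
       (level A \<phi> (height A \<phi> w + k) - descs A \<phi> k (Gam A \<phi> K n w))"


section \<open>Moduli and critical exponents\<close>

text \<open>The end points \<open>x0\<close>, \<open>x1\<close> do not belong to the path, and the path is not empty.\<close>

definition connecting_paths ::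
  "'v set \<Rightarrow> ('v \<times> 'v) set \<Rightarrow> 'v set \<Rightarrow> 'v set \<Rightarrow> 'v list set" where
  "connecting_paths V E U1 U2 =
     {xs. xs \<noteq> [] \<and> set xs \<subseteq> V \<and>
        (\<exists>x0\<in>U1. \<exists>x1\<in>U2. successively (\<lambda>x y. (x,y) \<in> E) (x0 # xs @ [x1]))}"

definition Modulus ::
  "real \<Rightarrow> 'v set \<Rightarrow> ('v \<times> 'v) set \<Rightarrow> 'v set \<Rightarrow> 'v set \<Rightarrow> ennreal" where
  "Modulus p V E U1 U2 =
     (INF f\<in>{f :: 'v \<Rightarrow> real. (\<forall>x\<in>V. 0 \<le> f x) \<and>
               (\<forall>xs\<in>connecting_paths V E U1 U2. (\<Sum>x\<leftarrow>xs. f x) \<ge> 1)}.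
        \<Sum>\<^sub>\<infinity>x\<in>V. ennreal (f x powr p))"

definition net_modulus ::
  "('t \<Rightarrow> 't \<Rightarrow> bool) \<Rightarrow> 't \<Rightarrow> ('t \<Rightarrow> 'x set) \<Rightarrow>
   (nat \<Rightarrow> 't set) \<Rightarrow> (nat \<Rightarrow> 'x set) \<Rightarrow> (nat \<Rightarrow> (('t + 'x) \<times> ('t + 'x)) set) \<Rightarrow>
   real \<Rightarrow> nat \<Rightarrow> nat \<Rightarrow> nat \<Rightarrow> ennreal" where
  "net_modulus A \<phi> K Am Vm E p k N1 N2 =
     (SUP w. Modulus p (net_verts Am Vm (height A \<phi> w + k)) (E (height A \<phi> w + k))
               (net_inner A \<phi> K Am Vm k w N1) (net_outer A \<phi> K Am Vm k w N2))"

definition upper_exponent ::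
  "('t \<Rightarrow> 't \<Rightarrow> bool) \<Rightarrow> 't \<Rightarrow> ('t \<Rightarrow> 'x set) \<Rightarrow>
   (nat \<Rightarrow> 't set) \<Rightarrow> (nat \<Rightarrow> 'x set) \<Rightarrow> (nat \<Rightarrow> (('t + 'x) \<times> ('t + 'x)) set) \<Rightarrow>
   nat \<Rightarrow> nat \<Rightarrow> ereal" where
  "upper_exponent A \<phi> K Am Vm E N1 N2 =
     Inf {ereal p | p. p > 0 \<and> limsup (\<lambda>k. net_modulus A \<phi> K Am Vm E p k N1 N2) = 0}"

definition lower_exponent ::
  "('t \<Rightarrow> 't \<Rightarrow> bool) \<Rightarrow> 't \<Rightarrow> ('t \<Rightarrow> 'x set) \<Rightarrow>
   (nat \<Rightarrow> 't set) \<Rightarrow> (nat \<Rightarrow> 'x set) \<Rightarrow> (nat \<Rightarrow> (('t + 'x) \<times> ('t + 'x)) set) \<Rightarrow>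
   nat \<Rightarrow> nat \<Rightarrow> ereal" where
  "lower_exponent A \<phi> K Am Vm E N1 N2 =
     Inf {ereal p | p. p > 0 \<and> liminf (\<lambda>k. net_modulus A \<phi> K Am Vm E p k N1 N2) = 0}"

end

theory Submission
  imports Defs
begin

text \<open>
  Given \<open>p\<close> with vanishing lower modulus, one keeps only every \<open>k\<close>-th level of the tree, for a \<open>k\<close>
  at which all moduli are tiny. The almost optimal functions then prescribe ratios of successive
  diameters, smoothed by an exponential kernel so that neighbouring cells stay comparable; the
  admissibility of these functions bounds the length of every chain of cells from below, and their
  small \<open>p\<close>-energy makes the \<open>p\<close>-th powers of the diameters subadditive over children. The missing
  mass is given to one child in the interior of its parent, which turns the \<open>p\<close>-th powers
  into an additive measure and does not affect comparability. Chain length and this measure form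
  a \<open>p\<close>-Ahlfors regular structure quasisymmetric to \<open>d\<close>, so the dimension is at most \<open>p\<close>.
  Conversely, for an \<open>\<alpha>\<close>-regular metric the diameters of the cells in that metric, normalised by
  the diameter of \<open>K w\<close>, are admissible functions, and for \<open>p > \<alpha>\<close> their \<open>p\<close>-energy tends to zero.
\<close>

section \<open>Hierarchies of cells\<close>

text \<open>The diameters have two conflicting duties: long chains want them large, additivity wants
  their \<open>p\<close>-th powers to sum up to that of the parent. The duties are separated.
  \<open>E\<close> is small enough to be subadditive and large enough for the crossing estimate; the
  masses \<open>m\<close> are additive, and from parent to child the density \<open>m / E\<close>
  can only grow, so bounds for chains survive the correction. It grows only at a child all of whose
  neighbours have the same parent. Neighbours with different parents therefore keep the densities of
  their parents, and the comparability constant does not deteriorate with the depth. Skipping levels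
  serves four purposes with one \<open>k\<close>: small moduli, at least two descendants, an
  interior descendant, and graph distances that shrink by the factor 4, up to a constant, from a
  level to the one above. The last one allows the smoothing to be summed. The gap between
  \<open>N1\<close> and \<open>N2\<close> is matched to a separation property: cells of one level
  that are not joined by \<open>M\<close> steps have distance at least a constant times the scale of
  the level. This keeps inner and outer sets apart in \<open>d\<close>, hence in every
  quasisymmetric metric.\<close>

locale hierarchy =
  fixes C :: "'t set" and lev :: "'t \<Rightarrow> nat" and par :: "'t \<Rightarrow> 't"
    and K :: "'t \<Rightarrow> 'x set" and S :: "'x set"
  assumes par_C: "\<lbrakk>v \<in> C; lev v = Suc n\<rbrakk> \<Longrightarrow> par v \<in> C \<and> lev (par v) = n"
    and K_ne: "v \<in> C \<Longrightarrow> K v \<noteq> {}"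
    and fin_level: "finite {v \<in> C. lev v = n}"
    and K_root: "(\<Union>v\<in>{v \<in> C. lev v = 0}. K v) = S"
    and K_children: "w \<in> C \<Longrightarrow> K w = (\<Union>v\<in>{v \<in> C. lev v = Suc (lev w) \<and> par v = w}. K v)"
begin

definition V :: "nat \<Rightarrow> 't set" where "V n = {v \<in> C. lev v = n}"

definition anc :: "nat \<Rightarrow> 't \<Rightarrow> 't" where "anc n v = (par ^^ (lev v - n)) v"

text \<open>Reflexive on \<open>C\<close> because cells are nonempty. Hence, for cells,
  \<open>adj ^^ i\<close> means being joined by at most \<open>i\<close> steps, which is the
  relation behind \<open>Gam\<close>.\<close>

definition adj :: "('t \<times> 't) set" where
  "adj = {(v,v'). v \<in> C \<and> v' \<in> C \<and> lev v = lev v' \<and> K v \<inter> K v' \<noteq> {}}"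

lemma V_iff: "v \<in> V n \<longleftrightarrow> v \<in> C \<and> lev v = n"
  by (simp add: V_def)

lemma finite_V [simp]: "finite (V n)"
  using fin_level by (simp add: V_def)

lemma par_V: "v \<in> V (Suc n) \<Longrightarrow> par v \<in> V n"
  using par_C by (auto simp: V_iff)

lemma K_eq: "w \<in> V n \<Longrightarrow> K w = (\<Union>v\<in>{v \<in> V (Suc n). par v = w}. K v)"
  using K_children[of w] by (auto simp: V_iff)

lemma anc_self [simp]: "anc (lev v) v = v"
  by (simp add: anc_def)

lemma funpow_par_V: "v \<in> V (n + k) \<Longrightarrow> (par ^^ k) v \<in> V n"
proof (induction k arbitrary: n)
  case (Suc k)
  then have "(par ^^ k) v \<in> V (Suc n)" by simp
  then show ?case using par_V by simp
qed simp

lemma anc_V: "\<lbrakk>v \<in> C; n \<le> lev v\<rbrakk> \<Longrightarrow> anc n v \<in> V n"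
  using funpow_par_V[of v n "lev v - n"] by (simp add: anc_def V_iff)

lemma par_anc: "\<lbrakk>v \<in> C; Suc n \<le> lev v\<rbrakk> \<Longrightarrow> par (anc (Suc n) v) = anc n v"
proof -
  assume a: "v \<in> C" "Suc n \<le> lev v"
  then have "lev v - n = Suc (lev v - Suc n)" by simp
  then show ?thesis by (simp add: anc_def)
qed

lemma anc_anc: "\<lbrakk>v \<in> C; n \<le> m; m \<le> lev v\<rbrakk> \<Longrightarrow> anc n (anc m v) = anc n v"
proof -
  assume a: "v \<in> C" "n \<le> m" "m \<le> lev v"
  have "lev (anc m v) = m" using anc_V a by (simp add: V_iff)
  moreover have "lev v - n = (m - n) + (lev v - m)" using a by simp
  ultimately show ?thesis unfolding anc_def by (simp add: funpow_add)
qed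

lemma K_par: "v \<in> V (Suc n) \<Longrightarrow> K v \<subseteq> K (par v)"
  using K_eq[of "par v" n] par_V[of v n] by auto

lemma K_anc: "\<lbrakk>v \<in> C; n \<le> lev v\<rbrakk> \<Longrightarrow> K v \<subseteq> K (anc n v)"
proof (induction "lev v - n" arbitrary: n)
  case 0
  then have "n = lev v" by simp
  then show ?case by simp
next
  case (Suc k)
  then have "Suc n \<le> lev v" by simp
  with Suc have "K v \<subseteq> K (anc (Suc n) v)" by simp
  also have "\<dots> \<subseteq> K (anc n v)"
    using K_par[of "anc (Suc n) v" n] par_anc[of v n] anc_V[of v "Suc n"] Suc \<open>Suc n \<le> lev v\<close> by simp
  finally show ?case .
qed

lemma cell_below:
  assumes "w \<in> V n" "x \<in> K w" "n \<le> m"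
  obtains v where "v \<in> V m" "anc n v = w" "x \<in> K v"
proof -
  have "\<exists>v\<in>V (n + k). anc n v = w \<and> x \<in> K v" for k
  proof (induction k)
    case 0
    then show ?case using assms by (auto simp: V_iff intro!: bexI[of _ w])
  next
    case (Suc k)
    then obtain v where v: "v \<in> V (n + k)" "anc n v = w" "x \<in> K v" by auto
    then obtain u where u: "u \<in> V (Suc (n + k))" "par u = v" "x \<in> K u"
      using K_eq[OF v(1)] by auto
    have "anc (n + k) u = v" using u par_anc[of u "n+k"] anc_self[of u] by (simp add: V_iff)
    then have "anc n u = w" using anc_anc[of u n "n+k"] u v by (simp add: V_iff)
    then show ?case using u by auto
  qed
  from this[of "m - n"] show ?thesis using assms that by auto
qed

lemma cell_at:
  assumes "x \<in> S" obtains v where "v \<in> V n" "x \<in> K v"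
proof -
  obtain w where "w \<in> V 0" "x \<in> K w" using assms K_root by (auto simp: V_def)
  then show ?thesis using cell_below[of w 0 x n] that by auto
qed

lemma K_subset_S: "v \<in> C \<Longrightarrow> K v \<subseteq> S"
proof -
  assume v: "v \<in> C"
  have "K v \<subseteq> K (anc 0 v)" using K_anc[OF v, of 0] by simp
  also have "\<dots> \<subseteq> S"
    unfolding K_root[symmetric] using anc_V[OF v, of 0] by (intro UN_upper) (simp add: V_def)
  finally show ?thesis .
qed

lemma adj_refl: "v \<in> C \<Longrightarrow> (v,v) \<in> adj"
  using K_ne by (simp add: adj_def)

lemma sym_adj: "sym adj"
  by (rule symI) (simp add: adj_def Int_commute)

text \<open>Cells grow on passing to ancestors, so they keep touching. The two cells may have
  different levels, as is needed for chains that mix levels.\<close>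

lemma adj_anc:
  assumes "v \<in> C" "v' \<in> C" "n \<le> lev v" "n \<le> lev v'" "K v \<inter> K v' \<noteq> {}"
  shows "(anc n v, anc n v') \<in> adj"
proof -
  have "anc n v \<in> V n" "anc n v' \<in> V n" using anc_V assms by blast+
  moreover have "K v \<subseteq> K (anc n v)" "K v' \<subseteq> K (anc n v')" using K_anc assms by blast+
  then have "K (anc n v) \<inter> K (anc n v') \<noteq> {}" using assms(5) by blast
  ultimately show ?thesis unfolding adj_def V_iff by simp
qed

lemma adj_D: "(u,v) \<in> adj \<Longrightarrow> u \<in> C \<and> v \<in> C \<and> lev u = lev v \<and> K u \<inter> K v \<noteq> {}"
  by (simp add: adj_def)

lemma adj_pow_C: "(u,v) \<in> adj ^^ i \<Longrightarrow> u \<in> C \<Longrightarrow> v \<in> C \<and> lev v = lev u"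
proof (induction i arbitrary: v)
  case (Suc i)
  then obtain z where z: "(u,z) \<in> adj ^^ i" "(z,v) \<in> adj" by auto
  show ?case using Suc.IH[OF z(1) Suc.prems(2)] adj_D[OF z(2)] by simp
qed simp

lemma adj_pow_V: "(u,v) \<in> adj ^^ i \<Longrightarrow> u \<in> V n \<Longrightarrow> v \<in> V n"
  using adj_pow_C[of u v i] by (simp add: V_iff)

lemma adj_pow_sym: "(u,v) \<in> adj ^^ i \<Longrightarrow> (v,u) \<in> adj ^^ i"
proof (induction i arbitrary: v)
  case (Suc i)
  then obtain z where "(u,z) \<in> adj ^^ i" "(z,v) \<in> adj" by auto
  then have "(v,z) \<in> adj" "(z,u) \<in> adj ^^ i" using Suc sym_adj by (auto dest: symD)
  then show ?case by (rule relpow_Suc_I2)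
qed simp

lemma adj_pow_trans: "(u,v) \<in> adj ^^ i \<Longrightarrow> (v,w) \<in> adj ^^ j \<Longrightarrow> (u,w) \<in> adj ^^ (i + j)"
  by (auto simp: relpow_add)

lemma adj_pow_refl: "u \<in> C \<Longrightarrow> (u,u) \<in> adj ^^ i"
  by (induction i) (auto intro: adj_refl)

lemma adj_pow_mono:
  assumes "(u,v) \<in> adj ^^ i" "i \<le> j" "u \<in> C" shows "(u,v) \<in> adj ^^ j"
  using adj_pow_trans[OF adj_pow_refl[OF assms(3), of "j-i"] assms(1)] assms(2) by simp

lemma adj_pow_anc:
  assumes "(u,v) \<in> adj ^^ i" "u \<in> C" "n \<le> lev u"
  shows "(anc n u, anc n v) \<in> adj ^^ i"
  using assms
proof (induction i arbitrary: v)
  case (Suc i)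
  then obtain z where z: "(u,z) \<in> adj ^^ i" "(z,v) \<in> adj" by auto
  have "z \<in> C" "lev z = lev u" using adj_pow_C[OF z(1)] Suc by auto
  then have "(anc n z, anc n v) \<in> adj" using adj_D[OF z(2)] Suc.prems by (intro adj_anc) simp_all
  then show ?case using Suc z by auto
qed simp

end

locale bounded_hierarchy = hierarchy +
  fixes L :: nat
  assumes card_adj: "v \<in> C \<Longrightarrow> card (adj `` {v}) \<le> L"
begin

lemma finite_pow: "v \<in> C \<Longrightarrow> finite ((adj ^^ i) `` {v})"
  by (rule finite_subset[OF _ finite_V[of "lev v"]]) (metis Image_singleton_iff V_iff adj_pow_C subsetI)

lemma card_pow: "v \<in> C \<Longrightarrow> card ((adj ^^ i) `` {v}) \<le> L ^ i"
proof (induction i)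
  case (Suc i)
  have "(adj ^^ Suc i) `` {v} = (\<Union>u\<in>(adj ^^ i) `` {v}. adj `` {u})" by auto
  then have "card ((adj ^^ Suc i) `` {v}) \<le> (\<Sum>u\<in>(adj ^^ i) `` {v}. card (adj `` {u}))"
    using card_UN_le[OF finite_pow[OF Suc.prems, of i]] by metis
  also have "\<dots> \<le> (\<Sum>u\<in>(adj ^^ i) `` {v}. L)"
    by (intro sum_mono card_adj) (use Suc.prems adj_pow_C in blast)
  also have "\<dots> \<le> L ^ i * L" using Suc by (auto)
  finally show ?case by (simp add: mult.commute)
qed simp

lemma L_ge_1: "v \<in> C \<Longrightarrow> 1 \<le> L"
proof -
  assume v: "v \<in> C"
  have "v \<in> adj `` {v}" using adj_refl[OF v] by auto
  moreover have "finite (adj `` {v})" using finite_pow[OF v, of 1] by simp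
  ultimately have "0 < card (adj `` {v})" by (auto simp: card_gt_0_iff)
  then show ?thesis using card_adj[OF v] by linarith
qed

end


section \<open>Subadditive weights with a crossing property\<close>

text \<open>\<open>G w u\<close> plays the \<open>p\<close>-th power of the ratio of the diameters
  of \<open>u\<close> and \<open>w\<close>. In \<open>G_sum\<close>, the power of
  \<open>2 * real L\<close> is the loss in \<open>E_term\<close> and 4 is the product of two kernel
  sums. In \<open>G_cross\<close>, the power of \<open>L\<close> is the multiplicity with which a
  cell is counted in \<open>crossing\<close>.\<close>

locale weighted_hierarchy = bounded_hierarchy +
  fixes N :: nat and G :: "'a \<Rightarrow> 'a \<Rightarrow> real" and p a :: real
  assumes N_pos: "1 \<le> N" and p_pos: "0 < p" and a_pos: "0 < a"
    and hop: "\<lbrakk>u \<in> V (Suc n); (u,v) \<in> adj ^^ (4 * N)\<rbrakk> \<Longrightarrow> (par u, par v) \<in> adj ^^ N"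
    and G_nonneg: "0 \<le> G w u"
    and G_supp: "\<lbrakk>w \<in> V n; u \<in> V (Suc n); G w u \<noteq> 0\<rbrakk> \<Longrightarrow> (w, par u) \<in> adj ^^ (N + 1)"
    and G_floor: "\<lbrakk>w \<in> V n; u \<in> V (Suc n); par u = w\<rbrakk> \<Longrightarrow> a \<le> G w u"
    and G_sum: "w \<in> V n \<Longrightarrow> 4 * (2 * real L) ^ (8 * N + 4) * (\<Sum>u\<in>V (Suc n). G w u) \<le> 1"
    and G_cross: "\<lbrakk>w \<in> V n; us \<noteq> []; set us \<subseteq> V (Suc n); successively (\<lambda>u v. (u,v) \<in> adj) us;
        \<forall>u\<in>set us. (w, par u) \<in> adj ^^ (N + 1); par (hd us) = w; (w, par (last us)) \<notin> adj ^^ N\<rbrakk>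
        \<Longrightarrow> real L ^ (N + 1) \<le> (\<Sum>u\<in>set us. G w u powr (1 / p))"
    and C_ne: "C \<noteq> {}"
begin

lemma L_pos: "0 < L"
proof -
  obtain v where "v \<in> C" using C_ne by auto
  then show ?thesis using L_ge_1[of v] by simp
qed

section \<open>Exponential kernels on a level and the smoothed weights\<close>

definition gd :: "'a \<Rightarrow> 'a \<Rightarrow> nat" where "gd u v = (LEAST i. (u,v) \<in> adj ^^ i)"

text \<open>The test guards against cells in different components, for which the
  \<open>LEAST\<close> in \<open>gd\<close> is arbitrary.\<close>

definition ker :: "real \<Rightarrow> 'a \<Rightarrow> 'a \<Rightarrow> real" where
  "ker c u v = (if \<exists>i. (u,v) \<in> adj ^^ i then c ^ gd u v else 0)"

definition b :: real where "b = 1 / (2 * real L)"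

lemma b_pos: "0 < b" and b_le_1: "b \<le> 1" and bL: "b * real L = 1/2"
  using L_pos by (auto simp: b_def field_simps)

lemma bb_pos: "0 < b * b" and bb_le_1: "b * b \<le> 1"
  using b_pos b_le_1 by (auto simp: mult_le_one)

lemma gd_pow: "(u,v) \<in> adj ^^ i \<Longrightarrow> (u,v) \<in> adj ^^ gd u v"
  unfolding gd_def by (rule LeastI)

lemma gd_le: "(u,v) \<in> adj ^^ i \<Longrightarrow> gd u v \<le> i"
  unfolding gd_def by (rule Least_le)

lemma ker_nonneg: "0 \<le> c \<Longrightarrow> 0 \<le> ker c u v"
  by (simp add: ker_def)

lemma ker_eq: "(u,v) \<in> adj ^^ i \<Longrightarrow> ker c u v = c ^ gd u v"
  by (auto simp: ker_def)

lemma ker_self: "ker c u u = 1"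
proof -
  have r: "(u,u) \<in> adj ^^ 0" by simp
  then have "gd u u = 0" using gd_le[OF r] by simp
  then show ?thesis using ker_eq[OF r] by simp
qed

lemma ker_adj:
  assumes "0 < c" "c \<le> 1" "(v,v') \<in> adj" shows "c * ker c u v \<le> ker c u v'"
proof (cases "\<exists>i. (u,v) \<in> adj ^^ i")
  case True
  then have "(u,v) \<in> adj ^^ gd u v" using gd_pow by blast
  then have r: "(u,v') \<in> adj ^^ Suc (gd u v)" using assms(3) by auto
  then have "c ^ Suc (gd u v) \<le> c ^ gd u v'"
    using assms gd_le[OF r] by (intro power_decreasing) auto
  moreover have "ker c u v' = c ^ gd u v'" by (rule ker_eq[OF r])
  ultimately show ?thesis using True by (simp add: ker_def)
next
  case False
  then show ?thesis using ker_nonneg[of c u v'] assms by (simp add: ker_def)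
qed

text \<open>At most \<open>L ^ i\<close> cells have distance \<open>i\<close>, and \<open>b\<close>
  is chosen as \<open>1 / (2 * real L)\<close> so that they contribute at most
  \<open>(1/2) ^ i\<close> together; the geometric series has sum 2.\<close>

lemma ker_sum:
  assumes "u \<in> C" shows "(\<Sum>v\<in>V n. ker b u v) \<le> 2"
proof -
  define A where "A = {v \<in> V n. \<exists>i. (u,v) \<in> adj ^^ i}"
  have fA: "finite A" by (simp add: A_def)
  have "(\<Sum>v\<in>V n. ker b u v) = (\<Sum>v\<in>A. ker b u v)"
    by (rule sum.mono_neutral_right) (auto simp: A_def ker_def)
  also have "\<dots> = (\<Sum>v\<in>A. b ^ gd u v)" by (rule sum.cong) (auto simp: A_def ker_def)
  also have "\<dots> = (\<Sum>i\<in>gd u ` A. \<Sum>v\<in>{v \<in> A. gd u v = i}. b ^ gd u v)"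
    by (rule sum.image_gen[OF fA])
  also have "\<dots> \<le> (\<Sum>i\<in>gd u ` A. (1/2) ^ i)"
  proof (rule sum_mono)
    fix i assume "i \<in> gd u ` A"
    have "{v \<in> A. gd u v = i} \<subseteq> (adj ^^ i) `` {u}" using gd_pow by (auto simp: A_def)
    then have "card {v \<in> A. gd u v = i} \<le> L ^ i"
      using card_mono[OF finite_pow[OF assms]] card_pow[OF assms] order_trans by blast
    then have c: "real (card {v \<in> A. gd u v = i}) \<le> real L ^ i"
      by (metis of_nat_le_iff of_nat_power)
    have "(\<Sum>v\<in>{v \<in> A. gd u v = i}. b ^ gd u v) = real (card {v \<in> A. gd u v = i}) * b ^ i" by simp
    also have "\<dots> \<le> real L ^ i * b ^ i" using c b_pos by (intro mult_right_mono) auto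
    also have "\<dots> = (1/2) ^ i" by (metis bL mult.commute power_mult_distrib)
    finally show "(\<Sum>v\<in>{v \<in> A. gd u v = i}. b ^ gd u v) \<le> (1/2) ^ i" .
  qed
  also have "\<dots> \<le> (\<Sum>i. (1/2::real) ^ i)"
    by (intro sum_le_suminf summable_geometric) (auto simp: fA)
  also have "\<dots> = 2" by (subst suminf_geometric) auto
  finally show ?thesis .
qed

text \<open>
  The kernel \<open>ker (b * b)\<close> makes \<open>E\<close> vary by at most the factor \<open>b * b\<close> between neighbours; by
  \<open>hop\<close>, distances in level \<open>Suc n\<close> are so much larger than those in level \<open>n\<close> that the kernel
  beats this variation (\<open>E_term\<close>) and the sums in \<open>E_children\<close> stay bounded.
\<close>

primrec E :: "nat \<Rightarrow> 'a \<Rightarrow> real" where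
  "E 0 v = 1"
| "E (Suc n) v = (\<Sum>w\<in>V n. \<Sum>u\<in>V (Suc n). E n w * G w u * ker (b * b) u v)"

lemma E_nonneg: "0 \<le> E n v"
proof (induction n arbitrary: v)
  case (Suc n)
  then show ?case
    using G_nonneg ker_nonneg[of "b*b"] bb_pos by (auto intro!: sum_nonneg mult_nonneg_nonneg)
qed simp

lemma E_adj:
  assumes "(v,v') \<in> adj" shows "b * b * E n v \<le> E n v'"
proof (cases n)
  case 0
  then show ?thesis using bb_le_1 by simp
next
  case (Suc m)
  have "b * b * E n v = (\<Sum>w\<in>V m. \<Sum>u\<in>V (Suc m). E m w * G w u * (b * b * ker (b * b) u v))"
    unfolding Suc E.simps sum_distrib_left by (intro sum.cong refl) (simp add: algebra_simps)
  also have "\<dots> \<le> E n v'"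
    unfolding Suc E.simps using ker_adj[OF bb_pos bb_le_1 assms]
    by (intro sum_mono mult_left_mono mult_nonneg_nonneg E_nonneg G_nonneg)
  finally show ?thesis .
qed

lemma E_pow: "(v,v') \<in> adj ^^ i \<Longrightarrow> (b * b) ^ i * E n v \<le> E n v'"
proof (induction i arbitrary: v')
  case (Suc i)
  then obtain z where z: "(v,z) \<in> adj ^^ i" "(z,v') \<in> adj" by auto
  have "(b * b) ^ Suc i * E n v = b * b * ((b * b) ^ i * E n v)" by simp
  also have "\<dots> \<le> b * b * E n z" using Suc.IH[OF z(1)] bb_pos by (intro mult_left_mono) auto
  also have "\<dots> \<le> E n v'" using E_adj[OF z(2)] .
  finally show ?case .
qed simp

text \<open>This is a single summand of the double sum defining \<open>E (Suc n) u\<close>, as the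
  kernel is 1 on the diagonal.\<close>

lemma E_G:
  assumes "w \<in> V n" "u \<in> V (Suc n)" shows "E n w * G w u \<le> E (Suc n) u"
proof -
  have nn: "0 \<le> E n w * G w u' * ker (b * b) u' u" for w u'
    using E_nonneg G_nonneg ker_nonneg[of "b*b"] bb_pos by (intro mult_nonneg_nonneg) auto
  have "E n w * G w u = E n w * G w u * ker (b * b) u u" by (simp add: ker_self)
  also have "\<dots> \<le> (\<Sum>u'\<in>V (Suc n). E n w * G w u' * ker (b * b) u' u)"
    by (rule member_le_sum[of u]) (use assms nn in auto)
  also have "\<dots> \<le> E (Suc n) u" unfolding E.simps
    by (rule member_le_sum[of w _ "\<lambda>w. \<Sum>u'\<in>V (Suc n). E n w * G w u' * ker (b * b) u' u"])
      (use assms nn in \<open>auto intro: sum_nonneg\<close>)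
  finally show ?thesis .
qed

lemma E_floor: "v \<in> V (Suc n) \<Longrightarrow> a * E n (par v) \<le> E (Suc n) v"
proof -
  assume v: "v \<in> V (Suc n)"
  have "E n (par v) * a \<le> E n (par v) * G (par v) v"
    by (rule mult_left_mono[OF G_floor[OF par_V[OF v] v refl] E_nonneg])
  also have "\<dots> \<le> E (Suc n) v" by (rule E_G[OF par_V[OF v] v])
  finally show ?thesis by (simp add: mult.commute)
qed

lemma E_pos: "v \<in> V n \<Longrightarrow> 0 < E n v"
proof (induction n arbitrary: v)
  case (Suc n)
  then have "0 < a * E n (par v)" using a_pos par_V by simp
  then show ?case using E_floor[OF Suc.prems] by linarith
qed simp

text \<open>\<open>hop\<close> is applied to blocks of \<open>4 * N\<close> steps; the incomplete
  last block is padded by reflexivity, whence the \<open>+ 1\<close>.\<close>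

lemma hop_iter:
  assumes "u \<in> V (Suc n)" "(u,v) \<in> adj ^^ i"
  shows "(par u, par v) \<in> adj ^^ (N * (i div (4 * N) + 1))"
proof -
  have *: "(par u, par v) \<in> adj ^^ (N * q)" if "(u,v) \<in> adj ^^ (4 * N * q)" for q v
    using that
  proof (induction q arbitrary: v)
    case (Suc q)
    then have "(u,v) \<in> adj ^^ (4 * N * q + 4 * N)" by (simp add: algebra_simps)
    then obtain z where z: "(u,z) \<in> adj ^^ (4 * N * q)" "(z,v) \<in> adj ^^ (4 * N)"
      unfolding relpow_add by auto
    have "z \<in> V (Suc n)" using adj_pow_V[OF z(1)] assms by simp
    then have "(par z, par v) \<in> adj ^^ N" using hop z by blast
    then have "(par u, par v) \<in> adj ^^ (N * q + N)" using Suc.IH[OF z(1)] adj_pow_trans by blast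
    then show ?case by (simp add: algebra_simps)
  qed simp
  have "i \<le> 4 * N * (i div (4 * N) + 1)"
    using N_pos dividend_less_times_div[of "4 * N" i] by (simp add: algebra_simps)
  then have "(u,v) \<in> adj ^^ (4 * N * (i div (4 * N) + 1))"
    using adj_pow_mono[OF assms(2)] assms(1) by (simp add: V_iff)
  then show ?thesis by (rule *)
qed

text \<open>The factor \<open>(b * b) ^ i\<close> with \<open>i\<close> the distance of
  \<open>u\<close> and \<open>v\<close> is spent three times: on a kernel in \<open>u\<close> and
  \<open>v\<close>, on a kernel in \<open>par v\<close> and \<open>w\<close>, and on replacing
  \<open>E n w\<close> by \<open>E n (par v)\<close>. What remains can be summed over
  \<open>v\<close> and over \<open>w\<close> separately.\<close>

lemma E_term:
  assumes "w \<in> V n" "u \<in> V (Suc n)" "v \<in> V (Suc n)"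
  shows "E n w * G w u * ker (b * b) u v
    \<le> (2 * real L) ^ (8 * N + 4) * E n (par v) * (ker b (par v) w * (G w u * ker b u v))"
proof (cases "G w u = 0 \<or> \<not> (\<exists>i. (u,v) \<in> adj ^^ i)")
  case True
  then show ?thesis by (auto simp: ker_def)
next
  case False
  define i where "i = gd u v"
  have i: "(u,v) \<in> adj ^^ i" using False gd_pow by (auto simp: i_def)
  have j0: "(w, par v) \<in> adj ^^ (N + 1 + N * (i div (4 * N) + 1))"
    using adj_pow_trans[OF G_supp[OF assms(1,2)] hop_iter[OF assms(2) i]] False by blast
  then have j1: "(par v, w) \<in> adj ^^ (N + 1 + N * (i div (4 * N) + 1))" by (rule adj_pow_sym)
  define j where "j = gd (par v) w"
  have j: "(par v, w) \<in> adj ^^ j" using gd_pow[OF j1] by (simp add: j_def)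
  have "4 * (N * (i div (4 * N))) \<le> i"
    using times_div_less_eq_dividend[of "4 * N" i] by (simp add: mult.assoc)
  moreover have "j \<le> N + 1 + N * (i div (4 * N) + 1)" using gd_le[OF j1] by (simp add: j_def)
  \<comment> \<open>Since blocks of length \<open>4 * N\<close> shrink to \<open>N\<close>, one has
    \<open>4 * j \<le> i + 8 * N + 4\<close>. Of the exponent \<open>i + 3 * j\<close>, the parts
    \<open>i\<close> and \<open>j\<close> are for the two kernels and \<open>2 * j\<close> pays for
    moving \<open>E\<close> from \<open>w\<close> to \<open>par v\<close>.\<close>
  ultimately have ij: "i + 3 * j \<le> 2 * i + (8 * N + 4)" by (simp add: algebra_simps)
  have kj: "ker b (par v) w = b ^ j" using ker_eq[OF j1] by (simp add: j_def)
  have ki: "ker c u v = c ^ i" for c using ker_eq[OF i] by (simp add: i_def)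
  have Ew: "(b * b) ^ j * E n w \<le> E n (par v)" using E_pow[OF adj_pow_sym[OF j]] .
  have Lb: "(2 * real L) * b = 1" using L_pos by (simp add: b_def)
  have "(b * b) ^ i * E n w = (2 * real L) ^ (8 * N + 4) * (b ^ (2 * i + (8 * N + 4)) * E n w)"
  proof -
    have "(2 * real L) ^ (8 * N + 4) * b ^ (8 * N + 4) = 1" by (metis Lb power_mult_distrib power_one)
    then have "(b * b) ^ i * E n w = (2 * real L) ^ (8 * N + 4) * b ^ (8 * N + 4) * ((b * b) ^ i * E n w)"
      by simp
    also have "(b * b) ^ i = b ^ (2 * i)" by (simp add: power_mult power2_eq_square)
    finally show ?thesis by (simp only: power_add mult_ac \<open>(b * b) ^ i = b ^ (2 * i)\<close>)
  qed
  also have "\<dots> \<le> (2 * real L) ^ (8 * N + 4) * (b ^ (i + 3 * j) * E n w)"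
    using ij b_pos b_le_1 by (intro mult_left_mono mult_right_mono power_decreasing E_nonneg) auto
  also have "\<dots> = (2 * real L) ^ (8 * N + 4) * (b ^ i * b ^ j * ((b * b) ^ j * E n w))"
    by (simp add: power_add power_mult_distrib power_mult[symmetric] algebra_simps eval_nat_numeral)
  also have "\<dots> \<le> (2 * real L) ^ (8 * N + 4) * (b ^ i * b ^ j * E n (par v))"
    using Ew b_pos by (intro mult_left_mono) auto
  finally have "G w u * ((b * b) ^ i * E n w) \<le> G w u * ((2 * real L) ^ (8 * N + 4) * (b ^ i * b ^ j * E n (par v)))"
    using G_nonneg by (intro mult_left_mono)
  then show ?thesis unfolding ki kj by (simp add: algebra_simps)
qed

text \<open>After \<open>E_term\<close> the sums can be carried out from the inside: those over
  \<open>v\<close> and over \<open>w\<close> are at most 2 by \<open>ker_sum\<close>, and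
  \<open>G_sum\<close> absorbs both of these factors and the constant of
  \<open>E_term\<close>.\<close>

lemma E_children:
  assumes "w0 \<in> V n"
  shows "(\<Sum>v\<in>{v \<in> V (Suc n). par v = w0}. E (Suc n) v) \<le> E n w0"
proof -
  let ?Ch = "{v \<in> V (Suc n). par v = w0}" and ?B = "(2 * real L) ^ (8 * N + 4)"
  have w0: "w0 \<in> C" using assms by (simp add: V_iff)
  have "(\<Sum>v\<in>?Ch. E (Suc n) v)
      \<le> (\<Sum>v\<in>?Ch. \<Sum>w\<in>V n. \<Sum>u\<in>V (Suc n). ?B * E n w0 * (ker b w0 w * (G w u * ker b u v)))"
    unfolding E.simps using E_term by (intro sum_mono) fastforce
  also have "\<dots> = ?B * E n w0 * (\<Sum>w\<in>V n. ker b w0 w * (\<Sum>u\<in>V (Suc n). G w u * (\<Sum>v\<in>?Ch. ker b u v)))"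
    unfolding sum_distrib_left by (subst sum.swap, rule sum.cong[OF refl], rule sum.swap)
  also have "\<dots> \<le> ?B * E n w0 * (\<Sum>w\<in>V n. ker b w0 w * (\<Sum>u\<in>V (Suc n). G w u * 2))"
  proof (intro mult_left_mono sum_mono)
    fix w u assume u: "u \<in> V (Suc n)"
    have "(\<Sum>v\<in>?Ch. ker b u v) \<le> (\<Sum>v\<in>V (Suc n). ker b u v)"
      using ker_nonneg b_pos by (intro sum_mono2) auto
    then show "(\<Sum>v\<in>?Ch. ker b u v) \<le> 2" using ker_sum[of u "Suc n"] u by (simp add: V_iff)
  qed (use G_nonneg E_nonneg ker_nonneg b_pos in auto)
  also have "\<dots> \<le> ?B * E n w0 * (\<Sum>w\<in>V n. ker b w0 w * (1 / (2 * ?B)))"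
  proof (intro mult_left_mono sum_mono)
    fix w assume "w \<in> V n"
    then have "4 * ?B * (\<Sum>u\<in>V (Suc n). G w u) \<le> 1" by (rule G_sum)
    moreover have "0 < ?B" using L_pos by simp
    ultimately show "(\<Sum>u\<in>V (Suc n). G w u * 2) \<le> 1 / (2 * ?B)"
      by (simp add: sum_distrib_right[symmetric] field_simps)
  qed (use G_nonneg E_nonneg ker_nonneg b_pos in auto)
  also have "\<dots> = E n w0 * ((\<Sum>w\<in>V n. ker b w0 w) / 2)"
    using L_pos by (simp add: sum_distrib_right[symmetric] sum_divide_distrib[symmetric])
  also have "\<dots> \<le> E n w0 * 1"
    using ker_sum[OF w0, of n] E_nonneg by (intro mult_left_mono) auto
  finally show ?thesis by simp
qed

section \<open>Lower bounds for the lengths of chains\<close>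

definition D :: "'a \<Rightarrow> real" where "D v = E (lev v) v powr (1 / p)"

definition cD :: real where "cD = ((b * b) ^ (N + 1)) powr (1 / p)"

lemma D_nonneg: "0 \<le> D v" by (simp add: D_def)

lemma D_pos: "v \<in> C \<Longrightarrow> 0 < D v" using E_pos[of v "lev v"] by (simp add: D_def V_iff)

lemma cD_pos: "0 < cD" using b_pos by (simp add: cD_def)

lemma D_pow:
  assumes "(v,v') \<in> adj ^^ (N + 1)" "v \<in> C" shows "cD * D v \<le> D v'"
proof -
  have l: "lev v' = lev v" using adj_pow_C[OF assms] by simp
  have "cD * D v = ((b * b) ^ (N + 1) * E (lev v) v) powr (1 / p)"
    unfolding cD_def D_def using E_nonneg bb_pos by (intro powr_mult[symmetric]) 
  also have "\<dots> \<le> D v'"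
    unfolding D_def l using E_pow[OF assms(1)] E_nonneg bb_pos p_pos by (intro powr_mono2) auto
  finally show ?thesis .
qed

lemma D_G:
  assumes "w \<in> V n" "u \<in> V (Suc n)" shows "D w * G w u powr (1 / p) \<le> D u"
proof -
  have "D w * G w u powr (1 / p) = (E n w * G w u) powr (1 / p)"
    using assms E_nonneg G_nonneg by (simp add: D_def V_iff powr_mult)
  also have "\<dots> \<le> D u"
    using E_G[OF assms] E_nonneg G_nonneg p_pos assms(2)
    unfolding D_def by (intro powr_mono2) (auto simp: V_iff simp del: E.simps)
  finally show ?thesis .
qed

definition touch :: "'a \<Rightarrow> 'a \<Rightarrow> bool" where "touch u v \<longleftrightarrow> K u \<inter> K v \<noteq> {}"

lemma touch_sym: "touch u v \<Longrightarrow> touch v u" by (auto simp: touch_def)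

text \<open>
  Induction on the depth of the chain: either it uses a cell of level \<open>n\<close> near \<open>w\<close>, or its
  projection to level \<open>Suc n\<close> gains the factor \<open>L ^ (N + 1)\<close> from \<open>G_cross\<close>, which pays for
  counting each cell of the chain for up to \<open>L ^ (N + 1)\<close> cells of that level.
\<close>

lemma crossing:
  assumes "w \<in> V n" "vs \<noteq> []" "set vs \<subseteq> C" "successively touch vs"
    "\<forall>v\<in>set vs. n \<le> lev v \<and> lev v \<le> n + j"
    "anc n (hd vs) = w" "(w, anc n (last vs)) \<notin> adj ^^ N"
  shows "cD * D w \<le> (\<Sum>v\<in>{v \<in> set vs. (w, anc n v) \<in> adj ^^ (N + 1)}. D v)"
  using assms
proof (induction j arbitrary: n w vs)
  \<comment> \<open>One argument for both induction cases: the hypothesis for the next level is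
    guarded by \<open>j \<noteq> 0\<close>, because for \<open>j = 0\<close> all cells of the chain
    have level \<open>n\<close> and it is never called.\<close>
  have main: "cD * D w \<le> (\<Sum>v\<in>{v \<in> set vs. (w, anc n v) \<in> adj ^^ (N + 1)}. D v)"
    if w: "w \<in> V n" and vs: "vs \<noteq> []" "set vs \<subseteq> C" "successively touch vs"
    and lv: "\<forall>v\<in>set vs. n \<le> lev v \<and> lev v \<le> n + j"
    and hd: "anc n (hd vs) = w" and last: "(w, anc n (last vs)) \<notin> adj ^^ N"
    and IH: "\<And>w vs. \<lbrakk>j \<noteq> 0; w \<in> V (Suc n); vs \<noteq> []; set vs \<subseteq> C; successively touch vs;
      \<forall>v\<in>set vs. Suc n \<le> lev v \<and> lev v \<le> n + j; anc (Suc n) (hd vs) = w;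
      (w, anc (Suc n) (last vs)) \<notin> adj ^^ N\<rbrakk>
      \<Longrightarrow> cD * D w \<le> (\<Sum>v\<in>{v \<in> set vs. (w, anc (Suc n) v) \<in> adj ^^ (N + 1)}. D v)"
    for n w vs j
  proof -
    have wC: "w \<in> C" using w by (simp add: V_iff)
    have "\<exists>q\<in>set vs. (w, anc n q) \<notin> adj ^^ N" using last vs(1) last_in_set by blast
    then obtain as q bs where vs_eq: "vs = as @ q # bs" and q: "(w, anc n q) \<notin> adj ^^ N"
      and as: "\<forall>v\<in>set as. (w, anc n v) \<in> adj ^^ N"
      using split_list_first_prop[of vs "\<lambda>q. (w, anc n q) \<notin> adj ^^ N"] by blast
    have as_ne: "as \<noteq> []"
    proof
      assume "as = []"
      then have "anc n q = w" using hd vs_eq by simp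
      then show False using q adj_pow_refl[OF wC] by simp
    qed
    \<comment> \<open>The chain is cut at the first cell more than \<open>N\<close> steps from
      \<open>w\<close>. The cells before it are within \<open>N\<close> steps, and \<open>q\<close>
      itself, touching one of them, within \<open>N + 1\<close>.\<close>
    define ts where "ts = as @ [q]"
    have ts: "ts \<noteq> []" "set ts \<subseteq> set vs" "hd ts = hd vs" "last ts = q"
      using as_ne by (auto simp: ts_def vs_eq)
    have tsC: "set ts \<subseteq> C" using ts vs by auto
    have ts_succ: "successively touch ts"
    proof -
      have "vs = ts @ bs" by (simp add: ts_def vs_eq)
      then show ?thesis using vs(3) by (simp add: successively_append_iff)
    qed
    have near: "(w, anc n v) \<in> adj ^^ (N + 1)" if "v \<in> set ts" for v
    proof (cases "v \<in> set as")
      case True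
      then show ?thesis using as adj_pow_mono[of w "anc n v" N "N+1"] wC by auto
    next
      case False
      then have v: "v = q" using that by (simp add: ts_def)
      have "touch (last as) q"
        using ts_succ as_ne by (simp add: ts_def successively_append_iff)
      moreover have "last as \<in> set vs" "q \<in> set vs" using as_ne by (auto simp: vs_eq)
      ultimately have "(anc n (last as), anc n q) \<in> adj"
        using vs lv by (intro adj_anc) (auto simp: touch_def)
      moreover have "(w, anc n (last as)) \<in> adj ^^ N" using as as_ne by simp
      ultimately show ?thesis using v by auto
    qed
    have sum_le: "(\<Sum>v\<in>set ts. D v) \<le> (\<Sum>v\<in>{v \<in> set vs. (w, anc n v) \<in> adj ^^ (N + 1)}. D v)"
      using near ts(2) D_nonneg by (intro sum_mono2) auto
    show ?thesis
    proof (cases "\<exists>v\<in>set ts. lev v = n")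
      case True
      \<comment> \<open>A single cell of level \<open>n\<close> near \<open>w\<close> is long
        enough, since \<open>D\<close> varies by at most \<open>cD\<close> over \<open>N + 1\<close>
        steps.\<close>
      then obtain v where v: "v \<in> set ts" "lev v = n" by auto
      then have "(w, v) \<in> adj ^^ (N + 1)" using near[OF v(1)] by (metis anc_self)
      then have "cD * D w \<le> D v" using D_pow wC by simp
      also have "\<dots> \<le> (\<Sum>v\<in>set ts. D v)"
        using v D_nonneg by (intro member_le_sum) auto
      finally show ?thesis using sum_le by linarith
    next
      case False
      then have lts: "\<forall>v\<in>set ts. Suc n \<le> lev v \<and> lev v \<le> n + j"
        using lv ts(2) by (metis Suc_leI le_neq_implies_less subsetD)
      then have j: "j \<noteq> 0" using ts(1) by (cases ts) auto
      define us where "us = map (anc (Suc n)) ts"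
      have usV: "set us \<subseteq> V (Suc n)" using lts tsC anc_V by (auto simp: us_def)
      have us_succ: "successively (\<lambda>u v. (u,v) \<in> adj) us"
        unfolding us_def successively_map
        by (rule successively_mono[OF ts_succ])
          (use lts tsC in \<open>auto simp: touch_def intro!: adj_anc\<close>)
      have par_us: "par (anc (Suc n) v) = anc n v" if "v \<in> set ts" for v
        using par_anc lts tsC that by blast
      have hd_ts: "hd ts \<in> set ts" and last_ts: "last ts \<in> set ts" using ts(1) by auto
      have near_us: "\<forall>u\<in>set us. (w, par u) \<in> adj ^^ (N + 1)"
      proof
        fix u assume "u \<in> set us"
        then obtain v where v: "v \<in> set ts" "u = anc (Suc n) v" by (auto simp: us_def)
        show "(w, par u) \<in> adj ^^ (N + 1)" unfolding v(2) par_us[OF v(1)] by (rule near[OF v(1)])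
      qed
      have "par (hd us) = w" using par_us[OF hd_ts] hd ts by (simp add: us_def hd_map)
      moreover have "(w, par (last us)) \<notin> adj ^^ N"
        using par_us[OF last_ts] q ts by (simp add: us_def last_map)
      ultimately have cross: "real L ^ (N + 1) \<le> (\<Sum>u\<in>set us. G w u powr (1 / p))"
        using G_cross[OF w _ usV us_succ near_us] ts(1) by (simp add: us_def)
      have each: "cD * D u \<le> (\<Sum>v\<in>{v \<in> set ts. (u, anc (Suc n) v) \<in> adj ^^ (N + 1)}. D v)"
        if u: "u \<in> set us" for u
      proof -
        obtain v where v: "v \<in> set ts" "u = anc (Suc n) v" using u by (auto simp: us_def)
        then obtain xs ys where xy: "ts = xs @ v # ys" by (meson split_list)
        have uV: "u \<in> V (Suc n)" using u usV by auto
        have IH': ?thesis if "vs' \<noteq> []" "set vs' \<subseteq> set ts" "successively touch vs'" "hd vs' = v"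
          "(u, anc (Suc n) (last vs')) \<notin> adj ^^ N" for vs'
        proof -
          have "cD * D u \<le> (\<Sum>v\<in>{v \<in> set vs'. (u, anc (Suc n) v) \<in> adj ^^ (N + 1)}. D v)"
            by (rule IH[OF j uV]) (use that tsC lts v in auto)
          also have "\<dots> \<le> (\<Sum>v\<in>{v \<in> set ts. (u, anc (Suc n) v) \<in> adj ^^ (N + 1)}. D v)"
            using that D_nonneg by (intro sum_mono2) auto
          finally show ?thesis .
        qed
        \<comment> \<open>At least one end of \<open>ts\<close> is far from \<open>u\<close>:
          otherwise the ends were within \<open>2 * N\<close> steps of each other, and by
          \<open>hop\<close> their parents within \<open>N\<close>, although \<open>q\<close> was
          chosen farther from \<open>w\<close> than that.\<close>
        consider "(u, anc (Suc n) (last ts)) \<notin> adj ^^ N" | "(u, anc (Suc n) (hd ts)) \<notin> adj ^^ N"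
        proof (rule ccontr)
          assume "\<not> thesis"
          then have "(u, anc (Suc n) (last ts)) \<in> adj ^^ N" "(u, anc (Suc n) (hd ts)) \<in> adj ^^ N"
            using that by blast+
          then have NN: "(anc (Suc n) (hd ts), anc (Suc n) (last ts)) \<in> adj ^^ (N + N)"
            using adj_pow_sym adj_pow_trans by blast
          have hV: "anc (Suc n) (hd ts) \<in> V (Suc n)" using usV hd_ts by (auto simp: us_def)
          then have hC: "anc (Suc n) (hd ts) \<in> C" by (simp add: V_iff)
          have "(anc (Suc n) (hd ts), anc (Suc n) (last ts)) \<in> adj ^^ (4 * N)"
            by (rule adj_pow_mono[OF NN _ hC]) simp
          then have "(par (anc (Suc n) (hd ts)), par (anc (Suc n) (last ts))) \<in> adj ^^ N"
            using hop[OF hV] by blast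
          then show False using par_us hd_ts last_ts q ts hd by simp
        qed
        then show ?thesis
        proof cases
          case 1
          show ?thesis
            by (rule IH'[of "v # ys"]) (use 1 ts_succ in \<open>auto simp: xy successively_append_iff\<close>)
        next
          case 2
          \<comment> \<open>Here the part of the chain up to \<open>v\<close> is used, read
            backwards so that it starts below \<open>u\<close>.\<close>
          have "successively touch (xs @ [v])"
          proof -
            have "ts = (xs @ [v]) @ ys" by (simp add: xy)
            then show ?thesis using ts_succ by (simp only: successively_append_iff)
          qed
          then have "successively touch (rev (xs @ [v]))"
            unfolding successively_rev by (rule successively_mono) (auto intro: touch_sym)
          moreover have "last (rev (xs @ [v])) = hd ts" by (cases xs) (auto simp: xy)
          ultimately show ?thesis using 2
            by (intro IH'[of "rev (xs @ [v])"]) (auto simp: xy)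
        qed
      qed
      have "real L ^ (N + 1) * (cD * D w) \<le> (\<Sum>u\<in>set us. G w u powr (1 / p)) * (cD * D w)"
        using cross cD_pos D_nonneg by (intro mult_right_mono) auto
      also have "\<dots> = (\<Sum>u\<in>set us. cD * (D w * G w u powr (1 / p)))"
        by (simp add: sum_distrib_left sum_distrib_right algebra_simps)
      also have "\<dots> \<le> (\<Sum>u\<in>set us. cD * D u)"
        using D_G[OF w] usV cD_pos by (intro sum_mono mult_left_mono) auto
      also have "\<dots> \<le> (\<Sum>u\<in>set us. \<Sum>v\<in>{v \<in> set ts. (u, anc (Suc n) v) \<in> adj ^^ (N + 1)}. D v)"
        using each by (intro sum_mono)
      \<comment> \<open>After the exchange each \<open>v\<close> is counted once for every
        \<open>u\<close> within \<open>N + 1\<close> steps of its ancestor, thus at most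
        \<open>L ^ (N + 1)\<close> times; this cancels the gain from \<open>cross\<close>.\<close>
      also have "\<dots> = (\<Sum>v\<in>set ts. \<Sum>u\<in>{u \<in> set us. (u, anc (Suc n) v) \<in> adj ^^ (N + 1)}. D v)"
        by (rule sum.swap_restrict) auto
      also have "\<dots> \<le> (\<Sum>v\<in>set ts. real L ^ (N + 1) * D v)"
      proof (rule sum_mono)
        fix v assume v: "v \<in> set ts"
        then have vC: "anc (Suc n) v \<in> C" using usV by (auto simp: us_def V_iff)
        have "{u \<in> set us. (u, anc (Suc n) v) \<in> adj ^^ (N + 1)} \<subseteq> (adj ^^ (N + 1)) `` {anc (Suc n) v}"
          using adj_pow_sym by blast
        then have "card {u \<in> set us. (u, anc (Suc n) v) \<in> adj ^^ (N + 1)} \<le> L ^ (N + 1)"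
          using card_mono[OF finite_pow[OF vC]] card_pow[OF vC] order_trans by blast
        then have "real (card {u \<in> set us. (u, anc (Suc n) v) \<in> adj ^^ (N + 1)}) \<le> real L ^ (N + 1)"
          by (metis of_nat_le_iff of_nat_power)
        then show "(\<Sum>u\<in>{u \<in> set us. (u, anc (Suc n) v) \<in> adj ^^ (N + 1)}. D v) \<le> real L ^ (N + 1) * D v"
          using D_nonneg by (simp add: mult_right_mono del: relpow.simps)
      qed
      also have "\<dots> = real L ^ (N + 1) * (\<Sum>v\<in>set ts. D v)" by (simp add: sum_distrib_left)
      finally have "cD * D w \<le> (\<Sum>v\<in>set ts. D v)"
        using L_pos by (subst (asm) mult_le_cancel_left_pos) auto
      then show ?thesis using sum_le by linarith
    qed
  qed
  {
    case 0
    show ?case by (rule main[OF 0]) simp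
  next
    case (Suc j)
    show ?case by (rule main[OF Suc.prems]) (rule Suc.IH, auto)
  }
qed

end


section \<open>Additive masses dominating the weights\<close>

text \<open>\<open>diam\<close> and \<open>sep\<close> tie level \<open>n\<close> to the scale
  \<open>R ^ n\<close> of \<open>d\<close>. The cell from \<open>interior\<close> receives the
  missing mass, and \<open>two\<close> forces the masses to decay.\<close>

locale metric_hierarchy = weighted_hierarchy +
  fixes \<phi> :: 'a and d :: "'b \<Rightarrow> 'b \<Rightarrow> real" and R c2 c3 :: real
  assumes root: "V 0 = {\<phi>}"
    and interior: "w \<in> V n \<Longrightarrow> \<exists>v\<in>V (Suc n). par v = w \<and> (\<forall>v'. (v,v') \<in> adj \<longrightarrow> par v' = w)"
    and two: "w \<in> V n \<Longrightarrow> \<exists>v\<in>V (Suc n). \<exists>v'\<in>V (Suc n). v \<noteq> v' \<and> par v = w \<and> par v' = w"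
    and d_metric: "Metric_space S d"
    and R: "0 < R" "R < 1" and c2_pos: "0 < c2" and c3_pos: "0 < c3"
    and diam: "\<lbrakk>w \<in> V n; x \<in> K w; y \<in> K w\<rbrakk> \<Longrightarrow> d x y \<le> c2 * R ^ n"
    and sep: "\<lbrakk>v \<in> V n; u \<in> V n; x \<in> K v; y \<in> K u; d x y < c3 * R ^ n\<rbrakk> \<Longrightarrow> (v,u) \<in> adj ^^ N"
begin

definition ch :: "nat \<Rightarrow> 'a \<Rightarrow> 'a set" where "ch n w = {v \<in> V (Suc n). par v = w}"

lemma finite_ch [simp]: "finite (ch n w)" by (simp add: ch_def)

definition special :: "nat \<Rightarrow> 'a \<Rightarrow> 'a" where
  "special n w = (SOME v. v \<in> ch n w \<and> (\<forall>v'. (v,v') \<in> adj \<longrightarrow> par v' = w))"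

lemma special: "w \<in> V n \<Longrightarrow> special n w \<in> ch n w \<and> (\<forall>v'. (special n w,v') \<in> adj \<longrightarrow> par v' = w)"
  unfolding special_def by (rule someI_ex) (use interior ch_def in blast)

primrec m :: "nat \<Rightarrow> 'a \<Rightarrow> real" where
  "m 0 v = 1"
| "m (Suc n) v = m n (par v) *
     (if v = special n (par v)
      then 1 - (\<Sum>u\<in>ch n (par v) - {v}. E (Suc n) u / E n (par v))
      else E (Suc n) v / E n (par v))"

lemma m_children:
  assumes "w \<in> V n" shows "(\<Sum>v\<in>ch n w. m (Suc n) v) = m n w"
proof -
  let ?s = "special n w"
  have s: "?s \<in> ch n w" using special[OF assms] by simp
  have p: "par v = w" if "v \<in> ch n w" for v using that by (simp add: ch_def)
  have "(\<Sum>v\<in>ch n w. m (Suc n) v) = m (Suc n) ?s + (\<Sum>v\<in>ch n w - {?s}. m (Suc n) v)"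
    by (rule sum.remove) (use s in auto)
  also have "(\<Sum>v\<in>ch n w - {?s}. m (Suc n) v) = (\<Sum>v\<in>ch n w - {?s}. m n w * (E (Suc n) v / E n w))"
    by (rule sum.cong) (use p in \<open>auto simp del: E.simps\<close>)
  also have "\<dots> = m n w * (\<Sum>v\<in>ch n w - {?s}. E (Suc n) v / E n w)" by (rule sum_distrib_left[symmetric])
  also have "m (Suc n) ?s = m n w * (1 - (\<Sum>v\<in>ch n w - {?s}. E (Suc n) v / E n w))"
    using p[OF s] by (simp del: E.simps)
  finally show ?thesis by (simp add: right_diff_distrib del: E.simps m.simps)
qed

lemma E_ratio_children:
  assumes "w \<in> V n" shows "(\<Sum>u\<in>ch n w. E (Suc n) u / E n w) \<le> 1"
proof -
  have "(\<Sum>u\<in>ch n w. E (Suc n) u / E n w) = (\<Sum>u\<in>ch n w. E (Suc n) u) / E n w"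
    by (simp add: sum_divide_distrib del: E.simps)
  also have "\<dots> \<le> 1" using E_children[OF assms] E_pos[OF assms] by (simp add: ch_def del: E.simps)
  finally show ?thesis .
qed

text \<open>Equality for an ordinary child. The special child gets what its siblings leave, which is
  at least its own share because the ratios sum up to at most 1.\<close>

lemma m_ge_aux:
  assumes "v \<in> V (Suc n)" "0 \<le> m n (par v)"
  shows "m n (par v) * (E (Suc n) v / E n (par v)) \<le> m (Suc n) v"
proof -
  have v: "v \<in> ch n (par v)" using assms by (simp add: ch_def)
  have "(\<Sum>u\<in>ch n (par v). E (Suc n) u / E n (par v))
      = E (Suc n) v / E n (par v) + (\<Sum>u\<in>ch n (par v) - {v}. E (Suc n) u / E n (par v))"
    by (rule sum.remove) (use v in auto)
  then have "E (Suc n) v / E n (par v) \<le> 1 - (\<Sum>u\<in>ch n (par v) - {v}. E (Suc n) u / E n (par v))"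
    using E_ratio_children[OF par_V[OF assms(1)]] by linarith
  then show ?thesis
    unfolding m.simps by (intro mult_left_mono assms(2)) (simp del: E.simps)
qed

lemma m_pos: "v \<in> V n \<Longrightarrow> 0 < m n v"
proof (induction n arbitrary: v)
  case (Suc n)
  have w: "par v \<in> V n" using par_V[OF Suc.prems] .
  have "0 < m n (par v) * (E (Suc n) v / E n (par v))"
    using Suc.IH[OF w] E_pos[OF w] E_pos[OF Suc.prems] by (intro mult_pos_pos divide_pos_pos)
  then show ?case using m_ge_aux[OF Suc.prems] Suc.IH[OF w] by linarith
qed simp

lemma m_ge: "v \<in> V (Suc n) \<Longrightarrow> m n (par v) * E (Suc n) v \<le> m (Suc n) v * E n (par v)"
  using m_ge_aux[of v n] m_pos[OF par_V, of v n] E_pos[OF par_V, of v n]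
  by (simp add: field_simps del: E.simps m.simps)

lemma m_floor: assumes "v \<in> V (Suc n)" shows "a * m n (par v) \<le> m (Suc n) v"
proof -
  have w: "par v \<in> V n" using par_V[OF assms] .
  have "m n (par v) * (a * E n (par v)) \<le> m n (par v) * E (Suc n) v"
    using E_floor[OF assms] m_pos[OF w] by (intro mult_left_mono) auto
  also have "\<dots> \<le> m (Suc n) v * E n (par v)" by (rule m_ge[OF assms])
  finally have "(a * m n (par v)) * E n (par v) \<le> m (Suc n) v * E n (par v)" by (simp add: mult_ac)
  then show ?thesis using E_pos[OF w] by (rule mult_right_le_imp_le)
qed

text \<open>A second child takes at least the fraction \<open>a\<close> of the mass, by
  \<open>m_floor\<close>. This is the source of the geometric decay of diameters along rays.\<close>

lemma m_upper: assumes "v \<in> V (Suc n)" shows "m (Suc n) v \<le> (1 - a) * m n (par v)"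
proof -
  have w: "par v \<in> V n" using par_V[OF assms] .
  have v: "v \<in> ch n (par v)" using assms by (simp add: ch_def)
  obtain v' where v': "v' \<in> ch n (par v)" "v' \<noteq> v" using two[OF w] by (auto simp: ch_def)
  have pos: "0 \<le> m (Suc n) u" if "u \<in> ch n (par v)" for u
    using m_pos[of u "Suc n"] that unfolding ch_def by (simp del: m.simps)
  have "m (Suc n) v + m (Suc n) v' = (\<Sum>u\<in>{v,v'}. m (Suc n) u)" using v'(2) by (simp del: m.simps)
  also have "\<dots> \<le> (\<Sum>u\<in>ch n (par v). m (Suc n) u)"
    using v v' pos by (intro sum_mono2) auto
  also have "\<dots> = m n (par v)" by (rule m_children[OF w])
  finally have "m (Suc n) v + m (Suc n) v' \<le> m n (par v)" .
  moreover have "a * m n (par v) \<le> m (Suc n) v'"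
    using m_floor[of v' n] v'(1) unfolding ch_def by (simp del: m.simps)
  ultimately show ?thesis by (simp add: algebra_simps del: m.simps)
qed

lemma a_half: "a \<le> 1 - a"
proof -
  obtain v where v: "v \<in> V (Suc 0)" using two[of \<phi> 0] root by auto
  have "a * m 0 (par v) \<le> (1 - a) * m 0 (par v)" using m_floor[OF v] m_upper[OF v] by linarith
  then show ?thesis by simp
qed

lemma a_lt_1: "a < 1" using a_half a_pos by linarith

section \<open>Densities and the comparability of neighbouring masses\<close>

definition h :: "nat \<Rightarrow> 'a \<Rightarrow> real" where "h n v = m n v / E n v"

lemma h_pos: "v \<in> V n \<Longrightarrow> 0 < h n v" using m_pos E_pos by (simp add: h_def)

lemma h_normal:
  assumes "v \<in> V (Suc n)" "v \<noteq> special n (par v)" shows "h (Suc n) v = h n (par v)"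
proof -
  have "E (Suc n) v \<noteq> 0" using E_pos[OF assms(1)] by simp
  moreover have "m (Suc n) v = m n (par v) * (E (Suc n) v / E n (par v))" using assms(2) by simp
  ultimately show ?thesis unfolding h_def by (simp del: E.simps m.simps)
qed

text \<open>The first bound is \<open>m_ge\<close>. For the second, the mass does not grow on
  passing to a child, while \<open>E\<close> keeps at least the fraction \<open>a\<close>.\<close>

lemma h_bounds:
  assumes "v \<in> V (Suc n)" shows "h n (par v) \<le> h (Suc n) v" "a * h (Suc n) v \<le> h n (par v)"
proof -
  have w: "par v \<in> V n" using par_V[OF assms] .
  have p: "0 < E (Suc n) v" "0 < E n (par v)" "0 < m n (par v)" "0 < m (Suc n) v"
    using E_pos[OF assms] E_pos[OF w] m_pos[OF w] m_pos[OF assms] .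
  show "h n (par v) \<le> h (Suc n) v"
    unfolding h_def using m_ge[OF assms] p by (simp add: field_simps del: E.simps m.simps)
  have "(1 - a) * m n (par v) \<le> 1 * m n (par v)" using p a_pos by (intro mult_right_mono) auto
  then have "m (Suc n) v \<le> m n (par v)" using m_upper[OF assms] by linarith
  then have "m (Suc n) v * (a * E n (par v)) \<le> m n (par v) * E (Suc n) v"
    using E_floor[OF assms] p a_pos by (intro mult_mono) auto
  then show "a * h (Suc n) v \<le> h n (par v)"
    unfolding h_def using p by (simp add: field_simps del: E.simps m.simps)
qed

text \<open>
  Two neighbouring cells with different parents are not special, so their densities are
  inherited until the branches meet; only the first step after the common ancestor can be special.
\<close>

lemma h_adj: "(v,v') \<in> adj \<Longrightarrow> v \<in> V n \<Longrightarrow> a * h n v \<le> h n v'"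
proof (induction n arbitrary: v v')
  case 0
  then show ?case using a_lt_1 by (simp add: h_def)
next
  case (Suc n)
  have v': "v' \<in> V (Suc n)" using adj_D[OF Suc.prems(1)] Suc.prems(2) by (simp add: V_iff)
  show ?case
  proof (cases "par v = par v'")
    case True
    then show ?thesis using h_bounds(2)[OF Suc.prems(2)] h_bounds(1)[OF v'] by simp
  next
    case False
    have "(v',v) \<in> adj" using Suc.prems(1) sym_adj by (rule symD[rotated])
    then have "v \<noteq> special n (par v)" "v' \<noteq> special n (par v')"
      using special[OF par_V[OF Suc.prems(2)]] special[OF par_V[OF v']] Suc.prems(1) False by metis+
    then have "h (Suc n) v = h n (par v)" "h (Suc n) v' = h n (par v')"
      using h_normal Suc.prems v' by auto
    moreover have "par v = anc n v" "par v' = anc n v'"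
      using par_anc[of v n] par_anc[of v' n] Suc.prems v' anc_self[of v] anc_self[of v'] by (auto simp: V_iff)
    then have "(par v, par v') \<in> adj"
      using adj_anc[of v v' n] adj_D[OF Suc.prems(1)] Suc.prems(2) by (simp add: V_iff)
    ultimately show ?thesis using Suc.IH par_V Suc.prems by auto
  qed
qed

definition qm :: real where "qm = a * (b * b)"

lemma qm_pos: "0 < qm" using a_pos bb_pos by (simp add: qm_def)

lemma qm_le_1: "qm \<le> 1" using a_lt_1 a_pos bb_le_1 bb_pos by (simp add: qm_def mult_le_one)

lemma m_adj:
  assumes "(v,v') \<in> adj" "v \<in> V n" shows "qm * m n v \<le> m n v'"
proof -
  have v': "v' \<in> V n" using adj_D[OF assms(1)] assms(2) by (simp add: V_iff)
  have "qm * m n v = (a * h n v) * (b * b * E n v)"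
    using E_pos[OF assms(2)] by (simp add: h_def qm_def)
  also have "\<dots> \<le> h n v' * E n v'"
    using h_adj[OF assms] E_adj[OF assms(1), of n] E_pos[OF assms(2)] h_pos[OF assms(2)] h_pos[OF v'] a_pos bb_pos
    by (intro mult_mono) auto
  also have "\<dots> = m n v'" using E_pos[OF v'] by (simp add: h_def)
  finally show ?thesis .
qed

lemma m_pow: "(v,v') \<in> adj ^^ i \<Longrightarrow> v \<in> V n \<Longrightarrow> qm ^ i * m n v \<le> m n v'"
proof (induction i arbitrary: v')
  case (Suc i)
  then obtain z where z: "(v,z) \<in> adj ^^ i" "(z,v') \<in> adj" by auto
  have "qm ^ Suc i * m n v = qm * (qm ^ i * m n v)" by simp
  also have "\<dots> \<le> qm * m n z" using Suc.IH[OF z(1) Suc.prems(2)] qm_pos by (intro mult_left_mono) auto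
  also have "\<dots> \<le> m n v'" using m_adj[OF z(2)] adj_pow_V[OF z(1) Suc.prems(2)] by simp
  finally show ?case .
qed simp

section \<open>Diameters obtained from the masses\<close>

definition W :: "'a \<Rightarrow> real" where "W v = m (lev v) v powr (1 / p)"
definition q :: real where "q = qm powr (1 / p)"
definition aW :: real where "aW = a powr (1 / p)"
definition bW :: real where "bW = (1 - a) powr (1 / p)"

lemma W_consts: "0 < q" "q \<le> 1" "0 < aW" "aW \<le> bW" "0 < bW" "bW < 1"
  using qm_pos qm_le_1 a_pos a_lt_1 a_half p_pos
  by (auto simp: q_def aW_def bW_def powr_le_one_le powr_mono2 powr_le1 powr01_less_one)

lemma W_V: "v \<in> V n \<Longrightarrow> W v = m n v powr (1 / p)" by (simp add: W_def V_iff)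

lemma W_pos: "v \<in> C \<Longrightarrow> 0 < W v" using m_pos[of v "lev v"] by (simp add: W_def V_iff)

lemma W_nonneg: "0 \<le> W v" by (simp add: W_def)

lemma W_powr: "v \<in> V n \<Longrightarrow> W v powr p = m n v"
  using m_pos[of v n] p_pos by (simp add: W_V powr_powr)

lemma W_adj: assumes "(v,v') \<in> adj" shows "q * W v \<le> W v'"
proof -
  have v: "v \<in> V (lev v)" "v' \<in> V (lev v)" using adj_D[OF assms] by (auto simp: V_iff)
  have "q * W v = (qm * m (lev v) v) powr (1 / p)" by (simp add: q_def W_def powr_mult)
  also have "\<dots> \<le> W v'" unfolding W_V[OF v(2)]
    using m_adj[OF assms v(1)] m_pos[OF v(1)] qm_pos p_pos by (intro powr_mono2) auto
  finally show ?thesis .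
qed

lemma W_pow: "(v,v') \<in> adj ^^ i \<Longrightarrow> q ^ i * W v \<le> W v'"
proof (induction i arbitrary: v')
  case (Suc i)
  then obtain z where z: "(v,z) \<in> adj ^^ i" "(z,v') \<in> adj" by auto
  have "q ^ Suc i * W v = q * (q ^ i * W v)" by simp
  also have "\<dots> \<le> q * W z" using Suc.IH[OF z(1)] W_consts by (intro mult_left_mono) auto
  also have "\<dots> \<le> W v'" using W_adj[OF z(2)] .
  finally show ?case .
qed simp

lemma W_par:
  assumes v: "v \<in> V (Suc n)" shows "aW * W (par v) \<le> W v" "W v \<le> bW * W (par v)"
proof -
  have w: "par v \<in> V n" using par_V[OF v] .
  have "aW * W (par v) = (a * m n (par v)) powr (1 / p)" using w by (simp add: W_V aW_def powr_mult)
  also have "\<dots> \<le> W v" unfolding W_V[OF v]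
    using m_floor[OF v] m_pos[OF w] a_pos p_pos by (intro powr_mono2) auto
  finally show "aW * W (par v) \<le> W v" .
  have "W v \<le> ((1 - a) * m n (par v)) powr (1 / p)" unfolding W_V[OF v]
    using m_upper[OF v] m_pos[OF v] p_pos by (intro powr_mono2) auto
  also have "\<dots> = bW * W (par v)" using w by (simp add: W_V bW_def powr_mult)
  finally show "W v \<le> bW * W (par v)" .
qed

text \<open>The third part accumulates \<open>m_ge\<close>: the quotient of \<open>W\<close> by
  \<open>D\<close> does not decrease along descents. It carries the crossing estimate over from
  \<open>D\<close> to \<open>W\<close>.\<close>

lemma W_anc:
  assumes "v \<in> C" "n \<le> lev v"
  shows "aW ^ (lev v - n) * W (anc n v) \<le> W v \<and> W v \<le> bW ^ (lev v - n) * W (anc n v)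
    \<and> W (anc n v) * D v \<le> W v * D (anc n v)"
  using assms
proof (induction "lev v - n" arbitrary: n)
  case 0
  then have "n = lev v" by simp
  then show ?case by simp
next
  case (Suc k)
  then have n: "Suc n \<le> lev v" "k = lev v - Suc n" by simp_all
  define u where "u = anc (Suc n) v"
  have u: "u \<in> V (Suc n)" using anc_V[OF Suc.prems(1) n(1)] by (simp add: u_def)
  have pu: "par u = anc n v" using par_anc[OF Suc.prems(1) n(1)] by (simp add: u_def)
  have w: "par u \<in> V n" using par_V[OF u] .
  have e: "lev v - n = Suc (lev v - Suc n)" using n by simp
  have IH: "aW ^ (lev v - Suc n) * W u \<le> W v" "W v \<le> bW ^ (lev v - Suc n) * W u" "W u * D v \<le> W v * D u"
    using Suc.hyps(1)[OF n(2) Suc.prems(1) n(1)] by (simp_all add: u_def)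
  have "aW ^ (lev v - n) * W (par u) = aW ^ (lev v - Suc n) * (aW * W (par u))" by (simp add: e)
  also have "\<dots> \<le> aW ^ (lev v - Suc n) * W u" using W_par(1)[OF u] W_consts by (intro mult_left_mono) auto
  finally have 1: "aW ^ (lev v - n) * W (par u) \<le> W v" using IH(1) by linarith
  have "bW ^ (lev v - Suc n) * W u \<le> bW ^ (lev v - Suc n) * (bW * W (par u))"
    using W_par(2)[OF u] W_consts by (intro mult_left_mono) auto
  also have "\<dots> = bW ^ (lev v - n) * W (par u)" by (simp add: e)
  finally have 2: "W v \<le> bW ^ (lev v - n) * W (par u)" using IH(2) by linarith
  have "W (par u) * D u = (m n (par u) * E (Suc n) u) powr (1 / p)"
    using u w by (simp add: W_V D_def V_iff powr_mult del: E.simps)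
  also have "\<dots> \<le> (m (Suc n) u * E n (par u)) powr (1 / p)"
    using m_ge[OF u] m_pos[OF w] E_pos[OF u] p_pos by (intro powr_mono2) auto
  also have "\<dots> = W u * D (par u)"
    using u w by (simp add: W_V D_def V_iff powr_mult del: E.simps m.simps)
  finally have 3: "W (par u) * D u \<le> W u * D (par u)" .
  have uC: "u \<in> C" using u by (simp add: V_iff)
  have "W (par u) * D v * W u \<le> W (par u) * (W v * D u)"
    using IH(3) W_nonneg by (metis mult.assoc mult.commute mult_left_mono)
  also have "\<dots> \<le> W v * (W u * D (par u))" using 3 W_nonneg by (metis mult.left_commute mult_left_mono)
  also have "\<dots> = W v * D (par u) * W u" by simp
  finally have "W (par u) * D v \<le> W v * D (par u)" using W_pos[OF uC] by (rule mult_right_le_imp_le)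
  then show ?case using 1 2 pu by simp
qed

definition cW :: real where "cW = q ^ (N + 1) * cD * cD"

lemma cW_pos: "0 < cW" using W_consts cD_pos by (simp add: cW_def)

text \<open>For a cell \<open>v\<close> counted in \<open>crossing\<close>, \<open>W v / D v\<close>
  is at least the same quotient at its ancestor of level \<open>n\<close>. That ancestor is within
  \<open>N + 1\<close> steps of \<open>w\<close>, so its quotient is at least
  \<open>q ^ (N + 1) * cD\<close> times the one at \<open>w\<close>.\<close>

lemma crossing_W:
  assumes w: "w \<in> V n" and vs: "vs \<noteq> []" "set vs \<subseteq> C" "successively touch vs"
    and lv: "\<forall>v\<in>set vs. n \<le> lev v"
    and e: "anc n (hd vs) = w" "(w, anc n (last vs)) \<notin> adj ^^ N"
  shows "cW * W w \<le> (\<Sum>v\<in>set vs. W v)"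
proof -
  let ?A = "{v \<in> set vs. (w, anc n v) \<in> adj ^^ (N + 1)}"
  have wC: "w \<in> C" using w by (simp add: V_iff)
  define j where "j = Max (lev ` set vs)"
  have "\<forall>v\<in>set vs. n \<le> lev v \<and> lev v \<le> n + j" using lv by (auto simp: j_def intro: trans_le_add2)
  then have cr: "cD * D w \<le> (\<Sum>v\<in>?A. D v)" using crossing[OF w vs _ e, of j] by blast
  have each: "q ^ (N + 1) * cD * W w * D v \<le> D w * W v" if v: "v \<in> ?A" for v
  proof -
    have vC: "v \<in> C" "n \<le> lev v" using v vs lv by auto
    have uC: "anc n v \<in> C" using anc_V[OF vC] by (simp add: V_iff)
    have near: "(w, anc n v) \<in> adj ^^ (N + 1)" using v by simp
    have 1: "q ^ (N + 1) * W w \<le> W (anc n v)" by (rule W_pow[OF near])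
    have 2: "cD * D (anc n v) \<le> D w" by (rule D_pow[OF adj_pow_sym[OF near] uC])
    have 3: "W (anc n v) * D v \<le> W v * D (anc n v)" using W_anc[OF vC] by blast
    have "q ^ (N + 1) * cD * W w * D v = (q ^ (N + 1) * W w) * (cD * D v)" by simp
    also have "\<dots> \<le> W (anc n v) * (cD * D v)"
      using 1 cD_pos D_nonneg by (intro mult_right_mono) auto
    also have "\<dots> = cD * (W (anc n v) * D v)" by simp
    also have "\<dots> \<le> cD * (W v * D (anc n v))" using 3 cD_pos by (intro mult_left_mono) auto
    also have "\<dots> = W v * (cD * D (anc n v))" by simp
    also have "\<dots> \<le> W v * D w" using 2 W_nonneg by (intro mult_left_mono)
    finally show ?thesis by (simp add: mult.commute)
  qed
  have "cW * W w * D w = q ^ (N + 1) * cD * W w * (cD * D w)" by (simp add: cW_def)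
  also have "\<dots> \<le> q ^ (N + 1) * cD * W w * (\<Sum>v\<in>?A. D v)"
    using cr W_consts cD_pos W_nonneg by (intro mult_left_mono) auto
  also have "\<dots> = (\<Sum>v\<in>?A. q ^ (N + 1) * cD * W w * D v)" by (rule sum_distrib_left)
  also have "\<dots> \<le> (\<Sum>v\<in>?A. D w * W v)" using each by (rule sum_mono)
  also have "\<dots> \<le> (\<Sum>v\<in>set vs. D w * W v)"
    using D_nonneg W_nonneg by (intro sum_mono2) auto
  also have "\<dots> = (\<Sum>v\<in>set vs. W v) * D w"
    by (subst mult.commute) (rule sum_distrib_left[symmetric])
  finally show ?thesis using D_pos[OF wC] by (rule mult_right_le_imp_le)
qed

end


section \<open>The chain metric\<close>

lemma sum_le_sum_list:
  fixes f :: "'a \<Rightarrow> real"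
  assumes "\<And>x. 0 \<le> f x" shows "(\<Sum>x\<in>set xs. f x) \<le> (\<Sum>x\<leftarrow>xs. f x)"
proof (induction xs)
  case (Cons x xs)
  have "(\<Sum>x\<in>set (x # xs). f x) \<le> f x + (\<Sum>x\<in>set xs. f x)"
    using assms by (cases "x \<in> set xs") (auto simp: insert_absorb)
  then show ?case using Cons by simp
qed simp

text \<open>Because of \<open>s1 \<le> s2\<close>, the maximum is the \<open>s1\<close>-th power up
  to 1 and the \<open>s2\<close>-th power beyond, so the inverse is the minimum of the two inverse
  powers.\<close>

lemma homeomorphism_powr_max:
  fixes s1 s2 A B :: real
  assumes s: "0 < s1" "s1 \<le> s2" and "0 < A" "0 < B"
  defines "g \<equiv> \<lambda>t. A * max ((B * t) powr s1) ((B * t) powr s2)"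
  shows "\<exists>g'. homeomorphism {0..} {0..} g g'" "g 0 = 0"
proof -
  define F where "F t = max (t powr s1) (t powr s2)" for t
  define H where "H y = min (y powr (1 / s1)) (y powr (1 / s2))" for y
  have s2: "0 < s2" using s by simp
  have F1: "F t = t powr s1" if "0 \<le> t" "t \<le> 1" for t
    using that s powr_mono'[of s1 s2 t] by (simp add: F_def)
  have F2: "F t = t powr s2" if "1 \<le> t" for t
    using that s powr_mono[of s1 s2 t] by (simp add: F_def)
  have inv_le: "1 / s2 \<le> 1 / s1" using s s2 by (simp add: field_simps)
  have H1: "H t = t powr (1 / s1)" if "0 \<le> t" "t \<le> 1" for t
    using that powr_mono'[OF inv_le, of t] by (simp add: H_def)
  have H2: "H t = t powr (1 / s2)" if "1 \<le> t" for t
    using that powr_mono[OF inv_le, of t] by (simp add: H_def)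
  have HF: "H (F t) = t" if "0 \<le> t" for t
  proof (cases "t \<le> 1")
    case True
    then have "t powr s1 \<le> 1" using that s by (simp add: powr_le1)
    then show ?thesis using True that F1 H1 s by (simp add: powr_powr)
  next
    case False
    then have "1 \<le> t powr s2" using s2 by (simp add: ge_one_powr_ge_zero)
    then show ?thesis using False F2 H2 s2 by (simp add: powr_powr)
  qed
  have FH: "F (H t) = t" if "0 \<le> t" for t
  proof (cases "t \<le> 1")
    case True
    then have "t powr (1 / s1) \<le> 1" using that s by (simp add: powr_le1)
    then show ?thesis using True that F1 H1 s by (simp add: powr_powr)
  next
    case False
    then have "1 \<le> t powr (1 / s2)" using s2 by (simp add: ge_one_powr_ge_zero)
    then show ?thesis using False F2 H2 s2 by (simp add: powr_powr)
  qed
  have F0: "0 \<le> F t" and H0: "0 \<le> H t" for t by (auto simp: F_def H_def le_max_iff_disj)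
  define g' where "g' y = H (y / A) / B" for y
  have g: "g t = A * F (B * t)" for t by (simp add: g_def F_def)
  have gg: "g' (g t) = t" if "0 \<le> t" for t using that assms(3,4) HF[of "B * t"] by (simp add: g g'_def)
  have gg': "g (g' y) = y" if "0 \<le> y" for y using that assms(3,4) FH[of "y / A"] by (simp add: g g'_def)
  have p: "0 \<le> g t" "0 \<le> g' t" for t using assms(3,4) F0 H0 by (auto simp: g g'_def)
  have c1: "continuous_on {0..} g"
    unfolding g_def using assms(1-4) s2 by (intro continuous_intros continuous_on_powr') auto
  have c2: "continuous_on {0..} g'"
    unfolding g'_def H_def using assms(1-4) s2 by (intro continuous_intros continuous_on_powr') auto
  have "homeomorphism {0..} {0..} g g'"
    unfolding homeomorphism_def using gg gg' p c1 c2
    by (auto simp: image_iff) (metis atLeast_iff)+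
  then show "\<exists>g'. homeomorphism {0..} {0..} g g'" by blast
  show "g 0 = 0" by (simp add: g_def)
qed

context metric_hierarchy begin

definition chains :: "'b \<Rightarrow> 'b \<Rightarrow> 'a list set" where
  "chains x y = {vs. vs \<noteq> [] \<and> set vs \<subseteq> C \<and> successively touch vs \<and> x \<in> K (hd vs) \<and> y \<in> K (last vs)}"

definition len :: "'a list \<Rightarrow> real" where "len vs = (\<Sum>v\<leftarrow>vs. W v)"

text \<open>\<open>Metric_space\<close> demands nonnegativity and symmetry for all arguments.
  Outside \<open>S\<close> there are no chains, and the infimum of the empty set is unspecified,
  hence the value 0 there.\<close>

definition \<rho> :: "'b \<Rightarrow> 'b \<Rightarrow> real" where
  "\<rho> x y = (if x \<in> S \<and> y \<in> S then Inf (len ` chains x y) else 0)"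

lemma len_nonneg: "0 \<le> len vs"
  unfolding len_def by (rule sum_list_nonneg) (use W_nonneg in auto)

lemma W_le_len: "v \<in> set vs \<Longrightarrow> W v \<le> len vs"
  unfolding len_def using W_nonneg by (intro member_le_sum_list) auto

lemma phi: "\<phi> \<in> C" "lev \<phi> = 0" "K \<phi> = S"
proof -
  have "\<phi> \<in> V 0" using root by simp
  then show "\<phi> \<in> C" "lev \<phi> = 0" by (auto simp: V_iff)
  show "K \<phi> = S" using K_root root by (simp add: V_def)
qed

lemma chains_ne: "x \<in> S \<Longrightarrow> y \<in> S \<Longrightarrow> [\<phi>] \<in> chains x y"
  using phi by (simp add: chains_def)

lemma bdd: "bdd_below (len ` chains x y)"
  by (rule bdd_belowI[of _ 0]) (use len_nonneg in auto)

lemma rho_le: "vs \<in> chains x y \<Longrightarrow> x \<in> S \<Longrightarrow> y \<in> S \<Longrightarrow> \<rho> x y \<le> len vs"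
  unfolding \<rho>_def using bdd by (auto intro: cInf_lower)

lemma rho_ge:
  assumes "x \<in> S" "y \<in> S" "\<And>vs. vs \<in> chains x y \<Longrightarrow> c \<le> len vs" shows "c \<le> \<rho> x y"
proof -
  have "c \<le> Inf (len ` chains x y)" using chains_ne[OF assms(1,2)] assms(3) by (intro cInf_greatest) auto
  then show ?thesis using assms by (simp add: \<rho>_def)
qed

lemma rho_nonneg: "0 \<le> \<rho> x y"
proof (cases "x \<in> S \<and> y \<in> S")
  case True
  then show ?thesis using len_nonneg by (intro rho_ge) auto
qed (auto simp: \<rho>_def)

lemma rho_cell: assumes "v \<in> C" "x \<in> K v" "y \<in> K v" shows "\<rho> x y \<le> W v"
proof -
  have "[v] \<in> chains x y" using assms by (simp add: chains_def)
  moreover have "x \<in> S" "y \<in> S" using K_subset_S assms by auto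
  ultimately show ?thesis using rho_le[of "[v]" x y] by (simp add: len_def)
qed

lemma rev_chains: "vs \<in> chains x y \<Longrightarrow> rev vs \<in> chains y x"
  using touch_sym by (auto simp: chains_def successively_rev hd_rev last_rev elim: successively_mono)

lemma len_rev: "len (rev vs) = len vs"
  by (simp add: len_def rev_map[symmetric] sum_list_rev)

lemma rho_commute: "\<rho> x y = \<rho> y x"
proof -
  have "len ` chains x y \<subseteq> len ` chains y x" for x y
    using rev_chains len_rev by (metis image_eqI image_subsetI)
  then have "len ` chains x y = len ` chains y x" by blast
  then show ?thesis by (simp add: \<rho>_def conj_commute)
qed

lemma rho_triangle:
  assumes "x \<in> S" "y \<in> S" "z \<in> S" shows "\<rho> x z \<le> \<rho> x y + \<rho> y z"
proof -
  have app: "\<rho> x z \<le> len vs + len us" if v: "vs \<in> chains x y" and u: "us \<in> chains y z" for vs us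
  proof -
    have "touch (last vs) (hd us)" using v u by (auto simp: chains_def touch_def)
    then have "vs @ us \<in> chains x z" using v u by (auto simp: chains_def successively_append_iff)
    then show ?thesis using rho_le[of "vs @ us" x z] assms by (simp add: len_def)
  qed
  have "\<rho> x z - \<rho> x y \<le> len us" if u: "us \<in> chains y z" for us
  proof -
    have "\<rho> x z - len us \<le> \<rho> x y"
      by (rule rho_ge[OF assms(1,2)]) (use app u in fastforce)
    then show ?thesis by simp
  qed
  then have "\<rho> x z - \<rho> x y \<le> \<rho> y z" by (rule rho_ge[OF assms(2,3)])
  then show ?thesis by simp
qed

lemma W_anc_le: "v \<in> C \<Longrightarrow> n \<le> lev v \<Longrightarrow> W v \<le> W (anc n v)"
proof -
  assume a: "v \<in> C" "n \<le> lev v"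
  have "W v \<le> bW ^ (lev v - n) * W (anc n v)" using W_anc[OF a] by blast
  also have "\<dots> \<le> 1 * W (anc n v)"
    using W_consts W_nonneg by (intro mult_right_mono power_le_one) auto
  finally show ?thesis by simp
qed

lemma W_root: "W \<phi> = 1" using root by (simp add: W_V[of \<phi> 0])

lemma W_le: "v \<in> V n \<Longrightarrow> W v \<le> bW ^ n"
proof -
  assume v: "v \<in> V n"
  then have vC: "v \<in> C" "lev v = n" by (auto simp: V_iff)
  have "anc 0 v = \<phi>" using anc_V[OF vC(1), of 0] root by simp
  then show ?thesis using W_anc[OF vC(1), of 0] vC W_root by simp
qed

text \<open>The entries belong to the two cases of \<open>rho_lower\<close>: a coarse cell met
  within \<open>N + 2\<close> steps, and a crossing by fine cells that starts below a neighbour of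
  \<open>w\<close>.\<close>

definition cL :: real where "cL = min (q ^ (N + 2)) (cW * q)"

lemma cL: "0 < cL" "cL \<le> 1"
  using W_consts cW_pos power_le_one[of q "N+2"] by (auto simp: cL_def)

text \<open>
  A chain may contain cells coarser than \<open>w\<close>; the first of these that it meets is already
  comparable to \<open>w\<close> or larger, so only the part before it needs \<open>crossing_W\<close>.
\<close>

lemma rho_lower:
  assumes w: "w \<in> V n" and x: "x \<in> K w" and y: "y \<in> S"
    and far: "\<And>u. (w,u) \<in> adj ^^ (N + 1) \<Longrightarrow> y \<notin> K u"
  shows "cL * W w \<le> \<rho> x y"
proof (rule rho_ge)
  have wC: "w \<in> C" "lev w = n" using w by (auto simp: V_iff)
  show "x \<in> S" using x K_subset_S[OF wC(1)] by blast
  show "y \<in> S" by fact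
  fix vs assume "vs \<in> chains x y"
  then have vs: "vs \<noteq> []" "set vs \<subseteq> C" "successively touch vs" "x \<in> K (hd vs)" "y \<in> K (last vs)"
    by (auto simp: chains_def)
  \<comment> \<open>Every chain from \<open>x\<close> to \<open>y\<close> meets a bad cell: if its
    last cell were not bad, the ancestor of that cell would put \<open>y\<close> within
    \<open>N + 1\<close> steps of \<open>w\<close>.\<close>
  define bad where "bad v \<longleftrightarrow> lev v < n \<or> (w, anc n v) \<notin> adj ^^ (N + 1)" for v
  have "bad (last vs)"
  proof (rule ccontr)
    assume b: "\<not> bad (last vs)"
    then have n: "n \<le> lev (last vs)" "(w, anc n (last vs)) \<in> adj ^^ (N + 1)" by (auto simp: bad_def)
    have "last vs \<in> C" using vs by auto
    then have "y \<in> K (anc n (last vs))" using K_anc n vs by blast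
    then show False using far n by blast
  qed
  then obtain as z bs where e: "vs = as @ z # bs" "bad z" "\<forall>v\<in>set as. \<not> bad v"
    using split_list_first_prop[of vs bad] vs(1) last_in_set by blast
  have zC: "z \<in> C" using vs(2) e by auto
  have asC: "set as \<subseteq> C" using vs(2) e by auto
  have as_near: "n \<le> lev v" "(w, anc n v) \<in> adj ^^ (N + 1)" if "v \<in> set as" for v
    using e(3) that by (auto simp: bad_def)
  have Wz: "W z \<le> len vs" using e by (intro W_le_len) auto
  show "cL * W w \<le> len vs"
  proof (cases "lev z < n")
    case True
    obtain c t where c: "c \<in> V n" "(w,c) \<in> adj ^^ (N + 1)" "t \<in> K c" "t \<in> K z"
    proof (cases "as = []")
      case True
      then have "x \<in> K z" using vs e by simp
      then show ?thesis using that[of w x] w x adj_pow_refl[OF wC(1)] by blast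
    next
      case False
      then have "touch (last as) z" using vs(3) e by (simp add: successively_append_iff)
      then obtain t where t: "t \<in> K (last as)" "t \<in> K z" by (auto simp: touch_def)
      have l: "last as \<in> set as" using False by simp
      then have lC: "last as \<in> C" using asC by blast
      show ?thesis
      proof (rule that[of "anc n (last as)" t])
        show "anc n (last as) \<in> V n" using anc_V[OF lC] as_near[OF l] by blast
        show "t \<in> K (anc n (last as))" using K_anc[OF lC] as_near[OF l] t by blast
      qed (use as_near[OF l] t in auto)
    qed
    \<comment> \<open>To compare the coarse \<open>z\<close> with \<open>w\<close>, a cell of level
      \<open>n\<close> below \<open>z\<close> is taken at the point where \<open>z\<close> is
      reached; it is within \<open>N + 2\<close> steps of \<open>w\<close> and not larger than
      \<open>z\<close>.\<close>
    obtain z' where z': "z' \<in> V n" "anc (lev z) z' = z" "t \<in> K z'"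
      using cell_below[of z "lev z" t n] zC c True by (auto simp: V_iff)
    have z'C: "z' \<in> C" "lev z' = n" using z' by (auto simp: V_iff)
    have "(c,z') \<in> adj" using c z' by (auto simp: adj_def V_iff)
    then have "(w,z') \<in> adj ^^ (N + 2)" using c by auto
    then have "q ^ (N + 2) * W w \<le> W z'" by (rule W_pow)
    also have "\<dots> \<le> W z" using W_anc_le[OF z'C(1), of "lev z"] z' z'C True by simp
    finally have "q ^ (N + 2) * W w \<le> len vs" using Wz by linarith
    moreover have "cL * W w \<le> q ^ (N + 2) * W w"
      using W_nonneg by (intro mult_right_mono) (auto simp: cL_def)
    ultimately show ?thesis by linarith
  next
    case False
    then have z: "n \<le> lev z" "(w, anc n z) \<notin> adj ^^ (N + 1)" using e(2) by (auto simp: bad_def)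
    have as_ne: "as \<noteq> []"
    proof
      assume "as = []"
      then have "x \<in> K z" using vs e by simp
      then have "x \<in> K (anc n z)" using K_anc[OF zC z(1)] by blast
      then have "(w, anc n z) \<in> adj" using anc_V[OF zC z(1)] w x by (auto simp: adj_def V_iff)
      then have "(w, anc n z) \<in> adj ^^ 1" by simp
      then have "(w, anc n z) \<in> adj ^^ (N + 1)" by (rule adj_pow_mono) (use wC in simp_all)
      then show False using z by blast
    qed
    \<comment> \<open>The point \<open>x\<close> may lie in several cells of level \<open>n\<close>,
      and the chain need not start below \<open>w\<close>. Starting at the neighbour
      \<open>w1\<close> costs the factor \<open>q\<close> and one of the \<open>N + 1\<close>
      steps.\<close>
    define w1 where "w1 = anc n (hd as)"
    have h: "hd as \<in> set as" using as_ne by simp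
    then have hC: "hd as \<in> C" using asC by blast
    have xh: "x \<in> K (hd as)" using vs(4) e as_ne by simp
    have w1: "w1 \<in> V n" using anc_V[OF hC] as_near[OF h] by (simp add: w1_def)
    have "x \<in> K w1" using K_anc[OF hC] as_near[OF h] xh unfolding w1_def by blast
    then have ww1: "(w,w1) \<in> adj" using w w1 x by (auto simp: adj_def V_iff)
    have "(w1, anc n z) \<notin> adj ^^ N"
    proof
      assume "(w1, anc n z) \<in> adj ^^ N"
      then have "(w, anc n z) \<in> adj ^^ Suc N" using ww1 by (rule relpow_Suc_I2[rotated])
      then show False using z by simp
    qed
    then have "cW * W w1 \<le> (\<Sum>v\<in>set (as @ [z]). W v)"
    proof (intro crossing_W[OF w1])
      have "vs = (as @ [z]) @ bs" using e by simp
      then show "successively touch (as @ [z])" using vs(3) by (simp only: successively_append_iff)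
      show "anc n (hd (as @ [z])) = w1" using as_ne by (simp add: w1_def)
      show "\<forall>v\<in>set (as @ [z]). n \<le> lev v" using as_near z by auto
    qed (use asC zC in auto)
    also have "\<dots> \<le> (\<Sum>v\<in>set vs. W v)" using e W_nonneg by (intro sum_mono2) auto
    also have "\<dots> \<le> len vs" unfolding len_def using W_nonneg by (rule sum_le_sum_list)
    finally have 1: "cW * W w1 \<le> len vs" .
    have "cL * W w \<le> (cW * q) * W w" using W_nonneg by (intro mult_right_mono) (auto simp: cL_def)
    also have "\<dots> \<le> cW * W w1" using W_adj[OF ww1] cW_pos by simp
    finally show ?thesis using 1 by linarith
  qed
qed

lemma d_nonneg: "0 \<le> d x y" using Metric_space.nonneg[OF d_metric] .

lemma pow_dist:
  assumes "w \<in> V n" "(w,u) \<in> adj ^^ i" "x \<in> K w" "y \<in> K u"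
  shows "d x y \<le> (real i + 1) * c2 * R ^ n \<and> \<rho> x y \<le> (real i + 1) / q ^ i * W w"
  using assms(2,4)
proof (induction i arbitrary: u y)
  case 0
  then show ?case using diam[OF assms(1,3)] rho_cell[of w x y] assms by (simp add: V_iff)
next
  case (Suc i)
  obtain z where z: "(w,z) \<in> adj ^^ i" "(z,u) \<in> adj" using Suc.prems(1) by auto
  obtain t where t: "t \<in> K z" "t \<in> K u" using adj_D[OF z(2)] by auto
  have u: "u \<in> V n" using adj_pow_V[OF Suc.prems(1) assms(1)] .
  have inS: "x \<in> S" "t \<in> S" "y \<in> S"
    using K_subset_S[of w] K_subset_S[of u] assms(1,3) t u Suc.prems(2) by (auto simp: V_iff)
  have IH: "d x t \<le> (real i + 1) * c2 * R ^ n" "\<rho> x t \<le> (real i + 1) / q ^ i * W w"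
    using Suc.IH[OF z(1) t(1)] by auto
  have "d x y \<le> d x t + d t y" using Metric_space.triangle[OF d_metric inS] .
  moreover have "d t y \<le> c2 * R ^ n" using diam[OF u t(2) Suc.prems(2)] .
  ultimately have 1: "d x y \<le> (real (Suc i) + 1) * c2 * R ^ n" using IH(1) by (simp add: algebra_simps)
  have "\<rho> x y \<le> \<rho> x t + \<rho> t y" using rho_triangle[OF inS] .
  moreover have "\<rho> t y \<le> W u" using rho_cell[of u t y] u t(2) Suc.prems(2) by (simp add: V_iff)
  moreover have "q ^ Suc i * W u \<le> W w" by (rule W_pow[OF adj_pow_sym[OF Suc.prems(1)]])
  then have "W u \<le> 1 / q ^ Suc i * W w" using W_consts by (simp add: field_simps)
  moreover have "(real i + 1) / q ^ i * W w \<le> (real i + 1) / q ^ Suc i * W w"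
    using W_consts W_nonneg by (intro mult_right_mono divide_left_mono power_decreasing) auto
  ultimately have "\<rho> x y \<le> (real i + 1) / q ^ Suc i * W w + 1 / q ^ Suc i * W w" using IH(2) by linarith
  also have "\<dots> = (real (Suc i) + 1) / q ^ Suc i * W w" by (simp add: add_divide_distrib algebra_simps)
  finally show ?case using 1 by blast
qed

text \<open>The level is the one just before the first level at which \<open>x\<close> and
  \<open>y\<close> no longer lie in cells at most \<open>N + 1\<close> steps apart. Such a level
  exists because the nearness forces \<open>d x y\<close> down to the scale. Nearness at
  \<open>n\<close> gives both upper bounds, its failure at \<open>Suc n\<close> both lower ones, by
  \<open>rho_lower\<close> and by \<open>sep\<close>.\<close>

lemma scale:
  assumes "x \<in> S" "y \<in> S" "x \<noteq> y"
  obtains n w where "w \<in> V n" "x \<in> K w"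
    "cL * aW * W w \<le> \<rho> x y" "\<rho> x y \<le> (real N + 2) / q ^ (N + 1) * W w"
    "c3 * R * R ^ n \<le> d x y" "d x y \<le> (real N + 2) * c2 * R ^ n"
proof -
  define cl where "cl n \<longleftrightarrow> (\<exists>w\<in>V n. \<exists>u. x \<in> K w \<and> y \<in> K u \<and> (w,u) \<in> adj ^^ (N + 1))" for n
  have cl_d: "d x y \<le> (real N + 2) * c2 * R ^ n" if "cl n" for n
    using that pow_dist[of _ n _ "N+1" x y] unfolding cl_def by (fastforce simp: add.commute)
  have "0 < d x y" using Metric_space.mdist_pos_less[OF d_metric] assms by blast
  moreover have "(\<lambda>n. (real N + 2) * c2 * R ^ n) \<longlonglongrightarrow> (real N + 2) * c2 * 0"
    using R by (intro tendsto_mult_left LIMSEQ_power_zero) auto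
  ultimately have "eventually (\<lambda>n. (real N + 2) * c2 * R ^ n < d x y) sequentially"
    by (intro order_tendstoD(2)[of _ "(real N + 2) * c2 * 0"]) auto
  then obtain n0 where "(real N + 2) * c2 * R ^ n0 < d x y" using eventually_happens by fastforce
  then have n0: "\<not> cl n0" using cl_d[of n0] by linarith
  define k where "k = (LEAST n. \<not> cl n)"
  have k: "\<not> cl k" unfolding k_def by (rule LeastI[of "\<lambda>n. \<not> cl n", OF n0])
  have below: "cl n" if "n < k" for n using not_less_Least[of n "\<lambda>n. \<not> cl n"] that by (auto simp: k_def)
  have "cl 0" unfolding cl_def using root phi assms adj_pow_refl[of \<phi>] by blast
  then have "k \<noteq> 0" using k by metis
  then obtain n where n: "k = Suc n" by (cases k) auto
  then obtain w u where w: "w \<in> V n" "x \<in> K w" "y \<in> K u" "(w,u) \<in> adj ^^ (N + 1)"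
    using below[of n] unfolding cl_def by auto
  obtain w1 where w1: "w1 \<in> V (Suc n)" "par w1 = w" "x \<in> K w1" using K_eq[OF w(1)] w(2) by auto
  have far: "y \<notin> K u" if "(w1,u) \<in> adj ^^ (N + 1)" for u
    using k that w1 unfolding n cl_def by blast
  show ?thesis
  proof (rule that[OF w(1,2)])
    have "cL * (aW * W w) \<le> cL * W w1" using W_par(1)[OF w1(1)] w1(2) cL by (intro mult_left_mono) auto
    also have "\<dots> \<le> \<rho> x y" by (rule rho_lower[OF w1(1,3) assms(2) far])
    finally show "cL * aW * W w \<le> \<rho> x y" by simp
    show "\<rho> x y \<le> (real N + 2) / q ^ (N + 1) * W w"
      using pow_dist[OF w(1,4,2,3)] by (simp add: add.commute)
    show "d x y \<le> (real N + 2) * c2 * R ^ n" using pow_dist[OF w(1,4,2,3)] by (simp add: add.commute)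
    show "c3 * R * R ^ n \<le> d x y"
    proof (rule ccontr)
      assume "\<not> c3 * R * R ^ n \<le> d x y"
      then have less: "d x y < c3 * R ^ Suc n" by simp
      obtain u1 where u1: "u1 \<in> V (Suc n)" "y \<in> K u1" using cell_at[OF assms(2)] by blast
      have "(w1,u1) \<in> adj ^^ N" using sep[OF w1(1) u1(1) w1(3) u1(2) less] .
      then have "(w1,u1) \<in> adj ^^ (N + 1)" by (rule adj_pow_mono) (use w1 in \<open>simp_all add: V_iff\<close>)
      then show False using far u1 by blast
    qed
  qed
qed

lemma rho_refl: "x \<in> S \<Longrightarrow> \<rho> x x = 0"
proof -
  assume x: "x \<in> S"
  have le: "\<rho> x x \<le> bW ^ n" for n
  proof -
    obtain v where v: "v \<in> V n" "x \<in> K v" using cell_at[OF x] .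
    then show ?thesis using rho_cell[of v x x] W_le[OF v(1)] by (simp add: V_iff)
  qed
  have "(\<lambda>n. bW ^ n) \<longlonglongrightarrow> 0" using W_consts by (intro LIMSEQ_power_zero) auto
  then have "\<rho> x x \<le> 0" by (rule LIMSEQ_le_const) (use le in blast)
  then show ?thesis using rho_nonneg[of x x] by linarith
qed

lemma rho_pos: "x \<in> S \<Longrightarrow> y \<in> S \<Longrightarrow> x \<noteq> y \<Longrightarrow> 0 < \<rho> x y"
proof -
  assume a: "x \<in> S" "y \<in> S" "x \<noteq> y"
  obtain n w where w: "w \<in> V n" "cL * aW * W w \<le> \<rho> x y" using scale[OF a] by metis
  have "0 < cL * aW * W w" using W_pos[of w] w cL W_consts by (simp add: V_iff)
  then show ?thesis using w(2) by linarith
qed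

lemma rho_metric: "Metric_space S \<rho>"
proof
  show "0 \<le> \<rho> x y" for x y by (rule rho_nonneg)
  show "\<rho> x y = \<rho> y x" for x y by (rule rho_commute)
  show "\<rho> x y = 0 \<longleftrightarrow> x = y" if "x \<in> S" "y \<in> S" for x y
    using rho_refl rho_pos that by force
  show "\<rho> x z \<le> \<rho> x y + \<rho> y z" if "x \<in> S" "y \<in> S" "z \<in> S" for x y z
    by (rule rho_triangle[OF that])
qed

text \<open>These exponents translate factors of \<open>W\<close> per level into powers of the
  scale: \<open>R powr s1\<close> is \<open>bW\<close>, the slowest decay, and
  \<open>R powr s2\<close> is \<open>aW\<close>, the fastest.\<close>

definition s1 :: real where "s1 = ln bW / ln R"
definition s2 :: real where "s2 = ln aW / ln R"

lemma s12: "0 < s1" "s1 \<le> s2" "R powr s1 = bW" "R powr s2 = aW"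
proof -
  have r: "ln R < 0" using R by simp
  show "0 < s1" unfolding s1_def using W_consts r by (intro divide_neg_neg) auto
  have "ln aW \<le> ln bW" using W_consts by simp
  then show "s1 \<le> s2" unfolding s1_def s2_def using r by (intro divide_right_mono_neg) auto
  show "R powr s1 = bW" "R powr s2 = aW" using R W_consts r by (auto simp: s1_def s2_def powr_def)
qed

text \<open>The finer cell is replaced by its ancestor at the level of the coarser one, which is a
  neighbour of the latter. The levels in between cost a power of \<open>bW\<close> if
  \<open>w\<close> is the finer cell and of \<open>aW\<close> if \<open>w'\<close> is; the maximum
  covers both.\<close>

lemma W_compare:
  assumes "w \<in> V n" "w' \<in> V n'" "x \<in> K w" "x \<in> K w'"
  shows "W w \<le> max ((R ^ n / R ^ n') powr s1) ((R ^ n / R ^ n') powr s2) / q * W w'"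
proof (cases "n' \<le> n")
  case True
  have wC: "w \<in> C" "lev w = n" using assms by (auto simp: V_iff)
  have u: "anc n' w \<in> V n'" using anc_V wC True by simp
  have "x \<in> K (anc n' w)" using K_anc[OF wC(1), of n'] True wC assms by auto
  then have "(anc n' w, w') \<in> adj" using u assms by (auto simp: adj_def V_iff)
  then have 1: "q * W (anc n' w) \<le> W w'" by (rule W_adj)
  have "bW ^ (n - n') = (R ^ (n - n')) powr s1"
    using R by (simp add: s12(3)[symmetric] powr_power powr_powr powr_realpow[symmetric] mult.commute)
  also have "R ^ (n - n') = R ^ n / R ^ n'" using R True by (simp add: power_diff)
  finally have e: "bW ^ (n - n') = (R ^ n / R ^ n') powr s1" .
  have "W w \<le> bW ^ (n - n') * W (anc n' w)" using W_anc[OF wC(1), of n'] wC True by simp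
  also have "\<dots> \<le> bW ^ (n - n') * (W w' / q)"
    using 1 W_consts by (intro mult_left_mono) (auto simp: field_simps)
  also have "\<dots> \<le> max ((R ^ n / R ^ n') powr s1) ((R ^ n / R ^ n') powr s2) * (W w' / q)"
    unfolding e using W_consts W_nonneg by (intro mult_right_mono) auto
  finally show ?thesis by simp
next
  case False
  then have le: "n \<le> n'" by simp
  have wC: "w' \<in> C" "lev w' = n'" using assms by (auto simp: V_iff)
  have u: "anc n w' \<in> V n" using anc_V wC le by simp
  have "x \<in> K (anc n w')" using K_anc[OF wC(1), of n] le wC assms by auto
  then have "(w, anc n w') \<in> adj" using u assms by (auto simp: adj_def V_iff)
  then have 1: "q * W w \<le> W (anc n w')" by (rule W_adj)
  have "1 / aW ^ (n' - n) = 1 / (R ^ (n' - n)) powr s2"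
    using R by (simp add: s12(4)[symmetric] powr_power powr_powr powr_realpow[symmetric] mult.commute)
  also have "\<dots> = (1 / R ^ (n' - n)) powr s2" using R by (simp add: powr_divide)
  also have "1 / R ^ (n' - n) = R ^ n / R ^ n'" using R le by (simp add: power_diff)
  finally have e: "1 / aW ^ (n' - n) = (R ^ n / R ^ n') powr s2" .
  have "aW ^ (n' - n) * W (anc n w') \<le> W w'" using W_anc[OF wC(1), of n] wC le by simp
  then have "W (anc n w') \<le> 1 / aW ^ (n' - n) * W w'" using W_consts by (simp add: field_simps)
  then have 2: "W (anc n w') / q \<le> 1 / aW ^ (n' - n) * W w' / q" using W_consts by (intro divide_right_mono) auto
  have "W w \<le> W (anc n w') / q" using 1 W_consts by (simp add: field_simps)
  with 2 have "W w \<le> 1 / aW ^ (n' - n) * W w' / q" by linarith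
  also have "\<dots> = (R ^ n / R ^ n') powr s2 * (W w' / q)" unfolding e by simp
  also have "\<dots> \<le> max ((R ^ n / R ^ n') powr s1) ((R ^ n / R ^ n') powr s2) * (W w' / q)"
    using W_consts W_nonneg by (intro mult_right_mono) auto
  finally show ?thesis by simp
qed

lemma rho_quasisymmetric: "quasisymmetric S d \<rho>"
proof -
  \<comment> \<open>\<open>A\<close> and \<open>B\<close> collect the constants of
    \<open>scale\<close>: \<open>B\<close> turns a bound on the ratio of distances in
    \<open>d\<close> into one on \<open>R ^ n / R ^ n'\<close>, and \<open>A\<close> turns the ratio
    of the weights \<open>W\<close> back into one of distances in \<open>\<rho>\<close>.\<close>
  define A where "A = ((real N + 2) / q ^ (N + 1)) / q / (cL * aW)"
  define B where "B = (real N + 2) * c2 / (c3 * R)"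
  define g where "g t = A * max ((B * t) powr s1) ((B * t) powr s2)" for t
  have A: "0 < A" using W_consts cL by (auto simp: A_def)
  have B: "0 < B" using c2_pos c3_pos R by (auto simp: B_def)
  obtain g' where g': "homeomorphism {0..} {0..} g g'" and g0: "g 0 = 0"
    using homeomorphism_powr_max[OF s12(1,2) A B] unfolding g_def by blast
  have "\<rho> x z < g t * \<rho> x y"
    if t: "t > 0" and xyz: "x \<in> S" "y \<in> S" "z \<in> S" and dl: "d x z < t * d x y" for t x y z
  proof -
    have "d x y \<noteq> 0" using dl d_nonneg[of x z] by auto
    then have xy: "x \<noteq> y" using Metric_space.mdist_zero[OF d_metric] xyz by metis
    have gt: "0 < g t" using A B t by (auto simp: g_def less_max_iff_disj)
    have rxy: "0 < \<rho> x y" by (rule rho_pos) (use xyz xy in auto)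
    show ?thesis
    proof (cases "x = z")
      case True
      then show ?thesis using gt rxy rho_refl xyz by simp
    next
      case False
      obtain n w where w: "w \<in> V n" "x \<in> K w" "\<rho> x z \<le> (real N + 2) / q ^ (N + 1) * W w"
        "c3 * R * R ^ n \<le> d x z" using scale[OF xyz(1,3) False] by metis
      obtain n' w' where w': "w' \<in> V n'" "x \<in> K w'" "cL * aW * W w' \<le> \<rho> x y"
        "d x y \<le> (real N + 2) * c2 * R ^ n'" using scale[OF xyz(1,2) xy] by metis
      let ?u = "R ^ n / R ^ n'"
      have "c3 * R * R ^ n < t * ((real N + 2) * c2 * R ^ n')"
        using w(4) dl w'(4) t by (meson le_less_trans less_le_trans mult_le_cancel_left_pos)
      then have u: "?u < B * t" using R c3_pos by (simp add: B_def field_simps)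
      have u0: "0 < ?u" using R by simp
      have mx: "max (?u powr s1) (?u powr s2) < max ((B * t) powr s1) ((B * t) powr s2)"
        using powr_less_mono2[OF _ less_imp_le[OF u0] u] s12 by (meson less_le_trans max.strict_coboundedI1 max.strict_coboundedI2 max_less_iff_conj)
      have Ww': "W w' \<le> \<rho> x y / (cL * aW)" using w'(3) cL W_consts by (simp add: field_simps)
      have "\<rho> x z \<le> (real N + 2) / q ^ (N + 1) * (max (?u powr s1) (?u powr s2) / q * W w')"
        using w(3) W_compare[OF w(1) w'(1) w(2) w'(2)] W_consts
        by (meson mult_left_mono order_trans zero_le_divide_iff zero_le_power less_imp_le of_nat_0_le_iff add_nonneg_nonneg zero_le_numeral)
      also have "\<dots> \<le> (real N + 2) / q ^ (N + 1) * (max (?u powr s1) (?u powr s2) / q * (\<rho> x y / (cL * aW)))"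
        using Ww' W_consts by (intro mult_left_mono) (auto simp: le_max_iff_disj)
      also have "\<dots> = A * max (?u powr s1) (?u powr s2) * \<rho> x y" by (simp add: A_def)
      also have "\<dots> < A * max ((B * t) powr s1) ((B * t) powr s2) * \<rho> x y"
        using mx A rxy by (intro mult_strict_right_mono mult_strict_left_mono)
      finally show ?thesis by (simp add: g_def)
    qed
  qed
  then show ?thesis unfolding quasisymmetric_def using g' g0 by blast
qed

end


section \<open>The natural measure\<close>

text \<open>The left end of the interval of \<open>v\<close> when intervals of lengths
  \<open>f\<close> are laid side by side in the order of the list, starting at 0.\<close>

definition offset :: "('a \<Rightarrow> real) \<Rightarrow> 'a list \<Rightarrow> 'a \<Rightarrow> real" where
  "offset f xs v = (\<Sum>u\<leftarrow>takeWhile (\<lambda>u. u \<noteq> v) xs. f u)"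

lemma offset_bounds:
  assumes "\<And>x. x \<in> set xs \<Longrightarrow> 0 \<le> f x" "v \<in> set xs"
  shows "0 \<le> offset f xs v" "offset f xs v + f v \<le> (\<Sum>u\<leftarrow>xs. f u)"
proof -
  have "0 \<le> offset f xs v \<and> offset f xs v + f v \<le> (\<Sum>u\<leftarrow>xs. f u)"
    using assms
  proof (induction xs)
    case (Cons x xs)
    show ?case
    proof (cases "v = x")
      case True
      have "0 \<le> (\<Sum>u\<leftarrow>xs. f u)" using Cons.prems(1) by (intro sum_list_nonneg) auto
      then show ?thesis using True by (simp add: offset_def)
    next
      case False
      then have "0 \<le> offset f xs v \<and> offset f xs v + f v \<le> (\<Sum>u\<leftarrow>xs. f u)"
        using Cons by auto
      then show ?thesis using False Cons.prems(1)[of x] by (simp add: offset_def)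
    qed
  qed simp
  then show "0 \<le> offset f xs v" "offset f xs v + f v \<le> (\<Sum>u\<leftarrow>xs. f u)" by auto
qed

lemma offset_cover:
  assumes "distinct xs" "s \<le> t" "t < s + (\<Sum>u\<leftarrow>xs. f u)"
  shows "\<exists>v\<in>set xs. s + offset f xs v \<le> t \<and> t < s + offset f xs v + f v"
  using assms
proof (induction xs arbitrary: s)
  case (Cons x xs)
  show ?case
  proof (cases "t < s + f x")
    case True
    then show ?thesis using Cons.prems by (intro bexI[of _ x]) (auto simp: offset_def)
  next
    case False
    then obtain v where v: "v \<in> set xs" "s + f x + offset f xs v \<le> t" "t < s + f x + offset f xs v + f v"
      using Cons.IH[of "s + f x"] Cons.prems by auto
    moreover have "v \<noteq> x" using v(1) Cons.prems(1) by auto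
    ultimately show ?thesis by (intro bexI[of _ v]) (auto simp: offset_def)
  qed
qed simp

lemma offset_unique:
  assumes "\<And>x. x \<in> set xs \<Longrightarrow> 0 \<le> f x" "u \<in> set xs" "v \<in> set xs"
    "s + offset f xs u \<le> t" "t < s + offset f xs u + f u"
    "s + offset f xs v \<le> t" "t < s + offset f xs v + f v"
  shows "u = v"
  using assms
proof (induction xs arbitrary: s)
  case (Cons x xs)
  have o: "offset f (x # xs) z = (if z = x then 0 else f x + offset f xs z)" for z
    by (simp add: offset_def)
  have nn: "0 \<le> offset f xs z" if "z \<in> set xs" for z
    using offset_bounds(1)[of xs f z] that Cons.prems(1) by simp
  consider "u = x" "v = x" | "u = x" "v \<noteq> x" | "u \<noteq> x" "v = x" | "u \<noteq> x" "v \<noteq> x" by blast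
  then show ?case
  proof cases
    case 2
    then show ?thesis using Cons.prems nn[of v] by (simp add: o)
  next
    case 3
    then show ?thesis using Cons.prems nn[of u] by (simp add: o)
  next
    case 4
    then show ?thesis using Cons.IH[of "s + f x"] Cons.prems by (simp add: o add.assoc)
  qed simp
qed simp

locale measured_hierarchy = metric_hierarchy +
  assumes ray_point: "\<lbrakk>\<And>n. \<omega> n \<in> V n; \<And>n. par (\<omega> (Suc n)) = \<omega> n\<rbrakk> \<Longrightarrow> \<exists>x. \<forall>n. x \<in> K (\<omega> n)"
begin

abbreviation "mb \<equiv> Metric_space.mball S \<rho>"

definition cl :: "nat \<Rightarrow> 'a \<Rightarrow> 'a list" where
  "cl n w = (SOME xs. set xs = ch n w \<and> distinct xs)"

lemma cl: "set (cl n w) = ch n w" "distinct (cl n w)"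
proof -
  have "set (cl n w) = ch n w \<and> distinct (cl n w)"
    unfolding cl_def by (rule someI_ex) (use finite_distinct_list[OF finite_ch] in blast)
  then show "set (cl n w) = ch n w" "distinct (cl n w)" by auto
qed

primrec st :: "nat \<Rightarrow> 'a \<Rightarrow> real" where
  "st 0 v = 0"
| "st (Suc n) v = st n (par v) + offset (m (Suc n)) (cl n (par v)) v"

text \<open>
  The cells of each level are coded by disjoint subintervals of \<open>{0..<1}\<close> of length \<open>m n v\<close>, and the
  measure on the space is the image of Lebesgue measure under the resulting map.
\<close>

definition I :: "nat \<Rightarrow> 'a \<Rightarrow> real set" where "I n v = {st n v..<st n v + m n v}"

lemma ch_V: "v \<in> ch n w \<longleftrightarrow> v \<in> V (Suc n) \<and> par v = w" by (simp add: ch_def)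

lemma m_nonneg_ch: "v \<in> set (cl n w) \<Longrightarrow> 0 \<le> m (Suc n) v"
  using m_pos[of v "Suc n"] by (simp add: cl ch_V del: m.simps)

lemma sum_cl: "w \<in> V n \<Longrightarrow> (\<Sum>v\<leftarrow>cl n w. m (Suc n) v) = m n w"
  using m_children[of w n] cl by (simp add: sum_list_distinct_conv_sum_set del: m.simps)

lemma I_sub: assumes "v \<in> V (Suc n)" shows "I (Suc n) v \<subseteq> I n (par v)"
proof -
  have v: "v \<in> set (cl n (par v))" using assms by (simp add: cl ch_V)
  have "0 \<le> offset (m (Suc n)) (cl n (par v)) v"
    "offset (m (Suc n)) (cl n (par v)) v + m (Suc n) v \<le> m n (par v)"
    using offset_bounds[of "cl n (par v)" "m (Suc n)" v, OF m_nonneg_ch v] sum_cl[OF par_V[OF assms]]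
    by (simp_all del: m.simps)
  then show ?thesis unfolding I_def by (auto simp del: m.simps)
qed

lemma I_cover: assumes "w \<in> V n" "t \<in> I n w" shows "\<exists>v\<in>ch n w. t \<in> I (Suc n) v"
proof -
  obtain v where v: "v \<in> set (cl n w)" "st n w + offset (m (Suc n)) (cl n w) v \<le> t"
    "t < st n w + offset (m (Suc n)) (cl n w) v + m (Suc n) v"
    using offset_cover[OF cl(2), of "st n w" t "m (Suc n)" n w] assms(2) sum_cl[OF assms(1)]
    by (auto simp: I_def simp del: m.simps)
  then have "v \<in> ch n w" "par v = w" by (auto simp: cl ch_V)
  then show ?thesis using v by (intro bexI[of _ v]) (auto simp: I_def simp del: m.simps)
qed

lemma I_unique: "v \<in> V n \<Longrightarrow> u \<in> V n \<Longrightarrow> t \<in> I n v \<Longrightarrow> t \<in> I n u \<Longrightarrow> u = v"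
proof (induction n arbitrary: u v)
  case 0
  then show ?case using root by simp
next
  case (Suc n)
  have pe: "par u = par v"
    using Suc.IH[OF par_V[OF Suc.prems(1)] par_V[OF Suc.prems(2)]] I_sub Suc.prems by blast
  have c: "v \<in> set (cl n (par v))" "u \<in> set (cl n (par v))" using Suc.prems pe by (simp_all add: cl ch_V)
  show ?case
    by (rule offset_unique[where f = "m (Suc n)" and s = "st n (par v)" and t = t, OF m_nonneg_ch c(2,1)])
      (use Suc.prems pe in \<open>auto simp: I_def simp del: m.simps\<close>)
qed

lemma I_root: "I 0 \<phi> = {0..<1}" by (simp add: I_def)

lemma I_ex: "t \<in> {0..<1} \<Longrightarrow> \<exists>v. v \<in> V n \<and> t \<in> I n v"
proof (induction n)
  case 0
  then show ?case using root I_root by auto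
next
  case (Suc n)
  then show ?case using I_cover ch_V by blast
qed

lemma I_unit: "v \<in> V n \<Longrightarrow> I n v \<subseteq> {0..<1}"
proof (induction n arbitrary: v)
  case 0
  then show ?case using root I_root by simp
next
  case (Suc n)
  then show ?case using I_sub[OF Suc.prems] par_V[OF Suc.prems] by blast
qed

definition wn :: "nat \<Rightarrow> real \<Rightarrow> 'a" where "wn n t = (THE v. v \<in> V n \<and> t \<in> I n v)"

lemma wn_eq: "v \<in> V n \<Longrightarrow> t \<in> I n v \<Longrightarrow> wn n t = v"
  unfolding wn_def by (rule the_equality) (auto intro: I_unique)

lemma wn: "t \<in> {0..<1} \<Longrightarrow> wn n t \<in> V n \<and> t \<in> I n (wn n t)"
  using I_ex[of t n] wn_eq[of _ n t] by auto

lemma par_wn: assumes "t \<in> {0..<1}" shows "par (wn (Suc n) t) = wn n t"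
proof -
  have w: "wn (Suc n) t \<in> V (Suc n)" "t \<in> I (Suc n) (wn (Suc n) t)" using wn[OF assms] by auto
  have "t \<in> I n (par (wn (Suc n) t))" using I_sub[OF w(1)] w(2) by blast
  then show ?thesis using wn_eq[OF par_V[OF w(1)]] by simp
qed

definition pt :: "real \<Rightarrow> 'b" where "pt t = (SOME x. \<forall>n. x \<in> K (wn n t))"

lemma pt: assumes "t \<in> {0..<1}" shows "pt t \<in> K (wn n t)"
proof -
  have "\<exists>x. \<forall>n. x \<in> K (wn n t)" using wn[OF assms] par_wn[OF assms] by (intro ray_point) auto
  then have "\<forall>n. pt t \<in> K (wn n t)" unfolding pt_def by (rule someI_ex)
  then show ?thesis by blast
qed

lemma pt_S: "t \<in> {0..<1} \<Longrightarrow> pt t \<in> S"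
  using pt[of t 0] wn[of t 0] K_subset_S by (auto simp: V_iff)

definition Op :: "'b set set" where "Op = {U. openin (Metric_space.mtopology S \<rho>) U}"

definition \<mu> :: "'b measure" where
  "\<mu> = distr (restrict_space lborel {0..<1}) (sigma S Op) pt"

lemma Op_iff: "U \<in> Op \<longleftrightarrow> U \<subseteq> S \<and> (\<forall>x\<in>U. \<exists>r>0. mb x r \<subseteq> U)"
  using Metric_space.openin_mtopology[OF rho_metric] by (auto simp: Op_def)

lemma Op_Pow: "Op \<subseteq> Pow S" by (auto simp: Op_iff)

lemma in_ball: "y \<in> mb x r \<longleftrightarrow> x \<in> S \<and> y \<in> S \<and> \<rho> x y < r"
  using Metric_space.in_mball[OF rho_metric] .

lemma small_cell:
  assumes "0 < r" shows "\<exists>n. \<forall>v\<in>V n. W v < r"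
proof -
  have "(\<lambda>n. bW ^ n) \<longlonglongrightarrow> 0" using W_consts by (intro LIMSEQ_power_zero) auto
  then have "eventually (\<lambda>n. bW ^ n < r) sequentially" using assms by (rule order_tendstoD)
  then obtain n where "bW ^ n < r" using eventually_happens by fastforce
  then show ?thesis using W_le le_less_trans by blast
qed

text \<open>Around a point of an open set, all cells of a sufficiently deep level that contain it
  stay inside the set. As every level is finite, the right side is a countable union of intervals,
  which makes \<open>pt\<close> measurable.\<close>

lemma preimage_open:
  assumes "U \<in> Op"
  shows "pt -` U \<inter> {0..<1} = (\<Union>n. \<Union>v\<in>{v \<in> V n. K v \<subseteq> U}. I n v)"
proof (intro equalityI subsetI)
  fix t assume t: "t \<in> pt -` U \<inter> {0..<1}"
  then have t01: "t \<in> {0..<1}" by blast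
  obtain r where r: "0 < r" "mb (pt t) r \<subseteq> U" using assms t Op_iff by blast
  obtain n where n: "\<forall>v\<in>V n. W v < r" using small_cell[OF r(1)] by blast
  have w: "wn n t \<in> V n" "t \<in> I n (wn n t)" using wn[OF t01] by auto
  have wC: "wn n t \<in> C" using w by (simp add: V_iff)
  have "K (wn n t) \<subseteq> U"
  proof
    fix y assume y: "y \<in> K (wn n t)"
    have "\<rho> (pt t) y \<le> W (wn n t)" by (rule rho_cell[OF wC pt[OF t01] y])
    then have "\<rho> (pt t) y < r" using n w by force
    then show "y \<in> U" using r(2) in_ball pt_S[OF t01] y K_subset_S[OF wC] by blast
  qed
  then show "t \<in> (\<Union>n. \<Union>v\<in>{v \<in> V n. K v \<subseteq> U}. I n v)" using w by blast
next
  fix t assume "t \<in> (\<Union>n. \<Union>v\<in>{v \<in> V n. K v \<subseteq> U}. I n v)"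
  then obtain n v where v: "v \<in> V n" "K v \<subseteq> U" "t \<in> I n v" by blast
  then have t: "t \<in> {0..<1}" using I_unit by blast
  have "pt t \<in> K v" using pt[OF t, of n] wn_eq[OF v(1,3)] by simp
  then show "t \<in> pt -` U \<inter> {0..<1}" using v t by blast
qed

lemma I_borel: "I n v \<in> sets borel" by (simp add: I_def)

lemma pt_measurable: "pt \<in> measurable (restrict_space lborel {0..<1}) (sigma S Op)"
proof (rule measurable_measure_of[OF Op_Pow])
  show "pt \<in> space (restrict_space lborel {0..<1}) \<rightarrow> S"
    using pt_S by (auto simp: space_restrict_space)
  fix U assume U: "U \<in> Op"
  have "(\<Union>n. \<Union>v\<in>{v \<in> V n. K v \<subseteq> U}. I n v) \<in> sets borel"
    using I_borel by (intro sets.countable_UN sets.finite_UN) auto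
  then have "pt -` U \<inter> {0..<1} \<in> sets borel" using preimage_open[OF U] by simp
  then show "pt -` U \<inter> space (restrict_space lborel {0..<1}) \<in> sets (restrict_space lborel {0..<1})"
    by (simp add: space_restrict_space sets_restrict_space_iff)
qed

lemma space_mu: "space \<mu> = S" and sets_mu: "sets \<mu> = sigma_sets S Op"
  using Op_Pow by (auto simp: \<mu>_def space_measure_of_conv sets_measure_of)

lemma emeasure_mu:
  assumes "B \<in> sets \<mu>"
  shows "emeasure \<mu> B = emeasure lborel (pt -` B \<inter> {0..<1})"
    "pt -` B \<inter> {0..<1} \<in> sets borel"
proof -
  have B: "B \<in> sets (sigma S Op)" using assms by (simp add: \<mu>_def)
  have sp: "space (restrict_space lborel {0..<1::real}) = {0..<1}" by (simp add: space_restrict_space)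
  show "emeasure \<mu> B = emeasure lborel (pt -` B \<inter> {0..<1})"
    unfolding \<mu>_def emeasure_distr[OF pt_measurable B] sp by (rule emeasure_restrict_space) auto
  have "pt -` B \<inter> {0..<1} \<in> sets (restrict_space lborel {0..<1})"
    using measurable_sets[OF pt_measurable B] by (simp add: sp)
  then show "pt -` B \<inter> {0..<1} \<in> sets borel" by (simp add: sets_restrict_space_iff)
qed

lemma emeasure_I: "v \<in> V n \<Longrightarrow> emeasure lborel (I n v) = ennreal (m n v)"
  using m_pos[of v n] by (simp add: I_def)

lemma mu_lower:
  assumes "B \<in> sets \<mu>" "v \<in> V n" "K v \<subseteq> B" shows "ennreal (m n v) \<le> emeasure \<mu> B"
proof -
  have "I n v \<subseteq> pt -` B \<inter> {0..<1}"
  proof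
    fix t assume t: "t \<in> I n v"
    then have t1: "t \<in> {0..<1}" using I_unit assms by blast
    then show "t \<in> pt -` B \<inter> {0..<1}" using pt[OF t1, of n] wn_eq[OF assms(2) t] assms by auto
  qed
  then have "emeasure lborel (I n v) \<le> emeasure lborel (pt -` B \<inter> {0..<1})"
    by (rule emeasure_mono) (use emeasure_mu(2)[OF assms(1)] in simp)
  then show ?thesis using emeasure_mu(1)[OF assms(1)] emeasure_I[OF assms(2)] by simp
qed

text \<open>A point of \<open>K u\<close> may be coded through another cell of the level that
  contains it. Hence the intervals to be counted belong to cells one step farther away, within
  \<open>i + 1\<close> steps of \<open>w\<close>.\<close>

lemma mu_upper:
  assumes "B \<in> sets \<mu>" "w \<in> V n" "B \<subseteq> (\<Union>u\<in>(adj ^^ i) `` {w}. K u)"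
  shows "emeasure \<mu> B \<le> ennreal (real L ^ (i + 1) / qm ^ (i + 1) * m n w)"
proof -
  let ?A = "(adj ^^ (i + 1)) `` {w}"
  have wC: "w \<in> C" using assms by (simp add: V_iff)
  have AV: "v \<in> V n" if "v \<in> ?A" for v using adj_pow_V that assms(2) by blast
  have sub: "pt -` B \<inter> {0..<1} \<subseteq> (\<Union>v\<in>?A. I n v)"
  proof
    fix t assume t: "t \<in> pt -` B \<inter> {0..<1}"
    then obtain u where u: "(w,u) \<in> adj ^^ i" "pt t \<in> K u" using assms(3) by blast
    have t1: "t \<in> {0..<1}" using t by blast
    have wt: "wn n t \<in> V n" "t \<in> I n (wn n t)" using wn[OF t1] by auto
    have "(u, wn n t) \<in> adj"
      using u pt[OF t1, of n] wt(1) adj_pow_V[OF u(1) assms(2)] by (auto simp: adj_def V_iff)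
    then have "(w, wn n t) \<in> adj ^^ (i + 1)" using u by auto
    then show "t \<in> (\<Union>v\<in>?A. I n v)" using wt by blast
  qed
  have finA: "finite ?A" by (rule finite_pow[OF wC])
  have Im: "(\<lambda>v. I n v) ` ?A \<subseteq> sets lborel" using I_borel by auto
  have "(\<Union>v\<in>?A. I n v) \<in> sets lborel" using Im finA by (intro sets.finite_UN) auto
  with sub have "emeasure lborel (pt -` B \<inter> {0..<1}) \<le> emeasure lborel (\<Union>v\<in>?A. I n v)"
    by (rule emeasure_mono)
  also have "\<dots> \<le> (\<Sum>v\<in>?A. emeasure lborel (I n v))"
    by (rule emeasure_subadditive_finite[OF finA Im])
  also have "\<dots> = (\<Sum>v\<in>?A. ennreal (m n v))" using AV emeasure_I by (intro sum.cong) auto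
  also have "\<dots> = ennreal (\<Sum>v\<in>?A. m n v)" using AV m_pos by (intro sum_ennreal) force
  also have "\<dots> \<le> ennreal (real L ^ (i + 1) / qm ^ (i + 1) * m n w)"
  proof (rule ennreal_leI)
    have each: "m n v \<le> m n w / qm ^ (i + 1)" if "v \<in> ?A" for v
      using m_pow[OF adj_pow_sym AV[OF that], of w "i+1"] that qm_pos by (simp add: field_simps)
    have "(\<Sum>v\<in>?A. m n v) \<le> real (card ?A) * (m n w / qm ^ (i + 1))"
      by (rule sum_bounded_above) (use each in blast)
    also have "\<dots> \<le> real L ^ (i + 1) * (m n w / qm ^ (i + 1))"
    proof (rule mult_right_mono)
      show "real (card ?A) \<le> real L ^ (i + 1)" using card_pow[OF wC, of "i+1"] by (metis of_nat_le_iff of_nat_power)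
      show "0 \<le> m n w / qm ^ (i + 1)" using m_pos[OF assms(2)] qm_pos by simp
    qed
    finally show "(\<Sum>v\<in>?A. m n v) \<le> real L ^ (i + 1) / qm ^ (i + 1) * m n w" by simp
  qed
  finally show ?thesis using emeasure_mu(1)[OF assms(1)] by simp
qed

lemma mu_le_1: "B \<in> sets \<mu> \<Longrightarrow> emeasure \<mu> B \<le> 1"
proof -
  assume B: "B \<in> sets \<mu>"
  have "emeasure lborel (pt -` B \<inter> {0..<1}) \<le> emeasure lborel {0..<1::real}"
    by (intro emeasure_mono) auto
  then show ?thesis using emeasure_mu(1)[OF B] by simp
qed

lemma ball_sets: "mb x r \<in> sets \<mu>"
  unfolding sets_mu Op_def using Metric_space.openin_mball[OF rho_metric] by (intro sigma_sets.Basic) simp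

lemma borel_regular_mu: "borel_regular (Metric_space.mtopology S \<rho>) \<mu>"
proof -
  have t: "topspace (Metric_space.mtopology S \<rho>) = S"
    using Metric_space.topspace_mtopology[OF rho_metric] .
  then show ?thesis unfolding borel_regular_def space_mu sets_mu Op_def by auto
qed

lemma mdiam_le_1: "mdiam \<rho> S \<le> 1"
proof -
  have "\<rho> x y \<le> 1" if "x \<in> S" "y \<in> S" for x y
    using rho_cell[of \<phi> x y] phi that W_root by simp
  then show ?thesis unfolding mdiam_def by (auto intro!: cSUP_least)
qed

lemma mu_Ahlfors: "Ahlfors_regular S \<rho> \<mu> p"
proof -
  \<comment> \<open>The first entry serves the radii above \<open>cL\<close>, for which the total
    mass 1 is bound enough; the second one serves the smaller radii.\<close>
  define C2 where "C2 = max (1 / cL powr p) (real L ^ (N + 2) / qm ^ (N + 2) / (a * cL powr p))"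
  have cLp: "0 < cL powr p" using cL by simp
  have C2: "0 < C2" using cLp by (simp add: C2_def less_max_iff_disj)
  have *: "ennreal (a * r powr p) \<le> emeasure \<mu> (mb x r) \<and>
    emeasure \<mu> (mb x r) \<le> ennreal (C2 * r powr p)"
    if x: "x \<in> S" and r: "0 < r" "r \<le> 1" for x r
  proof
    have ex: "\<exists>n. \<exists>w\<in>V n. x \<in> K w \<and> W w < s" if s: "0 < s" for s
      using small_cell[OF s] cell_at[OF x] by metis
    \<comment> \<open>Stopping at the first level where some cell through \<open>x\<close> is
      smaller than \<open>s\<close> forces its parent, which also contains \<open>x\<close>, to be
      at least \<open>s\<close>.\<close>
    have first: "\<exists>n w. w \<in> V (Suc n) \<and> x \<in> K w \<and> W w < s \<and> s \<le> W (par w)"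
      if s: "0 < s" "s \<le> 1" for s
    proof -
      let ?P = "\<lambda>n. \<exists>w\<in>V n. x \<in> K w \<and> W w < s"
      define k where "k = (LEAST n. ?P n)"
      have k: "?P k" unfolding k_def using ex[OF s(1)] by (rule LeastI_ex)
      have "\<not> ?P 0" using root W_root s by auto
      then have "k \<noteq> 0" using k by metis
      then obtain n where n: "k = Suc n" by (cases k) auto
      have nP: "\<not> ?P n" using not_less_Least[of n ?P] n by (simp add: k_def[symmetric])
      obtain w where w: "w \<in> V (Suc n)" "x \<in> K w" "W w < s" using k n by blast
      have "x \<in> K (par w)" using K_par[OF w(1)] w by blast
      then have "s \<le> W (par w)" using nP par_V[OF w(1)] by force
      then show ?thesis using w by blast
    qed
    obtain n w where w: "w \<in> V (Suc n)" "x \<in> K w" "W w < r" "r \<le> W (par w)"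
      using first[OF r] by blast
    have wC: "w \<in> C" using w by (simp add: V_iff)
    have "K w \<subseteq> mb x r"
    proof
      fix y assume y: "y \<in> K w"
      have "\<rho> x y \<le> W w" by (rule rho_cell[OF wC w(2) y])
      then show "y \<in> mb x r" using in_ball x y K_subset_S[OF wC] w(3) by force
    qed
    then have "ennreal (m (Suc n) w) \<le> emeasure \<mu> (mb x r)"
      by (rule mu_lower[OF ball_sets w(1)])
    moreover have "a * r powr p \<le> m (Suc n) w"
    proof -
      have "r powr p \<le> W (par w) powr p" using w r p_pos by (intro powr_mono2) auto
      also have "\<dots> = m n (par w)" by (rule W_powr[OF par_V[OF w(1)]])
      finally have "a * r powr p \<le> a * m n (par w)" using a_pos by (intro mult_left_mono) auto
      also have "\<dots> \<le> m (Suc n) w" by (rule m_floor[OF w(1)])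
      finally show ?thesis .
    qed
    ultimately show "ennreal (a * r powr p) \<le> emeasure \<mu> (mb x r)"
      using ennreal_leI order_trans by blast
    show "emeasure \<mu> (mb x r) \<le> ennreal (C2 * r powr p)"
    proof (cases "cL \<le> r")
      case True
      have "cL powr p \<le> r powr p" using True cL p_pos by (intro powr_mono2) auto
      then have "1 \<le> 1 / cL powr p * r powr p" using cLp by (simp add: field_simps)
      also have "\<dots> \<le> C2 * r powr p" by (intro mult_right_mono) (auto simp: C2_def)
      finally have "1 \<le> ennreal (C2 * r powr p)" by simp
      then show ?thesis using mu_le_1[OF ball_sets] order_trans by blast
    next
      case False
      \<comment> \<open>At the scale \<open>r / cL\<close>, the parent satisfies
        \<open>r \<le> cL * W (par w)\<close>, and \<open>rho_lower\<close> confines the ball to the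
        cells within \<open>N + 1\<close> steps of this parent.\<close>
      then have rc: "0 < r / cL" "r / cL \<le> 1" using r cL by auto
      obtain n w where w: "w \<in> V (Suc n)" "x \<in> K w" "W w < r / cL" "r / cL \<le> W (par w)"
        using first[OF rc] by blast
      have pw: "par w \<in> V n" using par_V[OF w(1)] .
      have xp: "x \<in> K (par w)" using K_par[OF w(1)] w by blast
      have "mb x r \<subseteq> (\<Union>u\<in>(adj ^^ (N + 1)) `` {par w}. K u)"
      proof
        fix y assume "y \<in> mb x r"
        then have y: "y \<in> S" "\<rho> x y < r" using in_ball by auto
        have "r \<le> cL * W (par w)" using w(4) cL by (simp add: field_simps)
        then have "\<not> cL * W (par w) \<le> \<rho> x y" using y by linarith
        then obtain u where "(par w, u) \<in> adj ^^ (N + 1)" "y \<in> K u"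
          using rho_lower[OF pw xp y(1)] by blast
        then show "y \<in> (\<Union>u\<in>(adj ^^ (N + 1)) `` {par w}. K u)" by blast
      qed
      then have 1: "emeasure \<mu> (mb x r)
          \<le> ennreal (real L ^ (N + 1 + 1) / qm ^ (N + 1 + 1) * m n (par w))"
        by (rule mu_upper[OF ball_sets pw])
      have "a * m n (par w) \<le> m (Suc n) w" by (rule m_floor[OF w(1)])
      also have "\<dots> = W w powr p" by (rule W_powr[OF w(1), symmetric])
      also have "\<dots> \<le> (r / cL) powr p" using w(3) W_nonneg p_pos by (intro powr_mono2) auto
      also have "\<dots> = r powr p / cL powr p" using r cL by (simp add: powr_divide)
      finally have "m n (par w) \<le> r powr p / (a * cL powr p)" using a_pos cLp by (simp add: field_simps)
      then have "real L ^ (N + 1 + 1) / qm ^ (N + 1 + 1) * m n (par w)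
          \<le> real L ^ (N + 1 + 1) / qm ^ (N + 1 + 1) * (r powr p / (a * cL powr p))"
        using qm_pos by (intro mult_left_mono) auto
      also have "\<dots> = real L ^ (N + 2) / qm ^ (N + 2) / (a * cL powr p) * r powr p" by simp
      also have "\<dots> \<le> C2 * r powr p" by (intro mult_right_mono) (auto simp: C2_def)
      finally show ?thesis using 1 ennreal_leI order_trans by blast
    qed
  qed
  have "\<forall>x\<in>S. \<forall>r\<in>{0..mdiam \<rho> S}.
        ennreal (a * r powr p) \<le> emeasure \<mu> (mb x r) \<and>
        emeasure \<mu> (mb x r) \<le> ennreal (C2 * r powr p)"
  proof (intro ballI)
    fix x r assume x: "x \<in> S" and r: "r \<in> {0..mdiam \<rho> S}"
    show "ennreal (a * r powr p) \<le> emeasure \<mu> (mb x r) \<and>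
        emeasure \<mu> (mb x r) \<le> ennreal (C2 * r powr p)"
    proof (cases "r = 0")
      case True
      have "mb x r = {}" using Metric_space.mball_eq_empty[OF rho_metric] True by simp
      then show ?thesis using True by simp
    next
      case False
      then show ?thesis using *[OF x, of r] r mdiam_le_1 by auto
    qed
  qed
  then show ?thesis unfolding Ahlfors_regular_def using a_pos C2 by blast
qed

theorem dim_AR_le: "dim_AR S d \<le> ereal p"
  unfolding dim_AR_def
  using p_pos rho_metric rho_quasisymmetric borel_regular_mu mu_Ahlfors
  by (intro Inf_lower CollectI exI[of _ p] conjI refl) blast+

end


section \<open>Rooted trees and subsampled levels\<close>

locale rooted_tree =
  fixes A :: "'t \<Rightarrow> 't \<Rightarrow> bool" and \<phi> :: 't
  assumes tree: "locally_finite_tree A"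
begin

abbreviation "ht \<equiv> height A \<phi>"
abbreviation "pa \<equiv> parent A \<phi>"
abbreviation "geo \<equiv> geodesic A \<phi>"

lemma A_sym: "A w v \<longleftrightarrow> A v w" and A_irrefl: "\<not> A w w"
  and path_unique: "\<exists>!xs. simple_path A w v xs" and A_finite: "finite {v. A w v}"
  using tree unfolding locally_finite_tree_def by blast+

lemma geo_path: "simple_path A \<phi> w (geo w)"
  unfolding geodesic_def by (rule theI'[OF path_unique])

lemma geo_eq: "simple_path A \<phi> w xs \<Longrightarrow> geo w = xs"
  using path_unique[of \<phi> w] geo_path by blast

lemma geo_root: "geo \<phi> = [\<phi>]"
  by (rule geo_eq) (simp add: simple_path_def)

lemma path_prefix:
  assumes "simple_path A \<phi> w (xs @ v # ys)" shows "simple_path A \<phi> v (xs @ [v])"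
proof -
  have "xs @ v # ys = (xs @ [v]) @ ys" by simp
  then have "successively A (xs @ [v])"
    using assms unfolding simple_path_def by (metis successively_append_iff)
  then show ?thesis using assms unfolding simple_path_def by (auto simp: hd_append)
qed

lemma geo_snoc: assumes "w \<noteq> \<phi>" shows "geo w = geo (pa w) @ [w]" "A (pa w) w"
proof -
  have p: "geo w \<noteq> []" "hd (geo w) = \<phi>" "last (geo w) = w" "successively A (geo w)"
    using geo_path[of w] by (auto simp: simple_path_def)
  then have bl: "geo w = butlast (geo w) @ [w]" using append_butlast_last_id by metis
  have bne: "butlast (geo w) \<noteq> []"
  proof
    assume "butlast (geo w) = []"
    then have "geo w = [w]" using bl by simp
    then show False using p assms by simp
  qed
  have pw: "pa w = last (butlast (geo w))" using assms by (simp add: parent_def)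
  have e: "geo w = butlast (butlast (geo w)) @ pa w # [w]"
    using bl bne pw append_butlast_last_id[of "butlast (geo w)"] by (metis append_Cons append_Nil append_assoc)
  then have "simple_path A \<phi> (pa w) (butlast (butlast (geo w)) @ [pa w])"
    using path_prefix[of w "butlast (butlast (geo w))" "pa w" "[w]"] geo_path[of w] by simp
  then have g: "geo (pa w) = butlast (butlast (geo w)) @ [pa w]" by (rule geo_eq)
  then show "geo w = geo (pa w) @ [w]" using e by simp
  have "successively A (butlast (butlast (geo w)) @ pa w # [w])" using p(4) e by metis
  then show "A (pa w) w" by (simp add: successively_append_iff)
qed

lemma pa_root: "pa \<phi> = \<phi>" by (simp add: parent_def)

lemma geo_ne: "geo w \<noteq> []" using geo_path[of w] by (simp add: simple_path_def)

lemma ht_root: "ht \<phi> = 0" by (simp add: height_def geo_root)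

lemma ht_pa: "w \<noteq> \<phi> \<Longrightarrow> ht w = Suc (ht (pa w))"
  using geo_snoc(1)[of w] geo_ne[of "pa w"] by (cases "geo (pa w)") (auto simp: height_def)

lemma ht_0: "ht w = 0 \<longleftrightarrow> w = \<phi>" using ht_pa ht_root by fastforce

text \<open>Uniqueness of simple paths: if \<open>v\<close> is on the geodesic of \<open>w\<close>,
  cutting it at \<open>v\<close> and appending \<open>w\<close> must give it back; if not, appending
  \<open>v\<close> gives the geodesic of \<open>v\<close>.\<close>

lemma adj_cases: assumes "A w v" shows "pa v = w \<and> v \<noteq> \<phi> \<or> pa w = v \<and> w \<noteq> \<phi>"
proof (cases "v \<in> set (geo w)")
  case True
  then obtain xs ys where e: "geo w = xs @ v # ys" by (meson split_list)
  have pv: "simple_path A \<phi> v (xs @ [v])" using path_prefix geo_path e by metis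
  have "w \<noteq> v" using assms A_irrefl by blast
  have wl: "last (geo w) = w" "distinct (geo w)" using geo_path[of w] by (auto simp: simple_path_def)
  then have "ys \<noteq> []" using e \<open>w \<noteq> v\<close> by auto
  then have "w \<in> set ys" using wl e by (metis last_ConsR last_appendR last_in_set list.distinct(1))
  then have "w \<notin> set (xs @ [v])" using wl e by auto
  then have "simple_path A \<phi> w ((xs @ [v]) @ [w])"
    using pv assms A_sym[of w v] unfolding simple_path_def by (auto simp: successively_append_iff hd_append)
  then have g: "geo w = (xs @ [v]) @ [w]" by (rule geo_eq)
  have wr: "w \<noteq> \<phi>"
  proof
    assume "w = \<phi>"
    then show False using g geo_root by (cases xs) auto
  qed
  then have "pa w = v" using g by (simp add: parent_def butlast_append)
  then show ?thesis using wr by blast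
next
  case False
  then have "simple_path A \<phi> v (geo w @ [v])"
    using geo_path[of w] assms geo_ne unfolding simple_path_def by (auto simp: successively_append_iff)
  then have g: "geo v = geo w @ [v]" by (rule geo_eq)
  have vr: "v \<noteq> \<phi>"
  proof
    assume "v = \<phi>"
    then show False using g geo_root geo_ne[of w] by simp
  qed
  moreover have "last (geo w) = w" using geo_path[of w] by (simp add: simple_path_def)
  ultimately have "pa v = w" using g by (simp add: parent_def)
  then show ?thesis using vr by blast
qed

text \<open>The root is excluded because it counts as its own parent without being its own
  child.\<close>

lemma children_iff: "v \<in> children A \<phi> w \<longleftrightarrow> v \<noteq> \<phi> \<and> pa v = w"
proof
  assume "v \<in> children A \<phi> w"
  then have "A w v" "v \<noteq> pa w" by (auto simp: children_def)
  then show "v \<noteq> \<phi> \<and> pa v = w" using adj_cases[of w v] by auto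
next
  assume a: "v \<noteq> \<phi> \<and> pa v = w"
  have "v \<noteq> pa w"
  proof
    assume e: "v = pa w"
    have "w \<noteq> \<phi>" using e a pa_root by metis
    then have "ht w = Suc (ht v)" using ht_pa e by simp
    then show False using ht_pa[of v] a by simp
  qed
  then show "v \<in> children A \<phi> w" using a geo_snoc(2)[of v] by (auto simp: children_def)
qed

lemma ht_funpow: "ht v = n + k \<Longrightarrow> ht ((pa ^^ k) v) = n"
proof (induction k arbitrary: n)
  case (Suc k)
  then have "ht ((pa ^^ k) v) = Suc n" by simp
  then show ?case using ht_pa ht_0 by (metis Zero_not_Suc comp_apply diff_Suc_1 funpow.simps(2))
qed simp

lemma subtree_iff: "v \<in> subtree A \<phi> w \<longleftrightarrow> (\<exists>i\<le>ht v. (pa ^^ i) v = w)"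
proof (induction "ht v" arbitrary: v)
  case 0
  then have "v = \<phi>" using ht_0 by metis
  then show ?case using geo_root ht_root by (auto simp: subtree_def)
next
  case (Suc n)
  then have vr: "v \<noteq> \<phi>" using ht_root by auto
  have n: "ht (pa v) = n" using ht_pa[OF vr] Suc by simp
  have "v \<in> subtree A \<phi> w \<longleftrightarrow> w = v \<or> pa v \<in> subtree A \<phi> w"
    using geo_snoc(1)[OF vr] by (auto simp: subtree_def)
  also have "\<dots> \<longleftrightarrow> w = v \<or> (\<exists>i\<le>n. (pa ^^ i) (pa v) = w)" using Suc.hyps(1)[of "pa v"] n by simp
  also have "\<dots> \<longleftrightarrow> w = v \<or> (\<exists>i\<le>n. (pa ^^ Suc i) v = w)" by (simp add: funpow_swap1)
  also have "\<dots> \<longleftrightarrow> (\<exists>i\<le>Suc n. (pa ^^ i) v = w)"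
  proof
    assume "w = v \<or> (\<exists>i\<le>n. (pa ^^ Suc i) v = w)"
    then show "\<exists>i\<le>Suc n. (pa ^^ i) v = w" by (auto intro: exI[of _ 0])
  next
    assume "\<exists>i\<le>Suc n. (pa ^^ i) v = w"
    then obtain i where i: "i \<le> Suc n" "(pa ^^ i) v = w" by blast
    then show "w = v \<or> (\<exists>i\<le>n. (pa ^^ Suc i) v = w)" by (cases i) auto
  qed
  finally show ?case using Suc by simp
qed

lemma desc_iff: "v \<in> desc A \<phi> k w \<longleftrightarrow> ht v = ht w + k \<and> (pa ^^ k) v = w"
proof
  assume "v \<in> desc A \<phi> k w"
  then have h: "ht v = ht w + k" "v \<in> subtree A \<phi> w" by (auto simp: desc_def)
  then obtain i where i: "i \<le> ht v" "(pa ^^ i) v = w" using subtree_iff by blast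
  have "ht w = ht v - i" using ht_funpow[of v "ht v - i" i] i by simp
  then have "i = k" using h i by simp
  then show "ht v = ht w + k \<and> (pa ^^ k) v = w" using h i by simp
next
  assume a: "ht v = ht w + k \<and> (pa ^^ k) v = w"
  then have "\<exists>i\<le>ht v. (pa ^^ i) v = w" by (intro exI[of _ k]) simp
  then show "v \<in> desc A \<phi> k w" using a by (simp add: desc_def subtree_iff)
qed

lemma finite_ht: "finite {v. ht v = n}"
proof (induction n)
  case 0
  then show ?case by (simp add: ht_0)
next
  case (Suc n)
  have "{v. ht v = Suc n} \<subseteq> (\<Union>w\<in>{w. ht w = n}. {v. A w v})"
  proof
    fix v assume "v \<in> {v. ht v = Suc n}"
    then have "v \<noteq> \<phi>" "ht v = Suc n" using ht_root by auto
    then show "v \<in> (\<Union>w\<in>{w. ht w = n}. {v. A w v})"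
      using geo_snoc(2)[of v] ht_pa[of v] by auto
  qed
  then show ?case using Suc A_finite by (meson finite_UN_I finite_subset)
qed

lemma ray_iff:
  assumes "\<omega> 0 = \<phi>" "\<And>n. ht (\<omega> n) = n" "\<And>n. pa (\<omega> (Suc n)) = \<omega> n"
  shows "\<omega> \<in> rays A \<phi>"
proof -
  have "geo (\<omega> n) = map \<omega> [0..<Suc n]" for n
  proof (induction n)
    case 0
    then show ?case using assms geo_root by simp
  next
    case (Suc n)
    have "\<omega> (Suc n) \<noteq> \<phi>" using assms(2)[of "Suc n"] ht_root by auto
    then show ?case using geo_snoc(1)[of "\<omega> (Suc n)"] Suc assms(3)[of n] by simp
  qed
  then have "simple_path A \<phi> (\<omega> n) (map \<omega> [0..<Suc n])" for n using geo_path[of "\<omega> n"] by metis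
  then show ?thesis using assms(1) by (simp add: rays_def)
qed

lemma tree_hierarchy:
  assumes "tree_partition A \<phi> X K"
  shows "hierarchy UNIV ht pa K (topspace X)"
proof
  show "pa v \<in> UNIV \<and> ht (pa v) = n" if "ht v = Suc n" for v n
    using that ht_pa[of v] ht_0[of v] by auto
  have tp: "\<And>w. K w \<noteq> {}" "K \<phi> = topspace X" "\<And>w. K w = (\<Union>v\<in>children A \<phi> w. K v)"
    using assms unfolding tree_partition_def by blast+
  show "K v \<noteq> {}" for v by (rule tp(1))
  show "finite {v \<in> UNIV. ht v = n}" for n using finite_ht by simp
  show "\<Union> (K ` {v \<in> UNIV. ht v = 0}) = topspace X"
    by (simp add: ht_0 tp(2))
  fix w
  have "K w = (\<Union>v\<in>children A \<phi> w. K v)" by (rule tp(3))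
  moreover have "children A \<phi> w = {v \<in> UNIV. ht v = Suc (ht w) \<and> pa v = w}"
  proof (rule set_eqI)
    fix v
    show "v \<in> children A \<phi> w \<longleftrightarrow> v \<in> {v \<in> UNIV. ht v = Suc (ht w) \<and> pa v = w}"
      using children_iff[of v w] ht_pa[of v] ht_0[of v] by auto
  qed
  ultimately show "K w = \<Union> (K ` {v \<in> UNIV. ht v = Suc (ht w) \<and> pa v = w})" by metis
qed

end

section \<open>Keeping every \<open>k\<close>-th level\<close>

context hierarchy begin

context
  fixes k :: nat assumes k: "1 \<le> k"
begin

definition thin where "thin = {v \<in> C. k dvd lev v}"

lemma thin_hierarchy: "hierarchy thin (\<lambda>v. lev v div k) (par ^^ k) K S"
proof
  show "(par ^^ k) v \<in> thin \<and> lev ((par ^^ k) v) div k = n" if "v \<in> thin" "lev v div k = Suc n" for v n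
  proof -
    have "lev v = k * Suc n" using that dvd_mult_div_cancel[of k "lev v"] by (simp add: thin_def)
    then have "v \<in> V (k * n + k)" using that by (simp add: V_iff thin_def)
    then have "(par ^^ k) v \<in> V (k * n)" by (rule funpow_par_V)
    then show ?thesis using k by (simp add: thin_def V_iff)
  qed
  show "K v \<noteq> {}" if "v \<in> thin" for v using that K_ne by (simp add: thin_def)
  show "finite {v \<in> thin. lev v div k = n}" for n
    by (rule finite_subset[OF _ finite_V[of "k * n"]]) (auto simp: thin_def V_iff)
  have "{v \<in> thin. lev v div k = 0} = {v \<in> C. lev v = 0}" using k by (auto simp: thin_def)
  then show "\<Union> (K ` {v \<in> thin. lev v div k = 0}) = S" using K_root by simp
  fix w assume w: "w \<in> thin"
  then obtain n where n: "lev w = k * n" "w \<in> C" by (auto simp: thin_def)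
  have e: "(par ^^ k) v = anc (k * n) v" if "lev v = k * Suc n" for v using that by (simp add: anc_def)
  have lw: "lev w div k = n" using n k by simp
  show "K w = \<Union> (K ` {v \<in> thin. lev v div k = Suc (lev w div k) \<and> (par ^^ k) v = w})"
  proof (intro equalityI subsetI)
    fix x assume x: "x \<in> K w"
    have "w \<in> V (k * n)" using n by (simp add: V_iff)
    then obtain v where v: "v \<in> V (k * Suc n)" "anc (k * n) v = w" "x \<in> K v"
      using cell_below[of w "k * n" x "k * Suc n"] x by auto
    then have "v \<in> thin" "lev v div k = Suc n" "(par ^^ k) v = w"
      using k e[of v] by (auto simp: thin_def V_iff simp del: mult_Suc_right)
    then show "x \<in> \<Union> (K ` {v \<in> thin. lev v div k = Suc (lev w div k) \<and> (par ^^ k) v = w})"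
      using v lw by blast
  next
    fix x assume "x \<in> \<Union> (K ` {v \<in> thin. lev v div k = Suc (lev w div k) \<and> (par ^^ k) v = w})"
    then obtain v where v: "v \<in> thin" "lev v div k = Suc n" "(par ^^ k) v = w" "x \<in> K v"
      using lw by auto
    then have l: "lev v = k * Suc n" "v \<in> C" using dvd_mult_div_cancel[of k "lev v"] by (simp_all add: thin_def)
    then have "K v \<subseteq> K (anc (k * n) v)" by (intro K_anc) auto
    then show "x \<in> K w" using v e[OF l(1)] by auto
  qed
qed

lemma thin_V: "hierarchy.V thin (\<lambda>v. lev v div k) n = V (n * k)"
  unfolding hierarchy.V_def[OF thin_hierarchy] V_def using k by (auto simp: thin_def)

lemma thin_adj: "hierarchy.adj thin (\<lambda>v. lev v div k) K = {(v,v') \<in> adj. k dvd lev v}"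
  unfolding hierarchy.adj_def[OF thin_hierarchy] adj_def by (auto simp: thin_def dest: dvd_div_eq_cancel)

text \<open>Steps never change the level, so a chain that starts in a retained level stays among the
  retained cells.\<close>

lemma thin_adj_pow:
  assumes "k dvd lev v"
  shows "(v,u) \<in> hierarchy.adj thin (\<lambda>v. lev v div k) K ^^ i \<longleftrightarrow> (v,u) \<in> adj ^^ i"
proof (induction i arbitrary: u)
  case (Suc i)
  have "k dvd lev z" if "(v,z) \<in> adj ^^ i" for z
  proof (cases i)
    case 0
    then show ?thesis using that assms by simp
  next
    case (Suc j)
    then have "(v,z) \<in> adj ^^ Suc j" using that by simp
    then obtain y where "(v,y) \<in> adj" using relpow_Suc_D2 by metis
    then have "v \<in> C" using adj_D by blast
    then show ?thesis using adj_pow_C[OF that] assms by simp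
  qed
  then show ?case using Suc by (auto simp: thin_adj)
qed simp

end

end


section \<open>Geometry of the basic framework\<close>

locale framework = rooted_tree A \<phi> for A :: "'t \<Rightarrow> 't \<Rightarrow> bool" and \<phi> :: 't +
  fixes X :: "'x topology" and K :: "'t \<Rightarrow> 'x set" and d :: "'x \<Rightarrow> 'x \<Rightarrow> real"
    and M :: nat and r c1 c2 :: real
  assumes cpt: "compact_space X"
    and part: "tree_partition A \<phi> X K" and minimal: "minimal_partition A \<phi> K"
    and branching: "\<exists>C::nat. \<forall>w. finite (children A \<phi> w) \<and> card (children A \<phi> w) \<le> C"
    and compat: "compatible_metric X d"
    and adapt: "adapted A \<phi> X K M d"
    and thick: "thick A \<phi> K (diam_weight K d)"
    and unif: "uniformly_finite A \<phi> K (diam_weight K d)"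
    and r: "0 < r" "r < 1" and c1_pos: "0 < c1" and c2_pos: "0 < c2"
    and self_similar: "\<forall>w. c1 * r ^ height A \<phi> w \<le> diam_weight K d w \<and>
             diam_weight K d w \<le> c2 * r ^ height A \<phi> w"
begin

abbreviation "S \<equiv> topspace X"
abbreviation "g \<equiv> diam_weight K d"

sublocale hierarchy UNIV ht pa K S
  by (rule tree_hierarchy[OF part])

lemma V_ht: "v \<in> V n \<longleftrightarrow> ht v = n" by (simp add: V_iff)

lemma d_metric: "Metric_space S d" and mtop: "Metric_space.mtopology S d = X"
  and diam_1: "mdiam d S = 1"
  using compat by (auto simp: compatible_metric_def)

lemma K_S: "K v \<subseteq> S" using K_subset_S by simp

lemma K_phi: "K \<phi> = S"
  using part unfolding tree_partition_def by blast

lemma d_bounded: "\<exists>B. \<forall>x\<in>S. \<forall>y\<in>S. d x y \<le> B"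
proof -
  have "compactin (Metric_space.mtopology S d) S" using cpt mtop by (simp add: compact_space_def)
  then have "Metric_space.mbounded S d S" by (rule Metric_space.compactin_imp_mbounded[OF d_metric])
  then show ?thesis unfolding Metric_space.mbounded_alt[OF d_metric] by blast
qed

lemma bdd_d: "bdd_above ((\<lambda>(x,y). d x y) ` (K w \<times> K w))"
proof -
  obtain B where B: "\<forall>x\<in>S. \<forall>y\<in>S. d x y \<le> B" using d_bounded by blast
  then show ?thesis using K_S[of w] by (intro bdd_aboveI[of _ B]) auto
qed

lemma d_le_g: "x \<in> K w \<Longrightarrow> y \<in> K w \<Longrightarrow> d x y \<le> g w"
  using cSUP_upper[OF _ bdd_d, of "(x,y)" w] by (auto simp: diam_weight_def mdiam_def)

lemma g_witness: assumes "e < g w" shows "\<exists>x\<in>K w. \<exists>y\<in>K w. e < d x y"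
proof -
  have ne: "K w \<noteq> {}" using K_ne by simp
  then have "e < (SUP (x,y)\<in>K w \<times> K w. d x y)" using assms by (simp add: diam_weight_def mdiam_def)
  then obtain z where "z \<in> K w \<times> K w" "e < (case z of (x,y) \<Rightarrow> d x y)"
    using less_cSUP_iff[OF _ bdd_d, of w e] ne by blast
  then show ?thesis by auto
qed

lemma g_mono: assumes "K v \<subseteq> K w" shows "g v \<le> g w"
proof (rule ccontr)
  assume "\<not> g v \<le> g w"
  then obtain x y where "x \<in> K v" "y \<in> K v" "g w < d x y" using g_witness[of "g w" v] by auto
  then show False using d_le_g[of x w y] assms by fastforce
qed

lemma g_root: "g \<phi> = 1" using diam_1 by (simp add: diam_weight_def K_phi)

lemma g_le_1: "g w \<le> 1"
  using g_mono[of w \<phi>] K_S[of w] by (simp add: K_phi g_root)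

lemma g_lower: "c1 * r ^ ht w \<le> g w" and g_upper: "g w \<le> c2 * r ^ ht w"
  using self_similar by auto

lemma d_le: "x \<in> K w \<Longrightarrow> y \<in> K w \<Longrightarrow> d x y \<le> c2 * r ^ ht w"
  using d_le_g g_upper order_trans by blast

lemma anc_ht: "n \<le> ht v \<Longrightarrow> ht (anc n v) = n" using anc_V[of v n] by (simp add: V_ht)

lemma anc_0: "anc 0 v = \<phi>" using anc_ht[of 0 v] by (simp add: ht_0)

lemma below:
  assumes "x \<in> K w" "ht w \<le> n" shows "\<exists>v. ht v = n \<and> anc (ht w) v = w \<and> x \<in> K v"
proof -
  have "w \<in> V (ht w)" by (simp add: V_ht)
  then obtain v where "v \<in> V n" "anc (ht w) v = w" "x \<in> K v" using cell_below[OF _ assms] by blast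
  then show ?thesis unfolding V_ht by blast
qed

lemma Lam_le: "w \<in> Lam A \<phi> g s \<Longrightarrow> g w \<le> s"
  by (auto simp: Lam_def g_root split: if_splits)

text \<open>Walking up from \<open>v\<close>, the ascent stops as soon as the parent exceeds
  \<open>s\<close>; this happens at the latest below the root, whose weight is 1. For
  \<open>s \<ge> 1\<close> the root itself is the cell.\<close>

lemma Lam_up: "g v \<le> s \<Longrightarrow> \<exists>n\<le>ht v. anc n v \<in> Lam A \<phi> g s"
proof (cases "1 \<le> s")
  case True
  then show ?thesis using anc_0 by (intro exI[of _ 0]) (simp add: Lam_def)
next
  case False
  assume "g v \<le> s"
  then show ?thesis
  proof (induction "ht v" arbitrary: v)
    case 0
    then have "v = \<phi>" using ht_0 by metis
    then show ?case using 0 g_root False by simp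
  next
    case (Suc n)
    show ?case
    proof (cases "s < g (pa v)")
      case True
      then have "v \<in> Lam A \<phi> g s" using Suc False by (simp add: Lam_def)
      then show ?thesis by (intro exI[of _ "ht v"]) simp
    next
      case False
      have pv: "pa v = anc n v" using Suc.hyps(2) par_anc[of v n] anc_self[of v] by simp
      then have hp: "ht (pa v) = n" using anc_ht[of n v] Suc.hyps(2) by simp
      then obtain i where i: "i \<le> n" "anc i (pa v) \<in> Lam A \<phi> g s"
        using Suc.hyps(1)[of "pa v"] False by auto
      then have "anc i v \<in> Lam A \<phi> g s" using anc_anc[of v i n] pv Suc.hyps(2) by simp
      then show ?thesis using i Suc.hyps(2) by (intro exI[of _ i]) simp
    qed
  qed
qed

lemma small_r: "0 < e \<Longrightarrow> \<exists>k0. \<forall>k\<ge>k0. C * r ^ k < e"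
proof -
  assume e: "0 < e"
  have "(\<lambda>n. C * r ^ n) \<longlonglongrightarrow> C * 0"
    using r by (intro tendsto_mult_left LIMSEQ_power_zero) auto
  then have "eventually (\<lambda>n. C * r ^ n < e) sequentially" using e by (intro order_tendstoD) auto
  then show ?thesis by (simp add: eventually_sequentially)
qed

text \<open>One descends along \<open>x\<close> to a cell of diameter at most \<open>s\<close> and
  goes back up by \<open>Lam_up\<close>. The ascent cannot pass \<open>w\<close>, which is larger
  than \<open>s\<close>.\<close>

lemma Lam_down:
  assumes "s < g w" "0 < s" "x \<in> K w"
  shows "\<exists>v\<in>Lam A \<phi> g s. ht w \<le> ht v \<and> anc (ht w) v = w \<and> x \<in> K v"
proof -
  obtain k where k: "c2 * r ^ k < s" "ht w \<le> k" using small_r[OF assms(2), of c2] by (meson nle_le)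
  obtain v where hv: "ht v = k" and v: "anc (ht w) v = w" "x \<in> K v"
    using below[OF assms(3) k(2)] by blast
  have "g v \<le> s" using g_upper[of v] k hv by simp
  then obtain n where n: "n \<le> k" "anc n v \<in> Lam A \<phi> g s" using Lam_up hv by blast
  have "ht w \<le> n"
  proof (rule ccontr)
    assume "\<not> ht w \<le> n"
    then have "anc n v = anc n w" using anc_anc[of v n "ht w"] v hv k by simp
    then have "K w \<subseteq> K (anc n v)" using K_anc[of w n] \<open>\<not> ht w \<le> n\<close> by simp
    then have "g w \<le> s" using g_mono Lam_le[OF n(2)] order_trans by blast
    then show False using assms by simp
  qed
  moreover have "anc (ht w) (anc n v) = w" using anc_anc[of v "ht w" n] v hv n \<open>ht w \<le> n\<close> by simp
  moreover have "x \<in> K (anc n v)" using K_anc[of v n] v n hv by auto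
  moreover have "ht (anc n v) = n" using anc_ht n hv by simp
  ultimately show ?thesis using n by metis
qed

lemma own_point: "\<exists>x\<in>K v. \<forall>u. ht u = ht v \<longrightarrow> x \<in> K u \<longrightarrow> u = v"
  using minimal unfolding minimal_partition_def level_def by blast

text \<open>Below \<open>v\<close> there is a tiny cell through \<open>x\<close>. A point that
  minimality gives to this cell alone in its deep level lies in no other cell of the level of
  \<open>v\<close> either, since such a cell would have a deep descendant through the point.\<close>

lemma own_point_below:
  assumes "x \<in> K v" "0 < e"
  shows "\<exists>y\<in>K v. d x y < e \<and> (\<forall>u. ht u = ht v \<longrightarrow> y \<in> K u \<longrightarrow> u = v)"
proof -
  obtain n where n: "c2 * r ^ n < e" "ht v \<le> n" using small_r[OF assms(2), of c2] by (meson nle_le)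
  obtain v' where hv: "ht v' = n" and v': "anc (ht v) v' = v" "x \<in> K v'"
    using below[OF assms(1) n(2)] by blast
  obtain y where y: "y \<in> K v'" "\<And>u. ht u = n \<Longrightarrow> y \<in> K u \<Longrightarrow> u = v'" using own_point[of v'] hv by auto
  have "d x y < e" using d_le[OF v'(2) y(1)] n hv by simp
  moreover have "K v' \<subseteq> K v" using K_anc[of v' "ht v"] v'(1) n hv by simp
  then have "y \<in> K v" using y(1) by blast
  moreover have "u = v" if u: "ht u = ht v" "y \<in> K u" for u
  proof -
    have "ht u \<le> n" using u(1) n(2) by simp
    then obtain u' where u': "ht u' = n" "anc (ht u) u' = u" "y \<in> K u'"
      using below[OF u(2)] by blast
    have uv: "u' = v'" by (rule y(2)[OF u'(1,3)])
    have "u = anc (ht u) u'" by (rule u'(2)[symmetric])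
    also have "\<dots> = anc (ht v) v'" by (simp only: uv u(1))
    also have "\<dots> = v" by (rule v'(1))
    finally show ?thesis .
  qed
  ultimately show ?thesis by blast
qed

lemma chain_pow:
  assumes "\<And>i. i \<in> {1..n+1} \<Longrightarrow> m \<le> ht (w i)" "\<And>i. i \<in> {1..n} \<Longrightarrow> K (w i) \<inter> K (w (i+1)) \<noteq> {}"
  shows "(anc m (w 1), anc m (w (n+1))) \<in> adj ^^ n"
  using assms
proof (induction n)
  case (Suc n)
  have "(anc m (w 1), anc m (w (n+1))) \<in> adj ^^ n" by (rule Suc.IH) (use Suc.prems in auto)
  moreover have "(anc m (w (n+1)), anc m (w (Suc n + 1))) \<in> adj"
    by (rule adj_anc) (use Suc.prems(1)[of "n+1"] Suc.prems(1)[of "Suc n + 1"] Suc.prems(2)[of "n+1"] in auto)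
  ultimately show ?case by auto
qed simp

text \<open>
  A cell is the closure of its points that lie in no other cell of the same level; for such
  points the chain in the adapted neighbourhood starts and ends under the given cells, which
  is why \<open>M\<close> steps are enough.
\<close>

lemma separation:
  obtains c3 where "0 < c3"
    "\<And>v u x y. \<lbrakk>ht u = ht v; x \<in> K v; y \<in> K u; d x y < c3 * r ^ ht v\<rbrakk> \<Longrightarrow> (v,u) \<in> adj ^^ M"
proof -
  obtain \<alpha>2 where a2: "0 < \<alpha>2" "\<And>x s. x \<in> S \<Longrightarrow> 0 < s \<Longrightarrow>
      Metric_space.mball S d x s \<subseteq> weight_nbhd A \<phi> K g M x (\<alpha>2 * s)"
    using adapt unfolding adapted_def by metis
  \<comment> \<open>Thus the chain for the radius \<open>c3 * r ^ m\<close> is taken at scale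
    \<open>c1 * r ^ m / 2\<close>. This is less than the diameter of any cell of height below
    \<open>m\<close>, so all cells of the chain have ancestors at height \<open>m\<close>.\<close>
  define c3 where "c3 = c1 / (2 * \<alpha>2)"
  have c3: "0 < c3" using a2 c1_pos by (simp add: c3_def)
  have "(v,u) \<in> adj ^^ M"
    if h: "ht u = ht v" and x: "x \<in> K v" and y: "y \<in> K u" and less: "d x y < c3 * r ^ ht v" for v u x y
  proof -
    define m where "m = ht v"
    \<comment> \<open>Half of the slack, so that moving both \<open>x\<close> and \<open>y\<close>
      by less than \<open>e\<close> keeps the strict inequality.\<close>
    define e where "e = (c3 * r ^ m - d x y) / 2"
    have e: "0 < e" using less by (simp add: e_def m_def)
    obtain x' where x': "x' \<in> K v" "d x x' < e" "\<And>u. ht u = m \<Longrightarrow> x' \<in> K u \<Longrightarrow> u = v"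
      using own_point_below[OF x e] unfolding m_def by blast
    obtain y' where y': "y' \<in> K u" "d y y' < e" "\<And>w. ht w = m \<Longrightarrow> y' \<in> K w \<Longrightarrow> w = u"
      using own_point_below[OF y e] unfolding m_def h by blast
    have inS: "x \<in> S" "y \<in> S" "x' \<in> S" "y' \<in> S" using K_S x y x'(1) y'(1) by blast+
    have "d x' y' \<le> d x' x + d x y'" using Metric_space.triangle[OF d_metric] inS by blast
    moreover have "d x y' \<le> d x y + d y y'" using Metric_space.triangle[OF d_metric] inS by blast
    moreover have "d x' x = d x x'" using Metric_space.commute[OF d_metric] .
    ultimately have "d x' y' < d x y + 2 * e" using x'(2) y'(2) by linarith
    moreover have "2 * e = c3 * r ^ m - d x y" by (simp add: e_def)
    ultimately have "d x' y' < c3 * r ^ m" by linarith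
    moreover have pos: "0 < c3 * r ^ m" using c3 r by simp
    ultimately have "y' \<in> Metric_space.mball S d x' (c3 * r ^ m)"
      using inS Metric_space.in_mball[OF d_metric] by blast
    then have "y' \<in> weight_nbhd A \<phi> K g M x' (\<alpha>2 * (c3 * r ^ m))" using a2(2)[OF inS(3) pos] by blast
    moreover have "\<alpha>2 * (c3 * r ^ m) = c1 * r ^ m / 2" using a2(1) by (simp add: c3_def)
    ultimately have "y' \<in> weight_nbhd A \<phi> K g M x' (c1 * r ^ m / 2)" by metis
    then obtain w where w: "\<And>i. i \<in> {1..M+1} \<Longrightarrow> w i \<in> Lam A \<phi> g (c1 * r ^ m / 2)"
      "x' \<in> K (w 1)" "y' \<in> K (w (M+1))" "\<And>i. i \<in> {1..M} \<Longrightarrow> K (w i) \<inter> K (w (i+1)) \<noteq> {}"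
      unfolding weight_nbhd_def by blast
    have hw: "m \<le> ht (w i)" if "i \<in> {1..M+1}" for i
    proof (rule ccontr)
      assume "\<not> m \<le> ht (w i)"
      then have "r ^ m \<le> r ^ ht (w i)" using r by (intro power_decreasing) auto
      then have "c1 * r ^ m \<le> g (w i)" using g_lower[of "w i"] c1_pos
        by (meson mult_le_cancel_left_pos order_trans)
      moreover have "g (w i) \<le> c1 * r ^ m / 2" using Lam_le[OF w(1)[OF that]] .
      moreover have "0 < c1 * r ^ m" using c1_pos r by simp
      ultimately show False by linarith
    qed
    have "(anc m (w 1), anc m (w (M+1))) \<in> adj ^^ M" using chain_pow hw w(4) by blast
    moreover have "anc m (w 1) = v"
    proof (rule x'(3))
      have "m \<le> ht (w 1)" using hw[of 1] by simp
      then show "ht (anc m (w 1)) = m" "x' \<in> K (anc m (w 1))"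
        using anc_ht K_anc[of "w 1" m] w(2) by auto
    qed
    moreover have "anc m (w (M+1)) = u"
    proof (rule y'(3))
      have "m \<le> ht (w (M+1))" using hw[of "M+1"] by simp
      then show "ht (anc m (w (M+1))) = m" "y' \<in> K (anc m (w (M+1)))"
        using anc_ht K_anc[of "w (M+1)" m] w(3) by auto
    qed
    ultimately show ?thesis by simp
  qed
  then show ?thesis using that c3 by blast
qed

lemma pow_dist:
  assumes "(w,u) \<in> adj ^^ i" "x \<in> K w" "y \<in> K u"
  shows "d x y \<le> (real i + 1) * c2 * r ^ ht w"
  using assms(1,3)
proof (induction i arbitrary: u y)
  case 0
  then show ?case using d_le[OF assms(2)] by simp
next
  case (Suc i)
  obtain z where z: "(w,z) \<in> adj ^^ i" "(z,u) \<in> adj" using Suc.prems(1) by auto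
  obtain t where t: "t \<in> K z" "t \<in> K u" using adj_D[OF z(2)] by auto
  have u: "ht u = ht w" using adj_pow_C[OF Suc.prems(1)] by simp
  have "d x y \<le> d x t + d t y"
    using Metric_space.triangle[OF d_metric] K_S assms(2) t Suc.prems(2) by blast
  moreover have "d t y \<le> c2 * r ^ ht w" using d_le[OF t(2) Suc.prems(2)] u by simp
  moreover have "d x t \<le> (real i + 1) * c2 * r ^ ht w" using Suc.IH[OF z(1) t(1)] .
  ultimately show ?case by (simp add: algebra_simps)
qed

abbreviation "offspring w i \<equiv> {v. ht v = ht w + i \<and> anc (ht w) v = w}"

lemma card_below:
  obtains B :: nat where "\<And>w i. finite (offspring w i) \<and>
    card (offspring w i) \<le> B ^ i"
proof -
  obtain B :: nat where B: "\<And>w. finite (children A \<phi> w) \<and> card (children A \<phi> w) \<le> B"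
    using branching by auto
  have "finite (offspring w i) \<and>
    card (offspring w i) \<le> B ^ i" for w i
  proof (induction i)
    case 0
    have "{v. ht v = ht w + 0 \<and> anc (ht w) v = w} = {w}"
      by auto (metis anc_self)
    then show ?case by simp
  next
    case (Suc i)
    let ?D = "\<lambda>i. offspring w i"
    have sub: "?D (Suc i) \<subseteq> (\<Union>u\<in>?D i. children A \<phi> u)"
    proof
      fix v assume v: "v \<in> ?D (Suc i)"
      have hv: "ht v = Suc (ht w + i)" using v by simp
      then have "anc (Suc (ht w + i)) v = v" by (metis anc_self)
      with hv have a: "anc (ht w + i) v = pa v" using par_anc[of v "ht w + i"] by simp
      then have "ht (pa v) = ht w + i" using anc_ht[of "ht w + i" v] v by simp
      moreover have "anc (ht w) (pa v) = w" using anc_anc[of v "ht w" "ht w + i"] v a by simp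
      moreover have "v \<noteq> \<phi>" using v ht_root by auto
      ultimately show "v \<in> (\<Union>u\<in>?D i. children A \<phi> u)" using children_iff by blast
    qed
    have fin: "finite (\<Union>u\<in>?D i. children A \<phi> u)" using Suc B by blast
    have "card (?D (Suc i)) \<le> card (\<Union>u\<in>?D i. children A \<phi> u)" by (rule card_mono[OF fin sub])
    also have "\<dots> \<le> (\<Sum>u\<in>?D i. card (children A \<phi> u))" using Suc by (intro card_UN_le) blast
    also have "\<dots> \<le> (\<Sum>u\<in>?D i. B)" using B by (intro sum_mono) blast
    also have "\<dots> \<le> B ^ Suc i" using Suc by simp
    finally show ?case using finite_subset[OF sub fin] by blast
  qed
  then show ?thesis using that by blast
qed

text \<open>Uniform finiteness concerns \<open>Lam\<close>, not levels. At the scale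
  \<open>c1 * r ^ m / 2\<close>, the cells of \<open>Lam\<close> reached from level \<open>m\<close>
  lie at most \<open>j\<close> levels below it. A neighbour of \<open>v\<close> is seen through one
  of the boundedly many such cells below \<open>v\<close> and one of the neighbours of that cell in
  \<open>Lam\<close>.\<close>

lemma neighbours: obtains L where "\<And>v. card (adj `` {v}) \<le> L"
proof -
  obtain C :: nat where C: "\<And>s w. s \<in> {0<..1} \<Longrightarrow> w \<in> Lam A \<phi> g s \<Longrightarrow>
     finite {v \<in> Lam A \<phi> g s. K v \<inter> K w \<noteq> {}} \<and> card {v \<in> Lam A \<phi> g s. K v \<inter> K w \<noteq> {}} \<le> C"
    using unif unfolding uniformly_finite_def by blast
  obtain B :: nat where B: "\<And>w i. finite (offspring w i) \<and>
    card (offspring w i) \<le> B ^ i" using card_below by blast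
  obtain j where j: "c2 * r ^ j < c1 / 2" using small_r[of "c1/2" c2] c1_pos by auto
  have "card (adj `` {v}) \<le> (\<Sum>i\<le>j. B ^ i) * C" for v
  proof -
    define m where "m = ht v"
    define s where "s = c1 * r ^ m / 2"
    have cp: "0 < c1 * r ^ m" using c1_pos r by simp
    have s_less: "s < g u" if "ht u = m" for u using g_lower[of u] cp that by (simp add: s_def)
    have s01: "s \<in> {0<..1}" and s1: "s < 1" using cp s_less[of v] g_le_1[of v] by (auto simp: s_def m_def)
    define D where "D = {v' \<in> Lam A \<phi> g s. m \<le> ht v' \<and> anc m v' = v}"
    have ht_D: "ht v' \<le> m + j" if "v' \<in> Lam A \<phi> g s" for v'
    proof (rule ccontr)
      assume a: "\<not> ht v' \<le> m + j"
      have gs: "s < g (pa v')" using that s1 by (simp add: Lam_def)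
      have "v' \<noteq> \<phi>" using a ht_root by auto
      then have "m + j \<le> ht (pa v')" using a ht_pa[of v'] by simp
      then have "c2 * r ^ ht (pa v') \<le> c2 * r ^ (m + j)"
        using r c2_pos by (intro mult_left_mono power_decreasing) auto
      also have "\<dots> = r ^ m * (c2 * r ^ j)" by (simp add: power_add)
      also have "\<dots> \<le> r ^ m * (c1 / 2)" using j r by (intro mult_left_mono) auto
      finally show False using gs g_upper[of "pa v'"] by (simp add: s_def mult.commute)
    qed
    have D_sub: "D \<subseteq> (\<Union>i\<le>j. offspring v i)"
    proof
      fix v' assume v': "v' \<in> D"
      then have "ht v' \<le> m + j" "m \<le> ht v'" using ht_D by (auto simp: D_def)
      then show "v' \<in> (\<Union>i\<le>j. offspring v i)"
        using v' by (intro UN_I[of "ht v' - m"]) (auto simp: D_def m_def)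
    qed
    have fin: "finite (\<Union>i\<le>j. offspring v i)" using B by blast
    have finD: "finite D" using finite_subset[OF D_sub fin] .
    have "card D \<le> card (\<Union>i\<le>j. offspring v i)" by (rule card_mono[OF fin D_sub])
    also have "\<dots> \<le> (\<Sum>i\<le>j. card (offspring v i))" by (intro card_UN_le) simp
    also have "\<dots> \<le> (\<Sum>i\<le>j. B ^ i)" using B by (intro sum_mono) blast
    finally have cD: "card D \<le> (\<Sum>i\<le>j. B ^ i)" .
    let ?N = "\<lambda>v'. {u' \<in> Lam A \<phi> g s. K u' \<inter> K v' \<noteq> {}}"
    have N: "finite (?N v') \<and> card (?N v') \<le> C" if "v' \<in> D" for v'
      using C[OF s01, of v'] that by (simp add: D_def)
    have sub: "adj `` {v} \<subseteq> (\<Union>v'\<in>D. anc m ` ?N v')"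
    proof
      fix u assume "u \<in> adj `` {v}"
      then have u: "ht u = m" "K v \<inter> K u \<noteq> {}" using adj_D[of v u] by (auto simp: m_def)
      then obtain z where z: "z \<in> K v" "z \<in> K u" by blast
      have sp: "0 < s" using s01 by simp
      obtain v' where v': "v' \<in> Lam A \<phi> g s" "m \<le> ht v'" "anc m v' = v" "z \<in> K v'"
        using Lam_down[OF s_less sp z(1)] by (auto simp: m_def)
      obtain u' where u': "u' \<in> Lam A \<phi> g s" "anc m u' = u" "z \<in> K u'"
        using Lam_down[OF s_less[OF u(1)] sp z(2)] u(1) by auto
      have "v' \<in> D" using v' by (simp add: D_def)
      moreover have "u' \<in> ?N v'" using u' v' by auto
      ultimately show "u \<in> (\<Union>v'\<in>D. anc m ` ?N v')" using u'(2) by blast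
    qed
    have "finite (\<Union>v'\<in>D. anc m ` ?N v')" using finD N by blast
    then have "card (adj `` {v}) \<le> card (\<Union>v'\<in>D. anc m ` ?N v')" using sub by (rule card_mono)
    also have "\<dots> \<le> (\<Sum>v'\<in>D. card (anc m ` ?N v'))" by (rule card_UN_le[OF finD])
    also have "\<dots> \<le> (\<Sum>v'\<in>D. C)"
    proof (rule sum_mono)
      fix v' assume v': "v' \<in> D"
      have "card (anc m ` ?N v') \<le> card (?N v')" using N[OF v'] by (intro card_image_le) blast
      then show "card (anc m ` ?N v') \<le> C" using N[OF v'] by linarith
    qed
    also have "\<dots> = card D * C" by simp
    also have "\<dots> \<le> (\<Sum>i\<le>j. B ^ i) * C" using cD by (rule mult_right_mono) simp
    finally show ?thesis .
  qed
  then show ?thesis using that by blast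
qed

text \<open>Thickness gives a point \<open>x\<close> whose neighbourhood at scale
  \<open>\<alpha> * s\<close> stays in \<open>K w\<close>, and \<open>v\<close> is a deep cell
  through \<open>x\<close>. A neighbour of \<open>v\<close> has its own point in this neighbourhood,
  hence in \<open>K w\<close>; the cell of the level that contains this point below \<open>w\<close>
  can only be the neighbour itself.\<close>

lemma interior_cells:
  "\<exists>k0. \<forall>k\<ge>k0. \<forall>w. \<exists>v. ht v = ht w + k \<and> anc (ht w) v = w \<and> (\<forall>v'. (v,v') \<in> adj \<longrightarrow> anc (ht w) v' = w)"
proof -
  obtain M' \<alpha> where M': "1 \<le> M'" "0 < \<alpha>" and th: "\<And>s w. s \<in> {0<..1} \<Longrightarrow> w \<in> Lam A \<phi> g s \<Longrightarrow>
     \<exists>x\<in>K w. weight_nbhd A \<phi> K g M' x (\<alpha> * s) \<subseteq> K w"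
    using thick unfolding thick_def by metis
  have "0 < \<alpha> * c1 / 2" using M' c1_pos by simp
  then obtain k0 where k0: "\<And>k. k \<ge> k0 \<Longrightarrow> c2 * r ^ k < \<alpha> * c1 / 2" using small_r by blast
  have "\<exists>v. ht v = ht w + k \<and> anc (ht w) v = w \<and> (\<forall>v'. (v,v') \<in> adj \<longrightarrow> anc (ht w) v' = w)"
    if k: "k \<ge> k0" for k w
  proof -
    define s where "s = c1 * r ^ ht w / 2"
    have cp: "0 < c1 * r ^ ht w" using c1_pos r by simp
    have sg: "s < g w" "0 < s" using g_lower[of w] cp by (auto simp: s_def)
    then have s01: "s \<in> {0<..1}" using g_le_1[of w] by simp
    obtain x0 where "x0 \<in> K w" using K_ne[of w] by auto
    then obtain w' where w': "w' \<in> Lam A \<phi> g s" "ht w \<le> ht w'" "anc (ht w) w' = w"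
      using Lam_down[OF sg] by blast
    have K': "K w' \<subseteq> K w" using K_anc[of w' "ht w"] w' by simp
    obtain x where x: "x \<in> K w'" "weight_nbhd A \<phi> K g M' x (\<alpha> * s) \<subseteq> K w'" using th[OF s01 w'(1)] by blast
    have "x \<in> K w" using x K' by blast
    then obtain v0 where h0: "ht v0 = ht w + k" and v0: "anc (ht w) v0 = w" "x \<in> K v0"
      using below[of x w "ht w + k"] by auto
    have small: "g v \<le> \<alpha> * s" if "ht v = ht w + k" for v
    proof -
      have "g v \<le> r ^ ht w * (c2 * r ^ k)" using g_upper[of v] that by (simp add: power_add mult_ac)
      also have "\<dots> \<le> r ^ ht w * (\<alpha> * c1 / 2)" using k0[OF k] r by (intro mult_left_mono) auto
      finally show ?thesis by (simp add: s_def mult_ac)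
    qed
    have "anc (ht w) v = w" if "(v0,v) \<in> adj" for v
    proof -
      have v: "ht v = ht w + k" "K v0 \<inter> K v \<noteq> {}" using adj_D[OF that] h0 by auto
      obtain y where y: "y \<in> K v" "\<And>u. ht u = ht v \<Longrightarrow> y \<in> K u \<Longrightarrow> u = v" using own_point[of v] by blast
      obtain n1 where n1: "n1 \<le> ht v0" "anc n1 v0 \<in> Lam A \<phi> g (\<alpha> * s)" using Lam_up[OF small[OF h0]] by blast
      obtain n2 where n2: "n2 \<le> ht v" "anc n2 v \<in> Lam A \<phi> g (\<alpha> * s)" using Lam_up[OF small[OF v(1)]] by blast
      have K1: "K v0 \<subseteq> K (anc n1 v0)" and K2: "K v \<subseteq> K (anc n2 v)" using K_anc n1 n2 by simp_all
      have meet: "K (anc n1 v0) \<inter> K (anc n2 v) \<noteq> {}" using v(2) K1 K2 by blast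
      have "y \<in> weight_nbhd A \<phi> K g M' x (\<alpha> * s)"
        unfolding weight_nbhd_def
      \<comment> \<open>Two cells suffice; repeating the second one gives a chain of the prescribed
        length for every \<open>M' \<ge> 1\<close>.\<close>
      proof (intro CollectI exI[of _ "\<lambda>i. if i = 1 then anc n1 v0 else anc n2 v"] conjI ballI)
        show "x \<in> K (if 1 = 1 then anc n1 v0 else anc n2 v)" using K1 v0 by auto
        show "y \<in> K (if M' + 1 = 1 then anc n1 v0 else anc n2 v)" using K2 y(1) M' by auto
        show "(if i = 1 then anc n1 v0 else anc n2 v) \<in> Lam A \<phi> g (\<alpha> * s)" for i using n1 n2 by simp
        fix i assume i: "i \<in> {1..M'}"
        have "K (anc n2 v) \<noteq> {}" using K_ne by simp
        then show "K (if i = 1 then anc n1 v0 else anc n2 v) \<inter> K (if i + 1 = 1 then anc n1 v0 else anc n2 v) \<noteq> {}"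
          using meet i by auto
      qed
      then have "y \<in> K w" using x(2) K' by blast
      then obtain u where u: "ht u = ht w + k" "anc (ht w) u = w" "y \<in> K u"
        using below[of y w "ht w + k"] by auto
      have "ht u = ht v" using u(1) v(1) by simp
      then have "u = v" using u(3) by (rule y(2))
      then show ?thesis using u(2) by blast
    qed
    then show ?thesis using v0 h0 by blast
  qed
  then show ?thesis by blast
qed

text \<open>A single descendant at depth \<open>k\<close> would contain all of \<open>K w\<close>,
  which is impossible once \<open>c2 * r ^ k < c1\<close>.\<close>

lemma two_cells:
  "\<exists>k0. \<forall>k\<ge>k0. \<forall>w. \<exists>v v'. v \<noteq> v' \<and> ht v = ht w + k \<and> anc (ht w) v = w \<and> ht v' = ht w + k \<and> anc (ht w) v' = w"
proof -
  obtain k0 where k0: "\<And>k. k \<ge> k0 \<Longrightarrow> c2 * r ^ k < c1" using small_r[OF c1_pos] by blast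
  have ex: "\<exists>v v'. v \<noteq> v' \<and> ht v = ht w + k \<and> anc (ht w) v = w \<and> ht v' = ht w + k \<and> anc (ht w) v' = w"
    if k: "k \<ge> k0" for k w
  proof (rule ccontr)
    assume a: "\<not> ?thesis"
    obtain x where "x \<in> K w" using K_ne[of w] by auto
    then obtain v where v: "ht v = ht w + k" "anc (ht w) v = w" using below[of x w "ht w + k"] by auto
    have "K w \<subseteq> K v"
    proof
      fix y assume "y \<in> K w"
      then obtain v' where v': "ht v' = ht w + k" "anc (ht w) v' = w" "y \<in> K v'"
        using below[of y w "ht w + k"] by auto
      then have "v' = v" using a v by blast
      then show "y \<in> K v" using v'(3) by blast
    qed
    then have "g w \<le> g v" by (rule g_mono)
    also have "\<dots> \<le> r ^ ht w * (c2 * r ^ k)" using g_upper[of v] v by (simp add: power_add mult_ac)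
    also have "\<dots> < r ^ ht w * c1" using k0[OF k] r by (intro mult_strict_left_mono) auto
    finally show False using g_lower[of w] by (simp add: mult.commute)
  qed
  show ?thesis by (rule exI[of _ k0], intro allI impI, rule ex)
qed

lemma Gam_iff: "u \<in> Gam A \<phi> K n w \<longleftrightarrow> (w,u) \<in> adj ^^ n"
proof
  assume "u \<in> Gam A \<phi> K n w"
  then obtain v where v: "v 1 = w" "v (n+1) = u" "\<And>i. i \<in> {1..n+1} \<Longrightarrow> ht (v i) = ht w"
    "\<And>i. i \<in> {1..n} \<Longrightarrow> K (v i) \<inter> K (v (i+1)) \<noteq> {}"
    unfolding Gam_def level_def mem_Collect_eq by blast
  have "(anc (ht w) (v 1), anc (ht w) (v (n+1))) \<in> adj ^^ n"
    by (rule chain_pow) (use v in auto)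
  moreover have "anc (ht w) (v 1) = w" using v(1) by simp
  moreover have "ht u = ht w" using v(2) v(3)[of "n+1"] by simp
  then have "anc (ht w) (v (n+1)) = u" using v(2) by (metis anc_self)
  ultimately show "(w,u) \<in> adj ^^ n" by simp
next
  assume "(w,u) \<in> adj ^^ n"
  then obtain f where f: "f 0 = w" "f n = u" "\<And>i. i < n \<Longrightarrow> (f i, f (Suc i)) \<in> adj"
    unfolding relpow_fun_conv by blast
  have h: "ht (f i) = ht w" if "i \<le> n" for i
    using that
  proof (induction i)
    case (Suc i)
    then show ?case using adj_D[OF f(3)[of i]] by simp
  qed (simp add: f)
  show "u \<in> Gam A \<phi> K n w"
    unfolding Gam_def level_def
  proof (intro CollectI exI[of _ "\<lambda>i. f (i - 1)"] conjI ballI)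
    fix i assume i: "i \<in> {1..n}"
    then have "i - 1 < n" by auto
    from adj_D[OF f(3)[OF this]] i show "K (f (i - 1)) \<inter> K (f (i + 1 - 1)) \<noteq> {}" by simp
  next
    show "f (1 - 1) = w" "f (n + 1 - 1) = u" using f(1,2) by simp_all
  next
    fix i assume "i \<in> {1..n+1}"
    then have "i - 1 \<le> n" by auto
    then show "ht (f (i - 1)) = ht w" by (rule h)
  qed
qed

end


section \<open>Networks and crossing functions\<close>

lemma rtrancl_distinct_path:
  assumes "(x,y) \<in> R\<^sup>*"
  shows "\<exists>ps. ps \<noteq> [] \<and> hd ps = x \<and> last ps = y \<and> distinct ps \<and> successively (\<lambda>a b. (a,b) \<in> R) ps"
  using assms
proof (induction rule: rtrancl_induct)
  case base
  show ?case by (rule exI[of _ "[x]"]) simp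
next
  case (step y z)
  then obtain ps where ps: "ps \<noteq> []" "hd ps = x" "last ps = y" "distinct ps"
    "successively (\<lambda>a b. (a,b) \<in> R) ps" by blast
  show ?case
  proof (cases "z \<in> set ps")
    case True
    then obtain as bs where e: "ps = as @ z # bs" by (meson split_list)
    then have e2: "ps = (as @ [z]) @ bs" by simp
    have "successively (\<lambda>a b. (a,b) \<in> R) (as @ [z])" using ps(5) unfolding e2 successively_append_iff by blast
    moreover have "hd (as @ [z]) = x" using ps(2) e by (cases as) auto
    moreover have "distinct (as @ [z])" using ps(4) e by auto
    ultimately show ?thesis by (intro exI[of _ "as @ [z]"]) simp
  next
    case False
    then show ?thesis using ps step(2)
      by (intro exI[of _ "ps @ [z]"]) (simp add: successively_append_iff)
  qed
qed

lemma sum_UN_le: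
  fixes f :: "'a \<Rightarrow> real"
  assumes "finite I" "\<And>i. i \<in> I \<Longrightarrow> finite (B i)" "\<And>i x. i \<in> I \<Longrightarrow> x \<in> B i \<Longrightarrow> 0 \<le> f x"
  shows "(\<Sum>x\<in>(\<Union>i\<in>I. B i). f x) \<le> (\<Sum>i\<in>I. \<Sum>x\<in>B i. f x)"
  using assms
proof (induction I rule: finite_induct)
  case (insert i I)
  have "(\<Sum>x\<in>B i \<union> (\<Union>i\<in>I. B i). f x) \<le> (\<Sum>x\<in>B i. f x) + (\<Sum>x\<in>(\<Union>i\<in>I. B i). f x)"
  proof -
    have "(\<Sum>x\<in>B i \<union> (\<Union>i\<in>I. B i). f x) + (\<Sum>x\<in>B i \<inter> (\<Union>i\<in>I. B i). f x)
      = (\<Sum>x\<in>B i. f x) + (\<Sum>x\<in>(\<Union>i\<in>I. B i). f x)"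
      using insert by (intro sum.union_inter) auto
    moreover have "0 \<le> (\<Sum>x\<in>B i \<inter> (\<Union>i\<in>I. B i). f x)" using insert by (intro sum_nonneg) auto
    ultimately show ?thesis by linarith
  qed
  moreover have "(\<Sum>x\<in>(\<Union>i\<in>I. B i). f x) \<le> (\<Sum>i\<in>I. \<Sum>x\<in>B i. f x)" using insert by blast
  ultimately show ?case using insert(1,2) by simp
qed simp

text \<open>Each term is bounded by the largest one. This crude argument covers all positive
  \<open>p\<close>, including those below 1, where convexity fails.\<close>

lemma sum_powr_le:
  fixes f :: "'a \<Rightarrow> real"
  assumes "finite A" "\<And>x. x \<in> A \<Longrightarrow> 0 \<le> f x" "0 < p"
  shows "(\<Sum>x\<in>A. f x) powr p \<le> real (card A) powr p * (\<Sum>x\<in>A. f x powr p)"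
proof (cases "A = {}")
  case False
  have "Max (f ` A) \<in> f ` A" using assms(1) False by (intro Max_in) auto
  then obtain y where y: "y \<in> A" "Max (f ` A) = f y" by blast
  have "f x \<le> f y" if "x \<in> A" for x
    unfolding y(2)[symmetric] using that assms(1) by (intro Max_ge) auto
  then have "(\<Sum>x\<in>A. f x) \<le> real (card A) * f y" by (intro sum_bounded_above) auto
  then have "(\<Sum>x\<in>A. f x) powr p \<le> (real (card A) * f y) powr p"
    using assms by (intro powr_mono2 sum_nonneg) auto
  also have "\<dots> = real (card A) powr p * f y powr p" using assms y by (simp add: powr_mult)
  also have "\<dots> \<le> real (card A) powr p * (\<Sum>x\<in>A. f x powr p)"
    using y assms by (intro mult_left_mono member_le_sum) auto
  finally show ?thesis .
qed simp

lemma indexed_path_rtrancl: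
  assumes "\<exists>n\<ge>1. \<exists>(xs :: nat \<Rightarrow> 'v) (ws :: nat \<Rightarrow> 't).
     (\<forall>i\<in>{1..n}. ws i \<in> W) \<and>
     (\<forall>i\<in>{1..<n}. (xs i, xs (i+1)) \<in> R \<and> xs i \<in> U (ws i) \<and> xs (i+1) \<in> U (ws (i+1))) \<and>
     xs 1 = x \<and> xs n = y \<and> ws 1 = u \<and> ws n = v"
  shows "(x,y) \<in> {(a,b) \<in> R. a \<in> (\<Union>w\<in>W. U w) \<and> b \<in> (\<Union>w\<in>W. U w)}\<^sup>*" (is "_ \<in> ?R\<^sup>*")
proof -
  from assms obtain n where n: "n \<ge> 1 \<and> (\<exists>(xs :: nat \<Rightarrow> 'v) (ws :: nat \<Rightarrow> 't).
     (\<forall>i\<in>{1..n}. ws i \<in> W) \<and>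
     (\<forall>i\<in>{1..<n}. (xs i, xs (i+1)) \<in> R \<and> xs i \<in> U (ws i) \<and> xs (i+1) \<in> U (ws (i+1))) \<and>
     xs 1 = x \<and> xs n = y \<and> ws 1 = u \<and> ws n = v)" by (rule exE)
  from n[THEN conjunct2] obtain xs :: "nat \<Rightarrow> 'v" where "\<exists>ws :: nat \<Rightarrow> 't.
     (\<forall>i\<in>{1..n}. ws i \<in> W) \<and>
     (\<forall>i\<in>{1..<n}. (xs i, xs (i+1)) \<in> R \<and> xs i \<in> U (ws i) \<and> xs (i+1) \<in> U (ws (i+1))) \<and>
     xs 1 = x \<and> xs n = y \<and> ws 1 = u \<and> ws n = v" by (rule exE)
  then obtain ws :: "nat \<Rightarrow> 't" where p: "(\<forall>i\<in>{1..n}. ws i \<in> W) \<and>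
     (\<forall>i\<in>{1..<n}. (xs i, xs (i+1)) \<in> R \<and> xs i \<in> U (ws i) \<and> xs (i+1) \<in> U (ws (i+1))) \<and>
     xs 1 = x \<and> xs n = y \<and> ws 1 = u \<and> ws n = v" by (rule exE)
  have "(xs 1, xs (Suc j)) \<in> ?R\<^sup>*" if "Suc j \<le> n" for j
    using that
  proof (induction j)
    case (Suc j)
    then have i: "Suc j \<in> {1..<n}" "Suc j \<in> {1..n}" "Suc j + 1 \<in> {1..n}" by auto
    then have "(xs (Suc j), xs (Suc j + 1)) \<in> ?R" using p by blast
    then show ?case using Suc by (auto intro: rtrancl_into_rtrancl)
  qed simp
  from this[of "n - 1"] show ?thesis using p n by simp
qed

text \<open>
  Here (N5) is used only in the form that the two vertices are joined inside the cells
  within \<open>L2\<close> steps of \<open>u\<close>.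
\<close>

locale network = framework A \<phi> X K d M r c1 c2
  for A :: "'t \<Rightarrow> 't \<Rightarrow> bool" and \<phi> :: 't and X :: "'x topology" and K d M r c1 c2 +
  fixes L :: nat and c3 :: real
    and Am :: "nat \<Rightarrow> 't set" and Vm :: "nat \<Rightarrow> 'x set"
    and E :: "nat \<Rightarrow> (('t + 'x) \<times> ('t + 'x)) set"
    and N L0 L1 L2 N1 N2 :: nat
  assumes card_adj': "card (adj `` {v}) \<le> L"
    and c3_pos: "0 < c3"
    and sep: "\<And>u v x y. \<lbrakk>ht u = ht v; x \<in> K v; y \<in> K u; d x y < c3 * r ^ ht v\<rbrakk> \<Longrightarrow> (v,u) \<in> adj ^^ M"
    and graph: "nondirected_graph (net_verts Am Vm m) (E m)"
    and Am_level: "Am m \<subseteq> level A \<phi> m" and Vm_S: "Vm m \<subseteq> topspace X"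
    and cell_ne: "ht w = m \<Longrightarrow> net_cell K Am Vm m w \<noteq> {}"
    and edge_card: "\<lbrakk>ht u = m; ht v = m\<rbrakk> \<Longrightarrow>
       finite (net_edges K Am Vm E m u v) \<and> card (net_edges K Am Vm E m u v) \<le> L0"
    and edge_near: "\<And>x y m. (x,y) \<in> E m \<Longrightarrow>
       \<exists>u v. ht u = m \<and> (u,v) \<in> adj ^^ N \<and> x \<in> net_cell K Am Vm m u \<and> y \<in> net_cell K Am Vm m v"
    and L1_pos: "1 \<le> L1"
    and edge_path: "\<And>x y u v m. \<lbrakk>ht u = m; (u,v) \<in> adj ^^ L1; x \<in> net_cell K Am Vm m u; y \<in> net_cell K Am Vm m v\<rbrakk> \<Longrightarrow>
       (x,y) \<in> {(a,b) \<in> E m. a \<in> (\<Union>w\<in>(adj ^^ L2) `` {u}. net_cell K Am Vm m w) \<and>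
          b \<in> (\<Union>w\<in>(adj ^^ L2) `` {u}. net_cell K Am Vm m w)}\<^sup>*"
    and M_pos: "1 \<le> M" and N2_ge: "N1 + M \<le> N2"
begin

sublocale bounded_hierarchy UNIV ht pa K S L
  by unfold_locales (rule card_adj')

abbreviation "cell \<equiv> net_cell K Am Vm"
abbreviation "verts \<equiv> net_verts Am Vm"

lemma cell_verts: "cell m w \<subseteq> verts m"
  by (auto simp: net_cell_def net_verts_def)

lemma vert_cell: assumes "z \<in> verts m" shows "\<exists>w. ht w = m \<and> z \<in> cell m w"
proof (cases z)
  case (Inl u)
  then have "u \<in> Am m" using assms by (auto simp: net_verts_def)
  then show ?thesis using Inl Am_level[of m] by (intro exI[of _ u]) (auto simp: net_cell_def level_def)
next
  case (Inr x)
  then have x: "x \<in> Vm m" using assms by (auto simp: net_verts_def)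
  then have "x \<in> S" using Vm_S by blast
  then obtain v where "v \<in> V m" "x \<in> K v" by (rule cell_at)
  then show ?thesis using Inr x by (intro exI[of _ v]) (auto simp: net_cell_def V_ht)
qed

lemma cells_adj:
  assumes "z \<in> cell m u" "z \<in> cell m v" "ht u = m" "ht v = m" shows "(u,v) \<in> adj"
proof (cases z)
  case (Inl a)
  then have "u = v" using assms by (auto simp: net_cell_def)
  then show ?thesis using adj_refl by simp
next
  case (Inr x)
  then have "x \<in> K u \<inter> K v" using assms by (auto simp: net_cell_def)
  then show ?thesis unfolding adj_def using assms by auto
qed

lemma pow_mono: "(u,v) \<in> adj ^^ i \<Longrightarrow> i \<le> j \<Longrightarrow> (u,v) \<in> adj ^^ j"
  by (rule adj_pow_mono) simp_all

lemma pow_ht: "(u,v) \<in> adj ^^ i \<Longrightarrow> ht v = ht u"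
  using adj_pow_C by blast

definition Lc :: nat where "Lc = L ^ L2 * L0 + 1"

text \<open>In a cell with at least two vertices, \<open>edge_path\<close> with equal cells joins
  each vertex to another one. So each vertex is the start of an edge into a cell within
  \<open>L2\<close> steps, and there are at most \<open>L ^ L2 * L0\<close> of these edges. The
  \<open>+ 1\<close> in \<open>Lc\<close> is for singletons.\<close>

lemma finite_cell: "ht u = m \<Longrightarrow> finite (cell m u) \<and> card (cell m u) \<le> Lc"
proof -
  assume u: "ht u = m"
  show ?thesis
  proof (cases "\<exists>a. cell m u \<subseteq> {a}")
    case True
    then obtain a where a: "cell m u \<subseteq> {a}" by blast
    then have "card (cell m u) \<le> card {a}" by (intro card_mono) auto
    then show ?thesis using a finite_subset[OF a] by (simp add: Lc_def)
  next
    case False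
    let ?U = "\<Union>w\<in>(adj ^^ L2) `` {u}. net_edges K Am Vm E m u w"
    have fin: "finite ((adj ^^ L2) `` {u})" using finite_pow by simp
    have e: "finite (net_edges K Am Vm E m u w) \<and> card (net_edges K Am Vm E m u w) \<le> L0"
      if "w \<in> (adj ^^ L2) `` {u}" for w using edge_card[OF u] pow_ht that u by blast
    have "cell m u \<subseteq> fst ` ?U"
    proof
      fix x assume x: "x \<in> cell m u"
      then obtain y where y: "y \<in> cell m u" "y \<noteq> x" using False by blast
      have "(u,u) \<in> adj ^^ L1" by (rule adj_pow_refl) simp
      from edge_path[OF u this x y(1)] obtain z where
        "(x,z) \<in> E m" "z \<in> (\<Union>w\<in>(adj ^^ L2) `` {u}. cell m w)"
        by (rule converse_rtranclE) (use y(2) in auto)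
      then obtain w where "w \<in> (adj ^^ L2) `` {u}" "(x,z) \<in> net_edges K Am Vm E m u w"
        using x by (auto simp: net_edges_def)
      then show "x \<in> fst ` ?U" by (intro image_eqI[of _ _ "(x, z)"]) auto
    qed
    moreover have finU: "finite ?U" using fin e by blast
    ultimately have "finite (cell m u)" "card (cell m u) \<le> card (fst ` ?U)"
      by (auto intro: finite_subset card_mono)
    moreover have "card (fst ` ?U) \<le> card ?U" by (rule card_image_le[OF finU])
    moreover have "card ?U \<le> (\<Sum>w\<in>(adj ^^ L2) `` {u}. card (net_edges K Am Vm E m u w))"
      by (rule card_UN_le[OF fin])
    moreover have "\<dots> \<le> (\<Sum>w\<in>(adj ^^ L2) `` {u}. L0)" using e by (intro sum_mono) blast
    moreover have "\<dots> \<le> L ^ L2 * L0" using card_pow[of u L2] by simp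
    ultimately show ?thesis unfolding Lc_def by linarith
  qed
qed

lemma finite_verts: "finite (verts m)"
proof -
  have "verts m \<subseteq> (\<Union>w\<in>{w. ht w = m}. cell m w)" using vert_cell by blast
  moreover have "finite (\<Union>w\<in>{w. ht w = m}. cell m w)" using finite_ht finite_cell by blast
  ultimately show ?thesis by (rule finite_subset)
qed

lemma descs_iff: "v \<in> descs A \<phi> k (Gam A \<phi> K n w) \<longleftrightarrow> ht v = ht w + k \<and> (w, anc (ht w) v) \<in> adj ^^ n"
proof
  assume "v \<in> descs A \<phi> k (Gam A \<phi> K n w)"
  then obtain w' where w': "(w,w') \<in> adj ^^ n" "ht v = ht w' + k" "(pa ^^ k) v = w'"
    by (auto simp: descs_def Gam_iff desc_iff)
  then show "ht v = ht w + k \<and> (w, anc (ht w) v) \<in> adj ^^ n" using pow_ht[OF w'(1)] by (simp add: anc_def)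
next
  assume a: "ht v = ht w + k \<and> (w, anc (ht w) v) \<in> adj ^^ n"
  then have "v \<in> desc A \<phi> k (anc (ht w) v)"
    using pow_ht[of w "anc (ht w) v" n] by (simp add: desc_iff) (simp add: anc_def)
  then show "v \<in> descs A \<phi> k (Gam A \<phi> K n w)" using a by (auto simp: descs_def Gam_iff)
qed

abbreviation "inn k w \<equiv> net_inner A \<phi> K Am Vm k w N1"
abbreviation "out k w \<equiv> net_outer A \<phi> K Am Vm k w N2"

lemma inn_iff: "z \<in> inn k w \<longleftrightarrow> (\<exists>v. ht v = ht w + k \<and> (w, anc (ht w) v) \<in> adj ^^ N1 \<and> z \<in> cell (ht w + k) v)"
  unfolding net_inner_def net_cells_def using descs_iff by auto

lemma out_iff: "z \<in> out k w \<longleftrightarrow> (\<exists>v. ht v = ht w + k \<and> (w, anc (ht w) v) \<notin> adj ^^ N2 \<and> z \<in> cell (ht w + k) v)"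
  unfolding net_outer_def net_cells_def level_def using descs_iff by auto

text \<open>A vertex in \<open>X\<close> can belong to several cells, but these touch. An inner
  vertex is therefore only in cells whose ancestors are within \<open>N1 + 1\<close> steps of
  \<open>w\<close>, and \<open>N1 + 1 \<le> N2\<close>.\<close>

lemma inn_out_disjoint: "z \<in> inn k w \<Longrightarrow> z \<notin> out k w"
proof
  assume "z \<in> inn k w" "z \<in> out k w"
  then obtain v u where v: "ht v = ht w + k" "(w, anc (ht w) v) \<in> adj ^^ N1" "z \<in> cell (ht w + k) v"
    and u: "ht u = ht w + k" "(w, anc (ht w) u) \<notin> adj ^^ N2" "z \<in> cell (ht w + k) u"
    using inn_iff out_iff by blast
  have "(v,u) \<in> adj" by (rule cells_adj[OF v(3) u(3) v(1) u(1)])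
  then have "(anc (ht w) v, anc (ht w) u) \<in> adj" using adj_D[of v u] u v by (intro adj_anc) auto
  then have "(w, anc (ht w) u) \<in> adj ^^ Suc N1" using v(2) by auto
  then show False using u(2) pow_mono[of w _ "Suc N1" N2] M_pos N2_ge by auto
qed

text \<open>The vertices to which \<open>edge_path\<close> confines the connection from
  \<open>u\<close> to a neighbouring cell.\<close>

definition Om :: "nat \<Rightarrow> 't \<Rightarrow> ('t + 'x) set" where "Om m u = (\<Union>v\<in>(adj ^^ L2) `` {u}. cell m v)"

lemma cell_Om: "cell m u \<subseteq> Om m u"
proof -
  have "(u,u) \<in> adj ^^ L2" by (rule adj_pow_refl) simp
  then show ?thesis unfolding Om_def by blast
qed

lemma Om_verts: "Om m u \<subseteq> verts m" using cell_verts by (auto simp: Om_def)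

lemma card_Om: "ht u = m \<Longrightarrow> card (Om m u) \<le> L ^ L2 * Lc"
proof -
  assume u: "ht u = m"
  have fin: "finite ((adj ^^ L2) `` {u})" using finite_pow by simp
  have "card (Om m u) \<le> (\<Sum>v\<in>(adj ^^ L2) `` {u}. card (cell m v))"
    unfolding Om_def by (rule card_UN_le[OF fin])
  also have "\<dots> \<le> (\<Sum>v\<in>(adj ^^ L2) `` {u}. Lc)" using finite_cell pow_ht u by (intro sum_mono) blast
  also have "\<dots> \<le> L ^ L2 * Lc" using card_pow[of u L2] by simp
  finally show ?thesis .
qed

lemma step_path:
  assumes "ht u = m" "(u,u') \<in> adj" "x \<in> cell m u" "y \<in> cell m u'"
  shows "(x,y) \<in> {(a,b) \<in> E m. a \<in> Om m u \<and> b \<in> Om m u}\<^sup>*"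
proof -
  have "(u,u') \<in> adj ^^ L1" using pow_mono[of u u' 1 L1] assms(2) L1_pos by simp
  from edge_path[OF assms(1) this assms(3,4)] show ?thesis unfolding Om_def .
qed

lemma chain_path:
  assumes "us \<noteq> []" "\<forall>u\<in>set us. ht u = m" "successively (\<lambda>u v. (u,v) \<in> adj) us"
    and z: "\<And>u. ht u = m \<Longrightarrow> z u \<in> cell m u"
  shows "(z (hd us), z (last us)) \<in> {(a,b) \<in> E m. a \<in> (\<Union>u\<in>set us. Om m u) \<and> b \<in> (\<Union>u\<in>set us. Om m u)}\<^sup>*"
  using assms(1-3)
proof (induction us)
  case (Cons u us)
  show ?case
  proof (cases "us = []")
    case False
    let ?R = "{(a,b) \<in> E m. a \<in> (\<Union>u\<in>set (u # us). Om m u) \<and> b \<in> (\<Union>u\<in>set (u # us). Om m u)}"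
    have a: "(u, hd us) \<in> adj" "successively (\<lambda>u v. (u,v) \<in> adj) us"
      using Cons.prems(3) False by (auto simp: successively_Cons)
    have h: "ht u = m" "ht (hd us) = m" using Cons.prems(2) False by auto
    have "(z u, z (hd us)) \<in> {(a,b) \<in> E m. a \<in> Om m u \<and> b \<in> Om m u}\<^sup>*"
      by (rule step_path[OF h(1) a(1)]) (use z h in auto)
    then have 1: "(z u, z (hd us)) \<in> ?R\<^sup>*" by (rule rtrancl_mono[THEN subsetD, rotated]) auto
    have "(z (hd us), z (last us)) \<in> {(a,b) \<in> E m. a \<in> (\<Union>u\<in>set us. Om m u) \<and> b \<in> (\<Union>u\<in>set us. Om m u)}\<^sup>*"
      using Cons.IH[OF False _ a(2)] Cons.prems(2) by simp
    then have "(z (hd us), z (last us)) \<in> ?R\<^sup>*" by (rule rtrancl_mono[THEN subsetD, rotated]) auto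
    then show ?thesis using 1 False by simp
  qed simp
qed simp

definition admissible :: "nat \<Rightarrow> 't \<Rightarrow> ('t + 'x \<Rightarrow> real) \<Rightarrow> bool" where
  "admissible k w f \<longleftrightarrow> (\<forall>x\<in>verts (ht w + k). 0 \<le> f x) \<and>
     (\<forall>xs\<in>connecting_paths (verts (ht w + k)) (E (ht w + k)) (inn k w) (out k w). 1 \<le> (\<Sum>x\<leftarrow>xs. f x))"

text \<open>Neighbouring cells of the chain are joined inside the sets \<open>Om\<close>, which
  yields a network path from an inner to an outer vertex. The path is made simple so that its sum is
  a sum over a set, which the union of the sets \<open>Om\<close> then dominates.\<close>

lemma transfer_cross:
  assumes f: "admissible k w f"
    and us: "us \<noteq> []" "\<forall>u\<in>set us. ht u = ht w + k" "successively (\<lambda>u v. (u,v) \<in> adj) us"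
    and e: "anc (ht w) (hd us) = w" "(w, anc (ht w) (last us)) \<notin> adj ^^ N2"
  shows "1 \<le> (\<Sum>u\<in>set us. \<Sum>x\<in>Om (ht w + k) u. f x)"
proof -
  let ?m = "ht w + k"
  define z where "z u = (SOME z. z \<in> cell ?m u)" for u
  have z: "z u \<in> cell ?m u" if "ht u = ?m" for u
    unfolding z_def by (rule someI_ex) (use cell_ne[OF that] in blast)
  let ?T = "\<Union>u\<in>set us. Om ?m u"
  let ?x = "z (hd us)" and ?y = "z (last us)"
  have hl: "hd us \<in> set us" "last us \<in> set us" using us(1) by auto
  then have hht: "ht (hd us) = ?m" "ht (last us) = ?m" using us(2) by auto
  have ww: "(w,w) \<in> adj ^^ N1" by (rule adj_pow_refl) simp
  have x_inn: "?x \<in> inn k w"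
    unfolding inn_iff by (rule exI[of _ "hd us"]) (use z[OF hht(1)] hht(1) e(1) ww in simp)
  have y_out: "?y \<in> out k w"
    unfolding out_iff by (rule exI[of _ "last us"]) (use z[OF hht(2)] hht(2) e(2) in simp)
  have xy: "?x \<noteq> ?y" using x_inn y_out inn_out_disjoint by metis
  obtain ps where ps: "ps \<noteq> []" "hd ps = ?x" "last ps = ?y" "distinct ps"
    "successively (\<lambda>a b. (a,b) \<in> {(a,b) \<in> E ?m. a \<in> ?T \<and> b \<in> ?T}) ps"
    using rtrancl_distinct_path[OF chain_path[OF us z]] by blast
  have succ: "successively (\<lambda>a b. (a,b) \<in> E ?m) ps" by (rule successively_mono[OF ps(5)]) auto
  have xyT: "?x \<in> ?T" "?y \<in> ?T" using z[OF hht(1)] z[OF hht(2)] hl cell_Om by blast+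
  have psT: "set ps \<subseteq> ?T"
    using ps(1,2,5) xyT(1)
  proof (induction ps arbitrary: rule: rev_induct)
    case (snoc a ps)
    then show ?case by (cases "ps = []") (auto simp: successively_append_iff)
  qed simp
  have Tv: "?T \<subseteq> verts ?m" using Om_verts by blast
  have fT: "0 \<le> f x" if "x \<in> ?T" for x using f that Tv unfolding admissible_def by blast
  have fin: "finite ?T" using finite_subset[OF Tv finite_verts] .
  obtain mid where mid: "ps = ?x # mid @ [?y]"
  proof -
    obtain qs where q: "ps = ?x # qs" using ps(1,2) by (cases ps) auto
    then have "qs \<noteq> []" using ps(3) xy by auto
    then have "qs = butlast qs @ [?y]" using ps(3) q by (metis append_butlast_last_id last_ConsR)
    then show ?thesis using that q by metis
  qed
  have sum_ps: "(\<Sum>x\<leftarrow>ps. f x) = (\<Sum>x\<in>set ps. f x)" using ps(4) by (simp add: sum_list_distinct_conv_sum_set)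
  have nn: "0 \<le> f ?x" "0 \<le> f ?y" using fT xyT by auto
  have "1 \<le> (\<Sum>x\<leftarrow>ps. f x)"
  proof (cases "mid = []")
    case False
    have "mid \<in> connecting_paths (verts ?m) (E ?m) (inn k w) (out k w)"
      unfolding connecting_paths_def
    proof (intro CollectI conjI bexI)
      show "successively (\<lambda>x y. (x, y) \<in> E ?m) (?x # mid @ [?y])" using succ mid by simp
      have "set mid \<subseteq> set ps" by (subst mid) auto
      then show "set mid \<subseteq> verts ?m" using psT Tv by blast
    qed (use False x_inn y_out in auto)
    then have "1 \<le> (\<Sum>x\<leftarrow>mid. f x)" using f by (simp add: admissible_def)
    also have "\<dots> \<le> (\<Sum>x\<leftarrow>ps. f x)" by (subst mid) (use nn in simp)
    finally show ?thesis .
  next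
    case True
    \<comment> \<open>A direct edge leaves no vertex strictly between its ends, and connecting paths
      must not be empty. Going to and fro along the edge gives the admissible path
      \<open>[?y, ?x]\<close> with end points \<open>?x\<close> and \<open>?y\<close>.\<close>
    then have "(?x, ?y) \<in> E ?m" using succ mid by simp
    moreover have "(?y, ?x) \<in> E ?m"
      using graph[of ?m] calculation by (auto simp: nondirected_graph_def dest: symD)
    ultimately have "[?y, ?x] \<in> connecting_paths (verts ?m) (E ?m) (inn k w) (out k w)"
      unfolding connecting_paths_def using x_inn y_out xyT Tv
      by (intro CollectI conjI bexI[of _ ?x] bexI[of _ ?y]) auto
    then have "1 \<le> (\<Sum>x\<leftarrow>[?y, ?x]. f x)" using f unfolding admissible_def by blast
    also have "\<dots> = (\<Sum>x\<leftarrow>ps. f x)" by (subst mid) (simp add: True)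
    finally show ?thesis .
  qed
  also have "\<dots> = (\<Sum>x\<in>set ps. f x)" by (rule sum_ps)
  also have "\<dots> \<le> (\<Sum>x\<in>?T. f x)" using psT fT by (intro sum_mono2[OF fin]) auto
  also have "\<dots> \<le> (\<Sum>u\<in>set us. \<Sum>x\<in>Om ?m u. f x)"
  proof (rule sum_UN_le)
    show "finite (Om ?m u)" for u using finite_subset[OF Om_verts finite_verts] .
  qed (use fT in auto)
  finally show ?thesis .
qed

text \<open>Each \<open>Om m u\<close> has boundedly many vertices, and each vertex is in at most
  \<open>L ^ (L2 + 1)\<close> of these sets: one step joins the cells containing it,
  \<open>L2\<close> steps lead back to \<open>u\<close>.\<close>

lemma transfer_sum:
  assumes f: "\<And>x. x \<in> verts m \<Longrightarrow> 0 \<le> f x" and p: "0 < p"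
  shows "(\<Sum>u\<in>{u. ht u = m}. (\<Sum>x\<in>Om m u. f x) powr p)
    \<le> real (L ^ L2 * Lc) powr p * real (L ^ (L2 + 1)) * (\<Sum>x\<in>verts m. f x powr p)"
proof -
  let ?n = "real (L ^ L2 * Lc) powr p"
  have finO: "finite (Om m u)" for u using finite_subset[OF Om_verts finite_verts] .
  have "(\<Sum>u\<in>{u. ht u = m}. (\<Sum>x\<in>Om m u. f x) powr p)
    \<le> (\<Sum>u\<in>{u. ht u = m}. ?n * (\<Sum>x\<in>Om m u. f x powr p))"
  proof (rule sum_mono)
    fix u assume u: "u \<in> {u. ht u = m}"
    have "(\<Sum>x\<in>Om m u. f x) powr p \<le> real (card (Om m u)) powr p * (\<Sum>x\<in>Om m u. f x powr p)"
      using f Om_verts p by (intro sum_powr_le finO) auto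
    also have "real (card (Om m u)) \<le> real (L ^ L2 * Lc)" using card_Om[of u m] u by (simp only: of_nat_le_iff mem_Collect_eq)
    then have "real (card (Om m u)) powr p * (\<Sum>x\<in>Om m u. f x powr p) \<le> ?n * (\<Sum>x\<in>Om m u. f x powr p)"
      using p by (intro mult_right_mono powr_mono2 sum_nonneg) auto
    finally show "(\<Sum>x\<in>Om m u. f x) powr p \<le> ?n * (\<Sum>x\<in>Om m u. f x powr p)" .
  qed
  also have "\<dots> = ?n * (\<Sum>u\<in>{u. ht u = m}. \<Sum>x\<in>{x \<in> verts m. x \<in> Om m u}. f x powr p)"
  proof -
    have "{x \<in> verts m. x \<in> Om m u} = Om m u" for u using Om_verts by blast
    then show ?thesis by (simp add: sum_distrib_left)
  qed
  also have "(\<Sum>u\<in>{u. ht u = m}. \<Sum>x\<in>{x \<in> verts m. x \<in> Om m u}. f x powr p)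
    = (\<Sum>x\<in>verts m. \<Sum>u\<in>{u \<in> {u. ht u = m}. x \<in> Om m u}. f x powr p)"
    by (rule sum.swap_restrict[OF finite_ht finite_verts])
  also have "?n * \<dots> \<le> ?n * (\<Sum>x\<in>verts m. real (L ^ (L2 + 1)) * f x powr p)"
  proof (intro mult_left_mono sum_mono)
    fix x assume "x \<in> verts m"
    then obtain u0 where u0: "ht u0 = m" "x \<in> cell m u0" using vert_cell by blast
    have "{u \<in> {u. ht u = m}. x \<in> Om m u} \<subseteq> (adj ^^ (L2 + 1)) `` {u0}"
    proof
      fix u assume "u \<in> {u \<in> {u. ht u = m}. x \<in> Om m u}"
      then obtain v where u: "ht u = m" and v: "(u,v) \<in> adj ^^ L2" "x \<in> cell m v" by (auto simp: Om_def)
      have "(u0,v) \<in> adj" using cells_adj[OF u0(2) v(2) u0(1)] pow_ht[OF v(1)] u by simp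
      then have "(u0,v) \<in> adj ^^ 1" by simp
      then have "(u0,u) \<in> adj ^^ (1 + L2)" using adj_pow_sym[OF v(1)] by (rule adj_pow_trans)
      then show "u \<in> (adj ^^ (L2 + 1)) `` {u0}" by (simp only: add.commute Image_singleton_iff)
    qed
    then have "card {u \<in> {u. ht u = m}. x \<in> Om m u} \<le> card ((adj ^^ (L2 + 1)) `` {u0})"
      by (rule card_mono[OF finite_pow[OF UNIV_I]])
    also have "\<dots> \<le> L ^ (L2 + 1)" by (rule card_pow) simp
    finally have "real (card {u \<in> {u. ht u = m}. x \<in> Om m u}) \<le> real (L ^ (L2 + 1))"
      by (simp only: of_nat_le_iff)
    then show "(\<Sum>u\<in>{u \<in> {u. ht u = m}. x \<in> Om m u}. f x powr p) \<le> real (L ^ (L2 + 1)) * f x powr p"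
      by (simp add: mult_right_mono del: of_nat_power power_Suc)
  qed simp
  finally show ?thesis by (simp add: sum_distrib_left mult.assoc)
qed

end

context network begin

abbreviation "modulus p k \<equiv> net_modulus A \<phi> K Am Vm E p k N1 N2"

lemma L_ge: "1 \<le> L" by (rule L_ge_1[of \<phi>]) simp

abbreviation "crossed w k F \<equiv>
  \<forall>us. us \<noteq> [] \<longrightarrow> (\<forall>u\<in>set us. ht u = ht w + k) \<longrightarrow> successively (\<lambda>u v. (u,v) \<in> adj) us \<longrightarrow>
       anc (ht w) (hd us) = w \<longrightarrow> (w, anc (ht w) (last us)) \<notin> adj ^^ N2 \<longrightarrow> 1 \<le> (\<Sum>u\<in>set us. F u)"

text \<open>A vanishing liminf gives arbitrarily large \<open>k\<close> with small modulus. As the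
  modulus is a supremum over \<open>w\<close>, one \<open>k\<close> serves all \<open>w\<close>. The
  function on a cell is the sum of a nearly optimal function over \<open>Om\<close>.\<close>

lemma crossing_functions:
  assumes p: "0 < p" and lim: "liminf (\<lambda>k. modulus p k) = 0" and e: "0 < e"
  shows "\<exists>k\<ge>k0. \<forall>w. \<exists>F. (\<forall>v. 0 \<le> F v) \<and> (\<Sum>u\<in>{u. ht u = ht w + k}. F u powr p) \<le> e \<and>
    crossed w k F"
proof -
  define C where "C = real (L ^ L2 * Lc) powr p * real (L ^ (L2 + 1))"
  have "0 < L ^ L2" "0 < Lc" "0 < L ^ (L2 + 1)" using L_ge by (auto simp: Lc_def)
  then have "0 < real (L ^ L2 * Lc)" "0 < real (L ^ (L2 + 1))" by (simp_all only: of_nat_0_less_iff nat_0_less_mult_iff)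
  then have C: "0 < C" unfolding C_def by (intro mult_pos_pos) (simp_all only: powr_gt_zero)
  define \<eta> where "\<eta> = e / C"
  have \<eta>: "0 < \<eta>" using e C by (simp add: \<eta>_def)
  let ?M = "\<lambda>k. modulus p k"
  have "\<exists>k\<ge>k0. ?M k < ennreal \<eta>"
  proof (rule ccontr)
    assume "\<not> ?thesis"
    then have "\<forall>k\<ge>k0. ennreal \<eta> \<le> ?M k" by (meson not_le)
    then have "ennreal \<eta> \<le> liminf ?M"
      by (intro Liminf_bounded) (auto simp: eventually_sequentially)
    then show False using lim \<eta> by simp
  qed
  then obtain k where k: "k \<ge> k0" "?M k < ennreal \<eta>" by blast
  have "\<exists>F. (\<forall>v. 0 \<le> F v) \<and> (\<Sum>u\<in>{u. ht u = ht w + k}. F u powr p) \<le> e \<and>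
    crossed w k F" for w
  proof -
    let ?m = "ht w + k"
    have "Modulus p (verts ?m) (E ?m) (inn k w) (out k w) \<le> ?M k"
      unfolding net_modulus_def by (rule SUP_upper) simp
    then have "Modulus p (verts ?m) (E ?m) (inn k w) (out k w) < ennreal \<eta>" using k(2) by (rule le_less_trans)
    then obtain f where f: "admissible k w f" "(\<Sum>\<^sub>\<infinity>x\<in>verts ?m. ennreal (f x powr p)) < ennreal \<eta>"
      unfolding Modulus_def INF_less_iff admissible_def by blast
    have "(\<Sum>\<^sub>\<infinity>x\<in>verts ?m. ennreal (f x powr p)) = ennreal (\<Sum>x\<in>verts ?m. f x powr p)"
      by (simp add: infsum_finite[OF finite_verts] sum_ennreal)
    then have fs: "(\<Sum>x\<in>verts ?m. f x powr p) \<le> \<eta>"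
      using f(2) \<eta> by (simp add: ennreal_less_iff sum_nonneg)
    have f0: "0 \<le> f x" if "x \<in> verts ?m" for x using f(1) that by (simp add: admissible_def)
    define F where "F v = (if ht v = ?m then \<Sum>x\<in>Om ?m v. f x else 0)" for v
    have F0: "0 \<le> F v" for v
      using f0 Om_verts by (auto simp: F_def intro!: sum_nonneg)
    have "(\<Sum>u\<in>{u. ht u = ?m}. F u powr p) = (\<Sum>u\<in>{u. ht u = ?m}. (\<Sum>x\<in>Om ?m u. f x) powr p)"
      by (rule sum.cong) (auto simp: F_def)
    also have "\<dots> \<le> C * (\<Sum>x\<in>verts ?m. f x powr p)" unfolding C_def by (rule transfer_sum[OF f0 p])
    also have "\<dots> \<le> C * \<eta>" using fs C by (intro mult_left_mono) auto
    also have "\<dots> = e" using C by (simp add: \<eta>_def)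
    finally have Fs: "(\<Sum>u\<in>{u. ht u = ?m}. F u powr p) \<le> e" .
    have "1 \<le> (\<Sum>u\<in>set us. F u)"
      if us: "us \<noteq> []" "\<forall>u\<in>set us. ht u = ?m" "successively (\<lambda>u v. (u,v) \<in> adj) us"
        "anc (ht w) (hd us) = w" "(w, anc (ht w) (last us)) \<notin> adj ^^ N2" for us
    proof -
      have "1 \<le> (\<Sum>u\<in>set us. \<Sum>x\<in>Om ?m u. f x)" by (rule transfer_cross[OF f(1) us])
      also have "\<dots> = (\<Sum>u\<in>set us. F u)" by (rule sum.cong) (use us(2) in \<open>auto simp: F_def\<close>)
      finally show ?thesis .
    qed
    with F0 Fs show ?thesis by (intro exI[of _ F] conjI allI impI) blast+
  qed
  with k(1) show ?thesis by (intro exI[of _ k] conjI allI)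
qed

lemma sep_N2: "\<lbrakk>ht u = ht v; x \<in> K v; y \<in> K u; d x y < c3 * r ^ ht v\<rbrakk> \<Longrightarrow> (v,u) \<in> adj ^^ N2"
  using pow_mono[OF sep, of u v x y N2] N2_ge by simp

text \<open>The skipped levels are filled in by ancestors: since \<open>j \<le> j * k\<close>, the
  cell \<open>\<omega> j\<close> is deep enough to have an ancestor at height \<open>j\<close>, and
  these ancestors form a ray of the tree.\<close>

lemma ray_meets:
  assumes k: "1 \<le> k" and \<omega>: "\<And>n. ht (\<omega> n) = n * k" "\<And>n. (pa ^^ k) (\<omega> (Suc n)) = \<omega> n"
  shows "\<exists>x. \<forall>n. x \<in> K (\<omega> n)"
proof -
  have step: "anc (n * k) (\<omega> (n + i)) = \<omega> n" for n i
  proof (induction i)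
    case 0
    then show ?case using \<omega>(1)[of n] by (metis add_0_right anc_self)
  next
    case (Suc i)
    have "anc ((n + i) * k) (\<omega> (n + Suc i)) = \<omega> (n + i)"
      using \<omega>(1)[of "n + Suc i"] \<omega>(2)[of "n + i"] by (simp add: anc_def)
    moreover have "anc (n * k) (anc ((n + i) * k) (\<omega> (n + Suc i))) = anc (n * k) (\<omega> (n + Suc i))"
      using \<omega>(1)[of "n + Suc i"] by (intro anc_anc) (auto simp: algebra_simps)
    ultimately show ?case using Suc by simp
  qed
  have le: "j \<le> j * k" for j using k by simp
  define \<sigma> where "\<sigma> j = anc j (\<omega> j)" for j
  have h: "ht (\<sigma> j) = j" for j
    unfolding \<sigma>_def by (rule anc_ht) (use \<omega>(1) le in simp)
  have "\<sigma> \<in> rays A \<phi>"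
  proof (rule ray_iff)
    show "\<sigma> 0 = \<phi>" using h[of 0] by (simp add: ht_0)
    show "ht (\<sigma> n) = n" for n by (rule h)
    fix n
    have hS: "ht (\<omega> (Suc n)) = Suc n * k" by (rule \<omega>(1))
    have "Suc n \<le> ht (\<omega> (Suc n))" using hS le[of "Suc n"] by simp
    then have "pa (\<sigma> (Suc n)) = anc n (\<omega> (Suc n))" unfolding \<sigma>_def by (intro par_anc) auto
    also have "\<dots> = anc n (anc (n * k) (\<omega> (Suc n)))"
      by (rule anc_anc[symmetric]) (use hS le in auto)
    also have "anc (n * k) (\<omega> (Suc n)) = \<omega> n" using step[of n 1] by simp
    finally show "pa (\<sigma> (Suc n)) = \<sigma> n" by (simp add: \<sigma>_def)
  qed
  then have "\<exists>x. (\<Inter>m. K (\<sigma> m)) = {x}" using part unfolding tree_partition_def by blast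
  then obtain x where x: "(\<Inter>m. K (\<sigma> m)) = {x}" by blast
  have "x \<in> K (\<omega> n)" for n
  proof -
    have "\<sigma> (n * k) = \<omega> n"
    proof -
      obtain i where i: "n * k = n + i" using le[of n] le_Suc_ex by blast
      show ?thesis unfolding \<sigma>_def using step[of n i] i by metis
    qed
    moreover have "x \<in> K (\<sigma> (n * k))" using x by blast
    ultimately show ?thesis by simp
  qed
  then show ?thesis by blast
qed

lemma dim_AR_le_lower:
  assumes p: "0 < p" and lim: "liminf (\<lambda>k. modulus p k) = 0"
  shows "dim_AR S d \<le> ereal p"
proof -
  obtain B :: nat where B: "\<And>w i. finite (offspring w i) \<and>
    card (offspring w i) \<le> B ^ i" using card_below by blast
  define g0 where "g0 = (2 * real L) ^ (8 * N2 + 4)"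
  define Q where "Q = real L ^ (N2 + 1)"
  have g0: "0 < g0" and Q: "0 < Q" using L_ge by (auto simp: g0_def Q_def)
  \<comment> \<open>The bound 1 in the crossing condition has to be raised to \<open>Q\<close>,
    which costs \<open>Q powr p\<close> in the energy. Energy and floor each get
    \<open>1 / (8 * g0)\<close>, half of what \<open>G_sum\<close> allows.\<close>
  define e where "e = 1 / (8 * g0 * Q powr p)"
  have e: "0 < e" using g0 Q by (simp add: e_def)
  obtain ka where ka: "\<And>k w. k \<ge> ka \<Longrightarrow> \<exists>v. ht v = ht w + k \<and> anc (ht w) v = w \<and>
    (\<forall>v'. (v,v') \<in> adj \<longrightarrow> anc (ht w) v' = w)" using interior_cells by blast
  obtain kb where kb: "\<forall>k\<ge>kb. \<forall>w. \<exists>v v'. v \<noteq> v' \<and> ht v = ht w + k \<and> anc (ht w) v = w \<and>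
    ht v' = ht w + k \<and> anc (ht w) v' = w" using two_cells by (rule exE)
  \<comment> \<open>For such \<open>k\<close>, cells joined by \<open>4 * N2\<close> steps are
    closer than \<open>c3\<close> times the scale \<open>k\<close> levels higher, so
    \<open>sep_N2\<close> applies to their ancestors; this is \<open>hop\<close>.\<close>
  obtain kc where kc: "\<And>k. k \<ge> kc \<Longrightarrow> (real (4 * N2) + 1) * c2 * r ^ k < c3"
    using small_r[OF c3_pos] by blast
  obtain k where k0: "k \<ge> Max {1, ka, kb, kc}" and kF: "\<forall>w. \<exists>F. (\<forall>v. 0 \<le> F v) \<and>
    (\<Sum>u\<in>{u. ht u = ht w + k}. F u powr p) \<le> e \<and>
    crossed w k F"
    using crossing_functions[OF p lim e, of "Max {1, ka, kb, kc}"] by (elim exE conjE)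
  have k: "1 \<le> k" "ka \<le> k" "kb \<le> k" "kc \<le> k" using k0 by auto
  from choice[OF kF] obtain F where F: "\<forall>w. (\<forall>v. 0 \<le> F w v) \<and>
    (\<Sum>u\<in>{u. ht u = ht w + k}. F w u powr p) \<le> e \<and>
    crossed w k (F w)"
    by (rule exE)
  have F0: "0 \<le> F w v" and Fsum: "(\<Sum>u\<in>{u. ht u = ht w + k}. F w u powr p) \<le> e" for w v
    using F by blast+
  have Fcross: "1 \<le> (\<Sum>u\<in>set us. F w u)"
    if "us \<noteq> []" "\<forall>u\<in>set us. ht u = ht w + k" "successively (\<lambda>u v. (u,v) \<in> adj) us"
      "anc (ht w) (hd us) = w" "(w, anc (ht w) (last us)) \<notin> adj ^^ N2" for us w
    using F[rule_format, of w] that by blast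
  define a where "a = 1 / (8 * g0 * (real B ^ k + 1))"
  have Bk: "0 < real B ^ k + 1" by (simp add: add_nonneg_pos)
  have a: "0 < a" using g0 Bk by (simp add: a_def)
  \<comment> \<open>The first summand is cut off to have the required support; the chains in
    \<open>G_cross\<close> stay inside it. The second one provides the floor, and the bound
    \<open>B ^ k\<close> on the number of descendants keeps its total small.\<close>
  define G where "G w u = (if ht u = ht w + k \<and> (w, anc (ht w) u) \<in> adj ^^ (N2 + 1) then (Q * F w u) powr p else 0)
    + (if ht u = ht w + k \<and> anc (ht w) u = w then a else 0)" for w u

  interpret H: hierarchy "thin k" "\<lambda>v. ht v div k" "pa ^^ k" K S by (rule thin_hierarchy[OF k(1)])
  have HV: "H.V n = V (n * k)" for n by (rule thin_V[OF k(1)])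
  have HVi: "v \<in> H.V n \<longleftrightarrow> ht v = n * k" for v n by (simp add: HV V_ht)
  have HC: "v \<in> thin k \<longleftrightarrow> k dvd ht v" for v by (simp add: thin_def[OF k(1)])
  have Hadj: "H.adj = {(v,v') \<in> adj. k dvd ht v}" by (rule thin_adj[OF k(1)])
  have Hpow: "(v,u) \<in> H.adj ^^ i \<longleftrightarrow> (v,u) \<in> adj ^^ i" if "ht v = n * k" for v u i n
    by (rule thin_adj_pow[OF k(1)]) (simp add: that)
  have Hpa: "(pa ^^ k) u = anc (n * k) u" if "ht u = Suc n * k" for u n
    using that by (simp add: anc_def)

  interpret H: measured_hierarchy "thin k" "\<lambda>v. ht v div k" "pa ^^ k" K S L N2 G p a \<phi> d "r ^ k" c2 c3
  proof unfold_locales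
    show "card (H.adj `` {v}) \<le> L" if "v \<in> thin k" for v
    proof -
      have "H.adj `` {v} \<subseteq> adj `` {v}" by (auto simp: Hadj)
      then have "card (H.adj `` {v}) \<le> card (adj `` {v})"
        by (rule card_mono[rotated]) (use finite_pow[of v 1] in simp)
      then show ?thesis using card_adj'[of v] by linarith
    qed
    show "1 \<le> N2" using M_pos N2_ge by linarith
    show "0 < p" by (rule p)
    show "0 < a" by (rule a)
    show "((pa ^^ k) u, (pa ^^ k) v) \<in> H.adj ^^ N2"
      if u: "u \<in> H.V (Suc n)" and uv: "(u, v) \<in> H.adj ^^ (4 * N2)" for n u v
    proof -
      have hu: "ht u = Suc n * k" using u HVi by simp
      have uv': "(u,v) \<in> adj ^^ (4 * N2)" using Hpow[OF hu] uv by simp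
      have hv: "ht v = Suc n * k" using pow_ht[OF uv'] hu by simp
      obtain x y where xy: "x \<in> K u" "y \<in> K v" using K_ne[of u] K_ne[of v] by auto
      have "d x y \<le> (real (4 * N2) + 1) * c2 * r ^ ht u" by (rule pow_dist[OF uv' xy])
      also have "\<dots> = r ^ (n * k) * ((real (4 * N2) + 1) * c2 * r ^ k)" by (simp add: hu power_add mult_ac)
      also have "\<dots> < r ^ (n * k) * c3" using kc[OF k(4)] r by (intro mult_strict_left_mono) auto
      finally have less: "d x y < c3 * r ^ (n * k)" by (simp add: mult.commute)
      have le: "n * k \<le> ht u" "n * k \<le> ht v" using hu hv by auto
      have ha: "ht (anc (n * k) u) = n * k" "ht (anc (n * k) v) = n * k" using anc_ht le by auto
      have "(anc (n * k) u, anc (n * k) v) \<in> adj ^^ N2"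
      proof (rule sep_N2)
        show "x \<in> K (anc (n * k) u)" "y \<in> K (anc (n * k) v)" using K_anc le xy by blast+
      qed (use ha less in auto)
      then show ?thesis using Hpow[OF ha(1)] Hpa[OF hu] Hpa[OF hv] by simp
    qed
    show "0 \<le> G w u" for w u using a by (simp add: G_def)
    show "(w, (pa ^^ k) u) \<in> H.adj ^^ (N2 + 1)"
      if w: "w \<in> H.V n" and u: "u \<in> H.V (Suc n)" and ne: "G w u \<noteq> 0" for n w u
    proof -
      have hw: "ht w = n * k" and hu: "ht u = Suc n * k" using w u HVi by auto
      have "(w, anc (n * k) u) \<in> adj ^^ (N2 + 1)"
      proof (cases "anc (n * k) u = w")
        case True
        then show ?thesis using adj_pow_refl[of w "N2 + 1"] by simp
      next
        case False
        then have "\<not> (ht u = ht w + k \<and> anc (ht w) u = w)" using hw by simp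
        then have "(ht u = ht w + k \<and> (w, anc (ht w) u) \<in> adj ^^ (N2 + 1))"
          using ne unfolding G_def by (simp split: if_splits)
        then show ?thesis using hw by simp
      qed
      then show ?thesis unfolding Hpow[OF hw] Hpa[OF hu] .
    qed
    show "a \<le> G w u" if w: "w \<in> H.V n" and u: "u \<in> H.V (Suc n)" and pu: "(pa ^^ k) u = w" for n w u
    proof -
      have hw: "ht w = n * k" and hu: "ht u = Suc n * k" using w u HVi by auto
      then have "ht u = ht w + k \<and> anc (ht w) u = w" using pu Hpa[OF hu] by simp
      then show ?thesis unfolding G_def by simp
    qed
    show "4 * (2 * real L) ^ (8 * N2 + 4) * sum (G w) (H.V (Suc n)) \<le> 1" if w: "w \<in> H.V n" for n w
    proof -
      have hw: "ht w = n * k" using w HVi by simp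
      let ?A = "{u. ht u = ht w + k}"
      have HA: "H.V (Suc n) = ?A" using hw HVi by auto
      have "sum (G w) ?A \<le> (\<Sum>u\<in>?A. (Q * F w u) powr p + (if ht u = ht w + k \<and> anc (ht w) u = w then a else 0))"
        unfolding G_def by (intro sum_mono) auto
      also have "\<dots> = (\<Sum>u\<in>?A. (Q * F w u) powr p) + (\<Sum>u\<in>?A. if ht u = ht w + k \<and> anc (ht w) u = w then a else 0)"
        by (rule sum.distrib)
      also have "(\<Sum>u\<in>?A. (Q * F w u) powr p) = Q powr p * (\<Sum>u\<in>?A. F w u powr p)"
        using Q F0 by (simp add: powr_mult sum_distrib_left)
      also have "(\<Sum>u\<in>?A. if ht u = ht w + k \<and> anc (ht w) u = w then a else 0)
        = (\<Sum>u\<in>{u \<in> ?A. ht u = ht w + k \<and> anc (ht w) u = w}. a)"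
        by (rule sum.inter_filter[symmetric]) (rule finite_ht)
      also have "\<dots> = real (card (offspring w k)) * a"
        by (simp add: conj_assoc[symmetric])
      finally have "sum (G w) ?A \<le> Q powr p * (\<Sum>u\<in>?A. F w u powr p)
        + real (card (offspring w k)) * a" .
      also have "\<dots> \<le> Q powr p * e + (real B ^ k + 1) * a"
      proof (intro add_mono mult_left_mono mult_right_mono)
        have "real (card (offspring w k)) \<le> real (B ^ k)"
          using B by (simp only: of_nat_le_iff)
        then show "real (card (offspring w k)) \<le> real B ^ k + 1"
          unfolding of_nat_power by linarith
      qed (use Fsum a in auto)
      also have "Q powr p * e = 1 / (8 * g0)" using Q by (simp add: e_def)
      also have "(real B ^ k + 1) * a = 1 / (8 * g0)" using Bk by (simp add: a_def)
      finally have "sum (G w) ?A \<le> 1 / (4 * g0)" by simp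
      then have "4 * g0 * sum (G w) ?A \<le> 1" using g0 by (simp add: field_simps)
      then show ?thesis unfolding HA g0_def .
    qed
    show "real L ^ (N2 + 1) \<le> (\<Sum>u\<in>set us. G w u powr (1 / p))"
      if w: "w \<in> H.V n" and us: "us \<noteq> []" "set us \<subseteq> H.V (Suc n)" "successively (\<lambda>u v. (u,v) \<in> H.adj) us"
        and near: "\<forall>u\<in>set us. (w, (pa ^^ k) u) \<in> H.adj ^^ (N2 + 1)"
        and hd: "(pa ^^ k) (hd us) = w" and last: "(w, (pa ^^ k) (last us)) \<notin> H.adj ^^ N2" for n w us
    proof -
      have hw: "ht w = n * k" using w HVi by simp
      have hus: "ht u = Suc n * k" if "u \<in> set us" for u using us(2) that HVi by blast
      have hts: "ht u = ht w + k" if "u \<in> set us" for u using hus[OF that] hw by simp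
      have hl: "hd us \<in> set us" "last us \<in> set us" using us(1) by auto
      have near': "(w, anc (ht w) u) \<in> adj ^^ (N2 + 1)" if "u \<in> set us" for u
        using near that unfolding Hpow[OF hw] hw Hpa[OF hus[OF that], symmetric] by blast
      have "1 \<le> (\<Sum>u\<in>set us. F w u)"
      proof (rule Fcross)
        show "successively (\<lambda>u v. (u,v) \<in> adj) us" by (rule successively_mono[OF us(3)]) (auto simp: Hadj)
        show "anc (ht w) (hd us) = w" using hd Hpa[OF hus[OF hl(1)]] hw by simp
        show "(w, anc (ht w) (last us)) \<notin> adj ^^ N2"
          using last Hpow[OF hw] Hpa[OF hus[OF hl(2)]] hw by simp
        show "\<forall>u\<in>set us. ht u = ht w + k" using hts by blast
      qed (rule us(1))
      then have "Q * 1 \<le> Q * (\<Sum>u\<in>set us. F w u)" using Q by (intro mult_left_mono) auto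
      also have "\<dots> = (\<Sum>u\<in>set us. Q * F w u)" by (rule sum_distrib_left)
      also have "\<dots> \<le> (\<Sum>u\<in>set us. G w u powr (1 / p))"
      proof (rule sum_mono)
        fix u assume u: "u \<in> set us"
        have nn: "0 \<le> Q * F w u" using Q F0[of w u] by simp
        have "(Q * F w u) powr p \<le> G w u" using near'[OF u] hts[OF u] a unfolding G_def by simp
        then have "((Q * F w u) powr p) powr (1 / p) \<le> G w u powr (1 / p)"
          using p by (intro powr_mono2) auto
        then show "Q * F w u \<le> G w u powr (1 / p)" using nn p by (simp add: powr_powr)
      qed
      finally show ?thesis by (simp add: Q_def)
    qed
    show "thin k \<noteq> {}" using HC[of \<phi>] ht_root by auto
    show "H.V 0 = {\<phi>}" by (auto simp: HVi ht_0)
    show "\<exists>v\<in>H.V (Suc n). (pa ^^ k) v = w \<and> (\<forall>v'. (v, v') \<in> H.adj \<longrightarrow> (pa ^^ k) v' = w)"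
      if w: "w \<in> H.V n" for n w
    proof -
      have hw: "ht w = n * k" using w HVi by simp
      obtain v where v: "ht v = ht w + k" "anc (ht w) v = w" "\<forall>v'. (v,v') \<in> adj \<longrightarrow> anc (ht w) v' = w"
        using ka[OF k(2), of w] by blast
      have hv: "ht v = Suc n * k" using v(1) hw by simp
      have "(pa ^^ k) v' = w" if "(v,v') \<in> H.adj" for v'
      proof -
        have a': "(v,v') \<in> adj" using that by (auto simp: Hadj)
        have "ht v' = Suc n * k" using adj_D[OF a'] hv by simp
        then have "(pa ^^ k) v' = anc (n * k) v'" by (rule Hpa)
        moreover have "anc (ht w) v' = w" using v(3) a' by blast
        ultimately show ?thesis using hw by simp
      qed
      moreover have "(pa ^^ k) v = w" using Hpa[OF hv] v(2) hw by simp
      ultimately show ?thesis using HVi hv by blast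
    qed
    show "\<exists>v\<in>H.V (Suc n). \<exists>v'\<in>H.V (Suc n). v \<noteq> v' \<and> (pa ^^ k) v = w \<and> (pa ^^ k) v' = w"
      if w: "w \<in> H.V n" for n w
    proof -
      have hw: "ht w = n * k" using w HVi by simp
      obtain v v' where v: "v \<noteq> v'" "ht v = ht w + k" "anc (ht w) v = w" "ht v' = ht w + k" "anc (ht w) v' = w"
        using kb k(3) by blast
      have hv: "ht v = Suc n * k" "ht v' = Suc n * k" using v hw by auto
      have "(pa ^^ k) v = w" "(pa ^^ k) v' = w" using Hpa[OF hv(1)] Hpa[OF hv(2)] v hw by auto
      then show ?thesis using v(1) hv HVi by blast
    qed
    show "0 < r ^ k" "r ^ k < 1" using r k(1) by (auto simp: power_less_one_iff)
    show "0 < c2" "0 < c3" by (rule c2_pos, rule c3_pos)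
    show "d x y \<le> c2 * (r ^ k) ^ n" if "w \<in> H.V n" "x \<in> K w" "y \<in> K w" for n w x y
      using d_le[OF that(2,3)] that(1) HVi by (simp add: power_mult[symmetric] mult.commute)
    show "(v, u) \<in> H.adj ^^ N2"
      if "v \<in> H.V n" "u \<in> H.V n" "x \<in> K v" "y \<in> K u" "d x y < c3 * (r ^ k) ^ n" for v n u x y
    proof -
      have h: "ht v = n * k" "ht u = n * k" using that HVi by auto
      have "d x y < c3 * r ^ ht v" using that(5) h by (simp add: power_mult[symmetric] mult.commute)
      then have "(v,u) \<in> adj ^^ N2" using sep_N2[of u v x y] h that by simp
      then show ?thesis using Hpow[OF h(1)] by simp
    qed
    show "\<exists>x. \<forall>n. x \<in> K (\<omega> n)" if "\<And>n. \<omega> n \<in> H.V n" "\<And>n. (pa ^^ k) (\<omega> (Suc n)) = \<omega> n" for \<omega>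
    proof (rule ray_meets[of k \<omega>, OF k(1)])
      show "ht (\<omega> n) = n * k" for n using that(1) HVi by blast
      show "(pa ^^ k) (\<omega> (Suc n)) = \<omega> n" for n by (rule that(2))
    qed
  qed (use d_metric in \<open>auto simp: Metric_space_def\<close>)
  show ?thesis by (rule H.dim_AR_le)
qed

end


section \<open>Ahlfors regular metrics bound the moduli\<close>

text \<open>The sum of the indicators is at most \<open>c\<close> on \<open>U\<close> and vanishes
  elsewhere; integration gives the bound.\<close>

lemma sum_emeasure_overlap:
  fixes c :: nat
  assumes "finite W" "\<And>v. v \<in> W \<Longrightarrow> B v \<in> sets \<nu>" "U \<in> sets \<nu>" "\<And>v. v \<in> W \<Longrightarrow> B v \<subseteq> U"
    and "\<And>x. x \<in> U \<Longrightarrow> card {v \<in> W. x \<in> B v} \<le> c"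
  shows "(\<Sum>v\<in>W. emeasure \<nu> (B v)) \<le> of_nat c * emeasure \<nu> U"
proof -
  have "(\<Sum>v\<in>W. emeasure \<nu> (B v)) = (\<Sum>v\<in>W. \<integral>\<^sup>+x. indicator (B v) x \<partial>\<nu>)"
    using assms(2) by (intro sum.cong) auto
  also have "\<dots> = (\<integral>\<^sup>+x. (\<Sum>v\<in>W. indicator (B v) x) \<partial>\<nu>)"
    by (rule nn_integral_sum[symmetric]) (use assms(2) in auto)
  also have "\<dots> \<le> (\<integral>\<^sup>+x. of_nat c * indicator U x \<partial>\<nu>)"
  proof (rule nn_integral_mono)
    fix x
    have "(\<Sum>v\<in>W. indicator (B v) x :: ennreal) = of_nat (card {v \<in> W. x \<in> B v})"
      using assms(1) by (simp add: indicator_def sum.If_cases Int_def)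
    also have "\<dots> \<le> of_nat c * indicator U x"
    proof (cases "x \<in> U")
      case True
      then show ?thesis using assms(5)[OF True] by simp
    next
      case False
      then have e: "{v \<in> W. x \<in> B v} = {}" using assms(4) by blast
      show ?thesis unfolding e by simp
    qed
    finally show "(\<Sum>v\<in>W. indicator (B v) x :: ennreal) \<le> of_nat c * indicator U x" .
  qed
  also have "\<dots> = of_nat c * emeasure \<nu> U" using assms(3) by (simp add: nn_integral_cmult)
  finally show ?thesis .
qed

locale ahlfors_network = network A \<phi> X K d M r c1 c2 L c3 Am Vm E N L0 L1 L2 N1 N2
  for A :: "'t \<Rightarrow> 't \<Rightarrow> bool" and \<phi> :: 't and X :: "'x topology" and K d M r c1 c2 L c3 Am Vm E N L0 L1 L2 N1 N2 +
  fixes \<rho> :: "'x \<Rightarrow> 'x \<Rightarrow> real" and \<mu> :: "'x measure" and \<alpha> C1 C2 :: real and h h' :: "real \<Rightarrow> real"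
  assumes rho: "Metric_space (topspace X) \<rho>"
    and homeo: "homeomorphism {0..} {0..} h h'" and h0: "h 0 = 0"
    and qs: "\<lbrakk>0 < t; x \<in> topspace X; y \<in> topspace X; z \<in> topspace X; d x z < t * d x y\<rbrakk> \<Longrightarrow> \<rho> x z < h t * \<rho> x y"
    and borel: "borel_regular (Metric_space.mtopology (topspace X) \<rho>) \<mu>"
    and \<alpha>_pos: "0 < \<alpha>" and C1_pos: "0 < C1" and C2_pos: "0 < C2"
    and regular: "\<lbrakk>x \<in> topspace X; s \<in> {0..mdiam \<rho> (topspace X)}\<rbrakk> \<Longrightarrow>
        ennreal (C1 * s powr \<alpha>) \<le> emeasure \<mu> (Metric_space.mball (topspace X) \<rho> x s) \<and>
        emeasure \<mu> (Metric_space.mball (topspace X) \<rho> x s) \<le> ennreal (C2 * s powr \<alpha>)"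
begin

abbreviation "mb \<equiv> Metric_space.mball S \<rho>"

lemma mb_iff: "y \<in> mb x s \<longleftrightarrow> x \<in> S \<and> y \<in> S \<and> \<rho> x y < s"
  by (rule Metric_space.in_mball[OF rho])

lemma rho_nn: "0 \<le> \<rho> x y" by (rule Metric_space.nonneg[OF rho])
lemma rho_comm: "\<rho> x y = \<rho> y x" by (rule Metric_space.commute[OF rho])
lemma rho_tri: "x \<in> S \<Longrightarrow> y \<in> S \<Longrightarrow> z \<in> S \<Longrightarrow> \<rho> x z \<le> \<rho> x y + \<rho> y z"
  by (rule Metric_space.triangle[OF rho])
lemma d_comm: "d x y = d y x" by (rule Metric_space.commute[OF d_metric])
lemma d_tri: "x \<in> S \<Longrightarrow> y \<in> S \<Longrightarrow> z \<in> S \<Longrightarrow> d x z \<le> d x y + d y z"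
  by (rule Metric_space.triangle[OF d_metric])

lemma mb_sets: "mb x s \<in> sets \<mu>"
proof -
  have "openin (Metric_space.mtopology S \<rho>) (mb x s)" by (rule Metric_space.openin_mball[OF rho])
  then show ?thesis using borel unfolding borel_regular_def by (auto intro: sigma_sets.Basic)
qed

lemma S_sets: "S \<in> sets \<mu>" "space \<mu> = S"
  using borel sets.top[of \<mu>] unfolding borel_regular_def Metric_space.topspace_mtopology[OF rho] by auto

lemma h_nonneg: "0 \<le> t \<Longrightarrow> 0 \<le> h t"
  using homeo unfolding homeomorphism_def by auto

lemma h_small: assumes "0 < e" obtains t where "0 < t" "h t < e"
proof -
  have "continuous_on {0..} h" using homeo by (simp add: homeomorphism_def)
  then obtain b where b: "0 < b" "\<And>x. x \<in> {0..} \<Longrightarrow> dist x 0 < b \<Longrightarrow> dist (h x) (h 0) < e"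
    using assms unfolding continuous_on_iff by (metis atLeast_iff order_refl)
  have "dist (h (b/2)) (h 0) < e" using b by (intro b(2)) auto
  then have "\<bar>h (b/2)\<bar> < e" using h0 by (simp add: dist_real_def)
  then show ?thesis using that[of "b/2"] b(1) by linarith
qed

lemma qs_le:
  assumes "x \<in> S" "y \<in> S" "z \<in> S" "0 < T" "0 < d x y" "d x z \<le> T * d x y"
  shows "\<rho> x z \<le> h (2 * T) * \<rho> x y"
proof -
  have "T * d x y < 2 * T * d x y" using assms by simp
  then have "d x z < 2 * T * d x y" using assms by linarith
  then show ?thesis using qs[of "2 * T" x y z] assms by simp
qed

text \<open>Quasisymmetry compares distances from a common point. A pair of points in
  \<open>K v\<close> whose \<open>d\<close>-distance is of the order of the scale thus serves as a
  gauge: \<open>s v\<close> replaces the diameter of \<open>K v\<close> in \<open>\<rho>\<close>, to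
  which it is comparable by \<open>near_rho\<close>.\<close>

definition xx :: "'t \<Rightarrow> 'x" where
  "xx v = (SOME x. x \<in> K v \<and> (\<exists>y\<in>K v. c1 / 2 * r ^ ht v < d x y))"
definition yy :: "'t \<Rightarrow> 'x" where "yy v = (SOME y. y \<in> K v \<and> c1 / 2 * r ^ ht v < d (xx v) y)"
definition s :: "'t \<Rightarrow> real" where "s v = \<rho> (xx v) (yy v)"

lemma xx_yy: "xx v \<in> K v" "yy v \<in> K v" "c1 / 2 * r ^ ht v < d (xx v) (yy v)"
proof -
  have "0 < c1 * r ^ ht v" using c1_pos r by simp
  then have "c1 / 2 * r ^ ht v < g v" using g_lower[of v] by linarith
  then have ex: "\<exists>x. x \<in> K v \<and> (\<exists>y\<in>K v. c1 / 2 * r ^ ht v < d x y)" using g_witness by blast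
  have x: "xx v \<in> K v \<and> (\<exists>y\<in>K v. c1 / 2 * r ^ ht v < d (xx v) y)"
    unfolding xx_def by (rule someI_ex[OF ex])
  then have ey: "\<exists>y. y \<in> K v \<and> c1 / 2 * r ^ ht v < d (xx v) y" by blast
  have y: "yy v \<in> K v \<and> c1 / 2 * r ^ ht v < d (xx v) (yy v)"
    unfolding yy_def by (rule someI_ex[OF ey])
  show "xx v \<in> K v" "yy v \<in> K v" "c1 / 2 * r ^ ht v < d (xx v) (yy v)" using x y by auto
qed

lemma xx_S: "xx v \<in> S" and yy_S: "yy v \<in> S" using xx_yy K_S by blast+

lemma rn_pos: "0 < r ^ n" using r by simp

lemma d_xy_pos: "0 < d (xx v) (yy v)"
  using xx_yy(3)[of v] c1_pos rn_pos[of "ht v"] by (meson half_gt_zero less_trans mult_pos_pos)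

lemma s_pos: "0 < s v"
proof -
  have "xx v \<noteq> yy v" using d_xy_pos[of v] Metric_space.mdist_zero[OF d_metric xx_S[of v]] by force
  then show ?thesis unfolding s_def by (intro Metric_space.mdist_pos_less[OF rho] xx_S yy_S)
qed

lemma near_rho:
  assumes "z \<in> S" "0 < C" "d (xx v) z \<le> C * r ^ ht v"
  shows "\<rho> (xx v) z \<le> h (4 * C / c1) * s v"
proof -
  have "C * r ^ ht v = (2 * C / c1) * (c1 / 2 * r ^ ht v)" using c1_pos by simp
  also have "\<dots> \<le> (2 * C / c1) * d (xx v) (yy v)"
    using xx_yy(3)[of v] assms c1_pos by (intro mult_left_mono) auto
  finally have "d (xx v) z \<le> (2 * C / c1) * d (xx v) (yy v)" using assms by linarith
  then have "\<rho> (xx v) z \<le> h (2 * (2 * C / c1)) * \<rho> (xx v) (yy v)"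
    using assms c1_pos d_xy_pos by (intro qs_le xx_S yy_S) auto
  then show ?thesis by (simp add: s_def)
qed

lemma far_point:
  assumes "x \<in> S" obtains q where "q \<in> {xx w, yy w}" "c1 / 4 * r ^ ht w < d x q"
proof -
  have "d (xx w) (yy w) \<le> d x (xx w) + d x (yy w)"
    using d_tri[OF xx_S assms yy_S] d_comm by metis
  moreover have "c1 / 2 * r ^ ht w = 2 * (c1 / 4 * r ^ ht w)" by simp
  ultimately have "c1 / 4 * r ^ ht w < d x (xx w) \<or> c1 / 4 * r ^ ht w < d x (yy w)"
    using xx_yy(3)[of w] by linarith
  then show ?thesis using that by blast
qed

text \<open>Wherever \<open>xx v\<close> lies, one of the two gauge points of \<open>w\<close> is
  far from it by \<open>far_point\<close>, while \<open>K v\<close> is small compared with the scale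
  of \<open>w\<close>.\<close>

lemma shrink:
  assumes "0 < t" "c2 * r ^ k < t * (c1 / 4)" "ht v = ht w + k" "z \<in> K v"
  obtains q where "q \<in> {xx w, yy w}" "\<rho> (xx v) z < h t * \<rho> (xx v) q"
proof -
  obtain q where q: "q \<in> {xx w, yy w}" "c1 / 4 * r ^ ht w < d (xx v) q" using far_point[OF xx_S] .
  have qS: "q \<in> S" using q xx_S yy_S by auto
  have "d (xx v) z \<le> r ^ ht w * (c2 * r ^ k)"
    using d_le[OF xx_yy(1) assms(4)] assms(3) by (simp add: power_add mult_ac)
  also have "\<dots> \<le> r ^ ht w * (t * (c1 / 4))" using assms(2) less_imp_le[OF rn_pos[of "ht w"]]
    by (intro mult_left_mono) auto
  also have "\<dots> = t * (c1 / 4 * r ^ ht w)" by simp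
  also have "\<dots> < t * d (xx v) q" using q assms by (intro mult_strict_left_mono) auto
  finally show ?thesis using qs[OF assms(1) xx_S qS, of z] K_S assms(4) that q by blast
qed

lemma t0_ex: "\<exists>t. 0 < t \<and> h t \<le> 1" using h_small[of 1] by (metis less_imp_le zero_less_one)

definition t0 :: real where "t0 = (SOME t. 0 < t \<and> h t \<le> 1)"

lemma t0: "0 < t0" "h t0 \<le> 1" using someI_ex[OF t0_ex] by (auto simp: t0_def)

text \<open>If \<open>z\<close> were farther away in \<open>d\<close>, quasisymmetry with
  \<open>h t0 \<le> 1\<close> would make the gauge \<open>s v\<close> smaller than the distance of
  \<open>z\<close> in \<open>\<rho>\<close>.\<close>

lemma ball_near: assumes "z \<in> mb (xx v) (s v)" shows "d (xx v) z \<le> c2 / t0 * r ^ ht v"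
proof -
  have z: "z \<in> S" "\<rho> (xx v) z < s v" using assms mb_iff by auto
  have "\<not> d (xx v) (yy v) < t0 * d (xx v) z"
  proof
    assume "d (xx v) (yy v) < t0 * d (xx v) z"
    then have "s v < h t0 * \<rho> (xx v) z" unfolding s_def by (intro qs t0 xx_S yy_S z)
    also have "\<dots> \<le> 1 * \<rho> (xx v) z" using t0 rho_nn by (intro mult_right_mono) auto
    finally show False using z by simp
  qed
  then have "t0 * d (xx v) z \<le> c2 * r ^ ht v" using d_le[OF xx_yy(1,2), of v] by linarith
  then show ?thesis using t0 by (simp add: field_simps)
qed

definition \<Delta> :: real where "\<Delta> = mdiam \<rho> S"

lemma rho_le_diam: "x \<in> S \<Longrightarrow> y \<in> S \<Longrightarrow> \<rho> x y \<le> \<Delta>"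
proof -
  assume xy: "x \<in> S" "y \<in> S"
  define H where "H = h (4 * c2 / c1) * s \<phi>"
  have H: "\<rho> (xx \<phi>) z \<le> H" if "z \<in> S" for z
    unfolding H_def using that d_le[OF xx_yy(1), of z \<phi>] K_phi c2_pos by (intro near_rho) auto
  have "\<rho> u v \<le> 2 * H" if "u \<in> S" "v \<in> S" for u v
    using rho_tri[OF that(1) xx_S that(2), of \<phi>] H[OF that(1)] H[OF that(2)] rho_comm[of u] by simp
  then have "bdd_above ((\<lambda>(x,y). \<rho> x y) ` (S \<times> S))" by (intro bdd_aboveI[of _ "2 * H"]) auto
  then have "\<rho> x y \<le> (SUP (x,y)\<in>S \<times> S. \<rho> x y)" 
    using cSUP_upper[of "(x,y)" "S \<times> S" "\<lambda>(x,y). \<rho> x y"] xy by auto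
  then show ?thesis using xy by (auto simp: \<Delta>_def mdiam_def)
qed

lemma s_le_diam: "s v \<le> \<Delta>" unfolding s_def by (rule rho_le_diam[OF xx_S yy_S])

lemma Delta_pos: "0 < \<Delta>" using s_pos[of \<phi>] s_le_diam[of \<phi>] by linarith

text \<open>Regularity is given for radii up to \<open>\<Delta>\<close> only, and an open ball of
  radius \<open>\<Delta>\<close> may miss points at distance exactly \<open>\<Delta>\<close>.
  Finitely many such balls, centred in the cells of a fixed level, do cover the space by
  \<open>shrink\<close> and bound its mass.\<close>

lemma mu_upper: obtains C3 :: real where "0 < C3"
  "\<And>x R. x \<in> S \<Longrightarrow> 0 < (R::real) \<Longrightarrow> emeasure \<mu> (mb x R) \<le> ennreal (C3 * R powr \<alpha>)"
proof -
  have "0 < t0 * (c1 / 4)" using t0 c1_pos by simp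
  then obtain j where j: "c2 * r ^ j < t0 * (c1 / 4)" using small_r by blast
  let ?J = "{v. ht v = j}"
  have SJ: "S \<subseteq> (\<Union>v\<in>?J. mb (xx v) \<Delta>)"
  proof
    fix z assume z: "z \<in> S"
    then obtain v where v: "v \<in> V j" "z \<in> K v" by (rule cell_at)
    then have hv: "ht v = ht \<phi> + j" by (simp add: V_ht ht_root)
    obtain q where q: "q \<in> {xx \<phi>, yy \<phi>}" "\<rho> (xx v) z < h t0 * \<rho> (xx v) q"
      using shrink[OF t0(1) j hv v(2)] .
    have "q \<in> S" using q xx_S yy_S by auto
    then have "\<rho> (xx v) q \<le> \<Delta>" using rho_le_diam[OF xx_S] by blast
    moreover have "h t0 * \<rho> (xx v) q \<le> 1 * \<rho> (xx v) q" using t0 rho_nn by (intro mult_right_mono) auto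
    ultimately have "\<rho> (xx v) z < \<Delta>" using q by linarith
    then show "z \<in> (\<Union>v\<in>?J. mb (xx v) \<Delta>)" using v z xx_S mb_iff by (auto simp: V_ht)
  qed
  define n where "n = card ?J"
  have "emeasure \<mu> S \<le> emeasure \<mu> (\<Union>v\<in>?J. mb (xx v) \<Delta>)"
    by (rule emeasure_mono[OF SJ]) (use mb_sets finite_ht in \<open>auto intro: sets.finite_UN\<close>)
  also have "\<dots> \<le> (\<Sum>v\<in>?J. emeasure \<mu> (mb (xx v) \<Delta>))"
    by (rule emeasure_subadditive_finite) (use mb_sets finite_ht in auto)
  also have "\<dots> \<le> (\<Sum>v\<in>?J. ennreal (C2 * \<Delta> powr \<alpha>))"
    using regular[OF xx_S, of \<Delta>] Delta_pos by (intro sum_mono) (auto simp: \<Delta>_def)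
  also have "\<dots> = ennreal (real n * (C2 * \<Delta> powr \<alpha>))"
    using C2_pos by (simp add: n_def ennreal_mult ennreal_of_nat_eq_real_of_nat)
  finally have muS: "emeasure \<mu> S \<le> ennreal (real n * (C2 * \<Delta> powr \<alpha>))" .
  show ?thesis
  proof (rule that[of "(real n + 1) * C2"])
    show "0 < (real n + 1) * C2" using C2_pos by simp
    fix x and R :: real assume x: "x \<in> S" and R: "0 < R"
    show "emeasure \<mu> (mb x R) \<le> ennreal ((real n + 1) * C2 * R powr \<alpha>)"
    proof (cases "R \<le> \<Delta>")
      case True
      then have "emeasure \<mu> (mb x R) \<le> ennreal (C2 * R powr \<alpha>)"
        using regular[OF x, of R] R by (auto simp: \<Delta>_def)
      also have "\<dots> \<le> ennreal ((real n + 1) * C2 * R powr \<alpha>)"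
        using C2_pos by (intro ennreal_leI mult_right_mono) auto
      finally show ?thesis .
    next
      case False
      have "emeasure \<mu> (mb x R) \<le> emeasure \<mu> S"
        by (rule emeasure_mono[OF _ S_sets(1)]) (use mb_iff in blast)
      also note muS
      also have "ennreal (real n * (C2 * \<Delta> powr \<alpha>)) \<le> ennreal ((real n + 1) * C2 * R powr \<alpha>)"
      proof (rule ennreal_leI)
        have "\<Delta> powr \<alpha> \<le> R powr \<alpha>" using False Delta_pos \<alpha>_pos by (intro powr_mono2) auto
        then have "real n * (C2 * \<Delta> powr \<alpha>) \<le> (real n + 1) * (C2 * R powr \<alpha>)"
          using C2_pos by (intro mult_mono) auto
        then show "real n * (C2 * \<Delta> powr \<alpha>) \<le> (real n + 1) * C2 * R powr \<alpha>" by (simp add: mult.assoc)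
      qed
      finally show ?thesis .
    qed
  qed
qed

abbreviation "nearby C u \<equiv> {v. ht v = ht u \<and> (\<exists>x\<in>K v. \<exists>z\<in>K u. d x z \<le> C * r ^ ht u)}"

text \<open>Going up \<open>j\<close> levels makes the distance \<open>C * r ^ ht u\<close> small
  against the scale, so by \<open>sep\<close> the ancestors are joined by \<open>M\<close> steps.
  Heights below \<open>j\<close> have boundedly many cells anyway.\<close>

lemma count_near:
  obtains c :: nat where "\<And>u. card (nearby C u) \<le> c"
proof -
  obtain B :: nat where B: "\<And>w i. finite (offspring w i) \<and>
    card (offspring w i) \<le> B ^ i" using card_below by blast
  obtain j where j: "C * r ^ j < c3" using small_r[OF c3_pos] by blast
  have "card (nearby C u) \<le> L ^ M * B ^ j + (\<Sum>i\<le>j. B ^ i)" for u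
  proof (cases "ht u < j")
    case True
    have "card (nearby C u)
      \<le> card (offspring \<phi> (ht u))"
      using B[of \<phi> "ht u"] by (intro card_mono) (auto simp: ht_root anc_0)
    also have "\<dots> \<le> B ^ ht u" using B by blast
    also have "\<dots> \<le> (\<Sum>i\<le>j. B ^ i)" using True by (intro member_le_sum) auto
    finally show ?thesis by simp
  next
    case False
    let ?n = "ht u - j" and ?u = "anc (ht u - j) u"
    have hu: "ht ?u = ?n" by (rule anc_ht) simp
    have fin: "finite ((adj ^^ M) `` {?u})" using finite_pow by simp
    have sub: "nearby C u
      \<subseteq> (\<Union>u'\<in>(adj ^^ M) `` {?u}. offspring u' j)"
    proof
      fix v assume "v \<in> nearby C u"
      then obtain x z where v: "ht v = ht u" "x \<in> K v" "z \<in> K u" "d x z \<le> C * r ^ ht u" by blast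
      have hv: "ht (anc ?n v) = ?n" by (rule anc_ht) (use v in simp)
      have "r ^ ht u = r ^ ?n * r ^ j" using False by (simp add: power_add[symmetric])
      then have "d x z \<le> r ^ ?n * (C * r ^ j)" using v by (simp add: mult_ac)
      also have "\<dots> < r ^ ?n * c3" using j rn_pos by (intro mult_strict_left_mono) auto
      finally have "d z x < c3 * r ^ ?n" using d_comm[of z x] by (simp add: mult.commute)
      moreover have "z \<in> K ?u" "x \<in> K (anc ?n v)" using K_anc[of u ?n] K_anc[of v ?n] v by auto
      ultimately have "(?u, anc ?n v) \<in> adj ^^ M" using hu hv by (intro sep[of _ _ z x]) auto
      then show "v \<in> (\<Union>u'\<in>(adj ^^ M) `` {?u}. offspring u' j)"
        using hv v(1) False by (intro UN_I[of "anc ?n v"]) auto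
    qed
    have "card (nearby C u)
      \<le> card (\<Union>u'\<in>(adj ^^ M) `` {?u}. offspring u' j)"
      by (rule card_mono[OF _ sub]) (use fin B in blast)
    also have "\<dots> \<le> (\<Sum>u'\<in>(adj ^^ M) `` {?u}. card (offspring u' j))"
      by (rule card_UN_le[OF fin])
    also have "\<dots> \<le> (\<Sum>u'\<in>(adj ^^ M) `` {?u}. B ^ j)" using B by (intro sum_mono) blast
    also have "\<dots> = card ((adj ^^ M) `` {?u}) * B ^ j" by simp
    also have "\<dots> \<le> L ^ M * B ^ j" by (intro mult_right_mono card_pow) auto
    finally show ?thesis by simp
  qed
  then show ?thesis using that by blast
qed

text \<open>A path is followed up to its first vertex in the outer set. The vertex before is within
  \<open>N2\<close> steps, and \<open>N + 2\<close> more are the reach of an edge between chosen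
  cells, by \<open>edge_cl\<close>.\<close>

definition N3 :: nat where "N3 = N2 + N + 2"

definition reg :: "nat \<Rightarrow> 't \<Rightarrow> 't set" where
  "reg k w = {v. ht v = ht w + k \<and> (w, anc (ht w) v) \<in> adj ^^ N3}"

lemma finite_reg: "finite (reg k w)"
  by (rule finite_subset[OF _ finite_ht[of "ht w + k"]]) (auto simp: reg_def)

lemma d_below:
  assumes "ht v = ht w + k" "(w, anc (ht w) v) \<in> adj ^^ i" "x \<in> K w" "y \<in> K v"
  shows "d x y \<le> (real i + 1) * c2 * r ^ ht w"
  using pow_dist[OF assms(2,3), of y] K_anc[of v "ht w"] assms by auto

text \<open>The balls of radius \<open>s v\<close> around \<open>xx v\<close> have mass at least
  \<open>C1 * s v powr \<alpha>\<close>. By \<open>ball_near\<close> they are small in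
  \<open>d\<close>, so they overlap boundedly often and lie in a ball around \<open>xx w\<close> of
  radius comparable to \<open>s w\<close>.\<close>

lemma sum_reg: obtains C5 where "0 < C5"
  "\<And>k w. (\<Sum>v\<in>reg k w. s v powr \<alpha>) \<le> C5 * s w powr \<alpha>"
proof -
  obtain C3 where C3: "0 < C3" "\<And>x R. x \<in> S \<Longrightarrow> 0 < R \<Longrightarrow> emeasure \<mu> (mb x R) \<le> ennreal (C3 * R powr \<alpha>)"
    using mu_upper by blast
  obtain c :: nat where c: "\<And>u. card (nearby (c2 / t0) u) \<le> c"
    using count_near by blast
  define C where "C = (real N3 + 1) * c2 + c2 / t0"
  have C: "0 < C" using c2_pos t0 by (auto simp: C_def intro!: add_pos_pos)
  define H where "H = h (4 * C / c1)"
  have H: "0 \<le> H" unfolding H_def using C c1_pos by (intro h_nonneg) auto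
  define C5 where "C5 = (real c + 1) * C3 * (H + 1) powr \<alpha> / C1"
  have "(\<Sum>v\<in>reg k w. s v powr \<alpha>) \<le> C5 * s w powr \<alpha>" for k w
  proof -
    define R where "R = (H + 1) * s w"
    have R: "0 < R" using H s_pos[of w] by (simp add: R_def)
    let ?B = "\<lambda>v. mb (xx v) (s v)"
    have sub: "?B v \<subseteq> mb (xx w) R" if v: "v \<in> reg k w" for v
    proof
      fix z assume z: "z \<in> ?B v"
      have hv: "ht v = ht w + k" "(w, anc (ht w) v) \<in> adj ^^ N3" using v by (auto simp: reg_def)
      have zS: "z \<in> S" using z mb_iff by blast
      have "r ^ ht v \<le> r ^ ht w" using r hv by (intro power_decreasing) auto
      then have "c2 / t0 * r ^ ht v \<le> c2 / t0 * r ^ ht w" using c2_pos t0 by (intro mult_left_mono) auto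
      moreover have "d (xx w) z \<le> d (xx w) (xx v) + d (xx v) z" by (rule d_tri[OF xx_S xx_S zS])
      moreover have "d (xx w) (xx v) \<le> (real N3 + 1) * c2 * r ^ ht w" by (rule d_below[OF hv xx_yy(1) xx_yy(1)])
      ultimately have "d (xx w) z \<le> C * r ^ ht w" using ball_near[OF z] by (simp add: C_def distrib_right)
      then have "\<rho> (xx w) z \<le> H * s w" unfolding H_def by (intro near_rho zS C)
      also have "\<dots> < R" using s_pos[of w] by (simp add: R_def)
      finally show "z \<in> mb (xx w) R" using zS xx_S mb_iff by blast
    qed
    have over: "card {v \<in> reg k w. z \<in> ?B v} \<le> c" if z: "z \<in> mb (xx w) R" for z
    proof -
      have "z \<in> S" using z mb_iff by blast
      then obtain u where "u \<in> V (ht w + k)" "z \<in> K u" by (rule cell_at)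
      then have u: "ht u = ht w + k" "z \<in> K u" by (simp_all add: V_ht)
      have "{v \<in> reg k w. z \<in> ?B v} \<subseteq> nearby (c2 / t0) u"
      proof
        fix v assume v: "v \<in> {v \<in> reg k w. z \<in> ?B v}"
        then have hv: "ht v = ht u" using u by (simp add: reg_def)
        have "d (xx v) z \<le> c2 / t0 * r ^ ht u" using ball_near[of z v] v hv by simp
        then show "v \<in> nearby (c2 / t0) u"
          using hv xx_yy(1)[of v] u(2) by blast
      qed
      then have "card {v \<in> reg k w. z \<in> ?B v} \<le> card (nearby (c2 / t0) u)"
        by (rule card_mono[rotated]) (rule finite_subset[OF _ finite_ht[of "ht u"]], auto)
      then show ?thesis using c[of u] by linarith
    qed
    have "ennreal (\<Sum>v\<in>reg k w. C1 * s v powr \<alpha>) = (\<Sum>v\<in>reg k w. ennreal (C1 * s v powr \<alpha>))"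
      using C1_pos by (intro sum_ennreal[symmetric]) auto
    also have "\<dots> \<le> (\<Sum>v\<in>reg k w. emeasure \<mu> (?B v))"
      using regular[OF xx_S] s_pos s_le_diam by (intro sum_mono) (auto simp: \<Delta>_def[symmetric] less_imp_le)
    also have "\<dots> \<le> of_nat c * emeasure \<mu> (mb (xx w) R)"
      by (rule sum_emeasure_overlap[OF finite_reg mb_sets mb_sets sub over])
    also have "\<dots> \<le> of_nat c * ennreal (C3 * R powr \<alpha>)"
      by (intro mult_left_mono C3(2) xx_S R) simp
    also have "\<dots> = ennreal (real c * (C3 * R powr \<alpha>))"
      using C3(1) by (simp add: ennreal_mult ennreal_of_nat_eq_real_of_nat)
    finally have "(\<Sum>v\<in>reg k w. C1 * s v powr \<alpha>) \<le> real c * (C3 * R powr \<alpha>)"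
      using C3(1) by (subst (asm) ennreal_le_iff) auto
    also have "\<dots> \<le> (real c + 1) * (C3 * R powr \<alpha>)" using C3(1) by (intro mult_right_mono) auto
    also have "R powr \<alpha> = (H + 1) powr \<alpha> * s w powr \<alpha>" using H s_pos[of w] by (simp add: R_def powr_mult)
    finally have "C1 * (\<Sum>v\<in>reg k w. s v powr \<alpha>) \<le> (real c + 1) * (C3 * ((H + 1) powr \<alpha> * s w powr \<alpha>))"
      by (simp add: sum_distrib_left)
    then show ?thesis using C1_pos by (simp add: C5_def field_simps)
  qed
  moreover have "0 < C5" using C3(1) C1_pos H by (simp add: C5_def add_nonneg_pos)
  ultimately show ?thesis using that by blast
qed

lemma reg_shrink:
  assumes "0 < e"
  shows "\<exists>k0. \<forall>k\<ge>k0. \<forall>w. \<forall>v\<in>reg k w. s v \<le> e * s w"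
proof -
  define H where "H = h (4 * ((real N3 + 1) * c2) / c1)"
  have Cp: "0 < (real N3 + 1) * c2" using c2_pos by (intro mult_pos_pos) auto
  have H: "0 \<le> H" unfolding H_def using Cp c1_pos by (intro h_nonneg) auto
  have "0 < e / (H + 1)" using assms H by simp
  then obtain t where t: "0 < t" "h t < e / (H + 1)" by (rule h_small)
  have "0 < t * (c1 / 4)" using t c1_pos by simp
  then obtain k0 where k0: "\<And>k. k \<ge> k0 \<Longrightarrow> c2 * r ^ k < t * (c1 / 4)" using small_r by blast
  have "s v \<le> e * s w" if k: "k \<ge> k0" and v: "v \<in> reg k w" for k w v
  proof -
    have hv: "ht v = ht w + k" "(w, anc (ht w) v) \<in> adj ^^ N3" using v by (auto simp: reg_def)
    obtain q where q: "q \<in> {xx w, yy w}" "\<rho> (xx v) (yy v) < h t * \<rho> (xx v) q"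
      using shrink[OF t(1) k0[OF k] hv(1) xx_yy(2)] .
    have qS: "q \<in> S" using q xx_S yy_S by auto
    have "d (xx w) (xx v) \<le> (real N3 + 1) * c2 * r ^ ht w" by (rule d_below[OF hv xx_yy(1) xx_yy(1)])
    then have "\<rho> (xx w) (xx v) \<le> H * s w" unfolding H_def by (intro near_rho xx_S Cp)
    moreover have "\<rho> (xx w) q \<le> s w"
      using q(1) s_pos[of w] Metric_space.mdist_zero[OF rho xx_S[of w]] by (auto simp: s_def)
    moreover have "\<rho> (xx v) q \<le> \<rho> (xx w) (xx v) + \<rho> (xx w) q" using rho_tri[OF xx_S xx_S qS, of v w] rho_comm by metis
    ultimately have "\<rho> (xx v) q \<le> (H + 1) * s w" by (simp add: distrib_right)
    then have "h t * \<rho> (xx v) q \<le> h t * ((H + 1) * s w)" using h_nonneg t by (intro mult_left_mono) auto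
    also have "\<dots> \<le> e / (H + 1) * ((H + 1) * s w)"
      using t H s_pos[of w] by (intro mult_right_mono) auto
    also have "\<dots> = e * s w" using H by simp
    finally show ?thesis using q(2) by (simp add: s_def)
  qed
  then show ?thesis by blast
qed

section \<open>Admissible functions from an Ahlfors regular metric\<close>

definition cl :: "nat \<Rightarrow> 't + 'x \<Rightarrow> 't" where "cl m z = (SOME v. ht v = m \<and> z \<in> cell m v)"

lemma cl: "z \<in> verts m \<Longrightarrow> ht (cl m z) = m \<and> z \<in> cell m (cl m z)"
  unfolding cl_def by (rule someI_ex[OF vert_cell])

lemma edge_verts: "(x,y) \<in> E m \<Longrightarrow> x \<in> verts m \<and> y \<in> verts m"
  using graph[of m] by (auto simp: nondirected_graph_def)

lemma edge_cl: assumes "(x,y) \<in> E m" shows "(cl m x, cl m y) \<in> adj ^^ (N + 2)"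
proof -
  obtain u v where uv: "ht u = m" "(u,v) \<in> adj ^^ N" "x \<in> cell m u" "y \<in> cell m v" using edge_near[OF assms] by blast
  have c: "ht (cl m x) = m" "x \<in> cell m (cl m x)" "ht (cl m y) = m" "y \<in> cell m (cl m y)"
    using cl edge_verts[OF assms] by auto
  have hv: "ht v = m" using pow_ht[OF uv(2)] uv(1) by simp
  have "(cl m x, u) \<in> adj" by (rule cells_adj[OF c(2) uv(3) c(1) uv(1)])
  then have "(cl m x, v) \<in> adj ^^ Suc N" using uv(2) by (rule relpow_Suc_I2)
  moreover have "(v, cl m y) \<in> adj" by (rule cells_adj[OF uv(4) c(4) hv c(3)])
  ultimately have "(cl m x, cl m y) \<in> adj ^^ Suc (Suc N)" by auto
  then show ?thesis by (metis add_2_eq_Suc')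
qed

definition H2 :: real where "H2 = h (4 * ((real (N + 2) + 1) * c2) / c1)"

lemma edge_rho:
  assumes "(x,y) \<in> E m"
  shows "\<rho> (xx (cl m x)) (xx (cl m y)) \<le> H2 * s (cl m x)" "\<rho> (xx (cl m x)) (xx (cl m y)) \<le> H2 * s (cl m y)"
proof -
  have *: "\<rho> (xx (cl m x)) (xx (cl m y)) \<le> H2 * s (cl m x)" if "(x,y) \<in> E m" for x y
    unfolding H2_def
  proof (rule near_rho[OF xx_S])
    show "0 < (real (N + 2) + 1) * c2" using c2_pos by (intro mult_pos_pos) auto
    show "d (xx (cl m x)) (xx (cl m y)) \<le> (real (N + 2) + 1) * c2 * r ^ ht (cl m x)"
      by (rule pow_dist[OF edge_cl[OF that] xx_yy(1) xx_yy(1)])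
  qed
  show "\<rho> (xx (cl m x)) (xx (cl m y)) \<le> H2 * s (cl m x)" by (rule *[OF assms])
  have "(y,x) \<in> E m" using assms graph[of m] by (auto simp: nondirected_graph_def dest: symD)
  then show "\<rho> (xx (cl m x)) (xx (cl m y)) \<le> H2 * s (cl m y)" using *[of y x] rho_comm by metis
qed

text \<open>Every edge is charged to its end vertex. The start vertex pays nothing, as it must not:
  in a connecting path it is the inner end point, which does not belong to the path.\<close>

lemma path_rho:
  "successively (\<lambda>x y. (x,y) \<in> E m) (x # zs) \<Longrightarrow>
    \<rho> (xx (cl m x)) (xx (cl m (last (x # zs)))) \<le> (\<Sum>z\<leftarrow>zs. H2 * s (cl m z))"
proof (induction zs arbitrary: x)
  case Nil
  then show ?case using Metric_space.mdist_zero[OF rho xx_S] by simp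
next
  case (Cons z zs)
  then have e: "(x,z) \<in> E m" "successively (\<lambda>x y. (x,y) \<in> E m) (z # zs)" by auto
  have "\<rho> (xx (cl m x)) (xx (cl m (last (z # zs))))
    \<le> \<rho> (xx (cl m x)) (xx (cl m z)) + \<rho> (xx (cl m z)) (xx (cl m (last (z # zs))))"
    by (rule rho_tri[OF xx_S xx_S xx_S])
  also have "\<dots> \<le> H2 * s (cl m z) + (\<Sum>z\<leftarrow>zs. H2 * s (cl m z))"
    using edge_rho(2)[OF e(1)] Cons.IH[OF e(2)] by (rule add_mono)
  finally show ?case by simp
qed

lemma H2_nonneg: "0 \<le> H2"
  unfolding H2_def using c1_pos c2_pos by (intro h_nonneg) auto

lemma not_out:
  assumes "z \<in> verts (ht w + k)" "z \<notin> out k w"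
  shows "(w, anc (ht w) (cl (ht w + k) z)) \<in> adj ^^ N2"
  using assms cl[OF assms(1)] out_iff by blast

definition \<kappa> :: real where "\<kappa> = 2 * h (2 * (2 * ((real N2 + 1) * c2) / c3)) + 1"

lemma kappa_pos: "0 < \<kappa>"
proof -
  have "0 \<le> h (2 * (2 * ((real N2 + 1) * c2) / c3))"
    using c2_pos c3_pos by (intro h_nonneg) auto
  then show ?thesis by (simp add: \<kappa>_def)
qed

text \<open>If the inner and the outer cell were close in \<open>d\<close>, their ancestors would be
  joined by \<open>M\<close> steps by \<open>sep\<close>, and the outer one would be within
  \<open>N1 + M \<le> N2\<close> steps of \<open>w\<close>. So they are apart at the scale of
  \<open>w\<close>, and quasisymmetry turns this into a lower bound by \<open>s w\<close>.\<close>

lemma inn_out_rho: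
  assumes k: "4 * c2 * r ^ k \<le> c3 / 2" and x: "x \<in> inn k w" and y: "y \<in> out k w"
  shows "s w \<le> \<kappa> * \<rho> (xx (cl (ht w + k) x)) (xx (cl (ht w + k) y))"
proof -
  let ?m = "ht w + k"
  obtain v where v: "ht v = ?m" "(w, anc (ht w) v) \<in> adj ^^ N1" "x \<in> cell ?m v" using x inn_iff by blast
  obtain u where u: "ht u = ?m" "(w, anc (ht w) u) \<notin> adj ^^ N2" "y \<in> cell ?m u" using y out_iff by blast
  have xv: "x \<in> verts ?m" "y \<in> verts ?m" using v u cell_verts by blast+
  have c: "ht (cl ?m x) = ?m" "x \<in> cell ?m (cl ?m x)" "ht (cl ?m y) = ?m" "y \<in> cell ?m (cl ?m y)"
    using cl xv by auto
  have close: "d (xx a) (xx b) \<le> 2 * c2 * r ^ ?m" if "(a,b) \<in> adj" "ht a = ?m" for a b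
  proof -
    have "(a,b) \<in> adj ^^ 1" using that by simp
    from pow_dist[OF this xx_yy(1) xx_yy(1)] show ?thesis using that by simp
  qed
  have "d (xx v) (xx (cl ?m x)) \<le> 2 * c2 * r ^ ?m"
    by (rule close[OF cells_adj[OF v(3) c(2) v(1) c(1)] v(1)])
  moreover have "d (xx (cl ?m y)) (xx u) \<le> 2 * c2 * r ^ ?m"
    by (rule close[OF cells_adj[OF c(4) u(3) c(3) u(1)] c(3)])
  moreover have "d (xx v) (xx u) \<le> d (xx v) (xx (cl ?m x)) + d (xx (cl ?m x)) (xx u)"
    by (rule d_tri[OF xx_S xx_S xx_S])
  moreover have "d (xx (cl ?m x)) (xx u) \<le> d (xx (cl ?m x)) (xx (cl ?m y)) + d (xx (cl ?m y)) (xx u)"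
    by (rule d_tri[OF xx_S xx_S xx_S])
  moreover have "c3 * r ^ ht w \<le> d (xx v) (xx u)"
  proof (rule ccontr)
    assume less: "\<not> c3 * r ^ ht w \<le> d (xx v) (xx u)"
    have h: "ht (anc (ht w) v) = ht w" "ht (anc (ht w) u) = ht w" using anc_ht v u by auto
    have "xx v \<in> K (anc (ht w) v)" "xx u \<in> K (anc (ht w) u)"
      using K_anc[of v "ht w"] K_anc[of u "ht w"] v(1) u(1) xx_yy(1)[of v] xx_yy(1)[of u] by auto
    then have "(anc (ht w) v, anc (ht w) u) \<in> adj ^^ M" using h less by (intro sep[of _ _ "xx v" "xx u"]) auto
    then have "(w, anc (ht w) u) \<in> adj ^^ (N1 + M)" by (rule adj_pow_trans[OF v(2)])
    then show False using u(2) pow_mono N2_ge by blast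
  qed
  moreover have "4 * c2 * r ^ ?m \<le> c3 / 2 * r ^ ht w"
  proof -
    have "4 * c2 * r ^ ?m = r ^ ht w * (4 * c2 * r ^ k)" by (simp add: power_add mult_ac)
    also have "\<dots> \<le> r ^ ht w * (c3 / 2)" using k rn_pos[of "ht w"] by (intro mult_left_mono) auto
    finally show ?thesis by (simp add: mult.commute)
  qed
  \<comment> \<open>The cells chosen by \<open>cl\<close> touch the inner and outer cells but need
    not equal them. Each replacement costs \<open>2 * c2 * r ^ ?m\<close>, and the assumption on
    \<open>k\<close> leaves half of \<open>c3\<close>.\<close>
  ultimately have dxy: "c3 / 2 * r ^ ht w \<le> d (xx (cl ?m x)) (xx (cl ?m y))" by simp
  then have dpos: "0 < d (xx (cl ?m x)) (xx (cl ?m y))" using c3_pos rn_pos[of "ht w"]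
    by (meson half_gt_zero less_le_trans mult_pos_pos)
  let ?T = "2 * ((real N2 + 1) * c2) / c3"
  have T: "0 < ?T" using c2_pos c3_pos by (intro divide_pos_pos mult_pos_pos) auto
  have near: "(w, anc (ht w) (cl ?m x)) \<in> adj ^^ N2"
    by (rule not_out[OF xv(1) inn_out_disjoint[OF x]])
  have each: "\<rho> (xx (cl ?m x)) z \<le> h (2 * ?T) * \<rho> (xx (cl ?m x)) (xx (cl ?m y))" if z: "z \<in> K w" for z
  proof (rule qs_le[OF xx_S xx_S _ T dpos])
    show "z \<in> S" using z K_S by blast
    have "d z (xx (cl ?m x)) \<le> (real N2 + 1) * c2 * r ^ ht w"
      by (rule d_below[OF c(1) near z xx_yy(1)])
    also have "\<dots> = ?T * (c3 / 2 * r ^ ht w)" using c3_pos by simp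
    also have "\<dots> \<le> ?T * d (xx (cl ?m x)) (xx (cl ?m y))" using dxy T by (intro mult_left_mono) auto
    finally show "d (xx (cl ?m x)) z \<le> ?T * d (xx (cl ?m x)) (xx (cl ?m y))" using d_comm by metis
  qed
  have "s w \<le> \<rho> (xx (cl ?m x)) (xx w) + \<rho> (xx (cl ?m x)) (yy w)"
  proof -
    have "\<rho> (xx w) (yy w) \<le> \<rho> (xx w) (xx (cl ?m x)) + \<rho> (xx (cl ?m x)) (yy w)"
      by (rule rho_tri[OF xx_S xx_S yy_S])
    then show ?thesis unfolding s_def using rho_comm[of "xx w" "xx (cl ?m x)"] by simp
  qed
  also have "\<dots> \<le> 2 * h (2 * ?T) * \<rho> (xx (cl ?m x)) (xx (cl ?m y))"
    using each[OF xx_yy(1)] each[OF xx_yy(2)] by simp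
  also have "\<dots> \<le> \<kappa> * \<rho> (xx (cl ?m x)) (xx (cl ?m y))"
    unfolding \<kappa>_def using rho_nn by (intro mult_right_mono) auto
  finally show ?thesis .
qed

text \<open>
  The factor 2 accounts for the last edge of a path, whose end point carries no weight.
\<close>

definition weight :: "nat \<Rightarrow> 't \<Rightarrow> 't + 'x \<Rightarrow> real" where
  "weight k w z = (if cl (ht w + k) z \<in> reg k w then 2 * \<kappa> * H2 * (s (cl (ht w + k) z) / s w) else 0)"

lemma weight_nonneg: "0 \<le> weight k w z"
  using kappa_pos H2_nonneg s_pos by (simp add: weight_def less_imp_le)

lemma weight_admissible:
  assumes k: "4 * c2 * r ^ k \<le> c3 / 2" shows "admissible k w (weight k w)"
  unfolding admissible_def
proof (intro conjI ballI)
  show "0 \<le> weight k w x" for x by (rule weight_nonneg)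
  let ?m = "ht w + k"
  let ?e = "\<lambda>z. H2 * s (cl ?m z)"
  fix xs assume "xs \<in> connecting_paths (verts ?m) (E ?m) (inn k w) (out k w)"
  then obtain x0 x1 where xs: "xs \<noteq> []" "set xs \<subseteq> verts ?m" "x0 \<in> inn k w" "x1 \<in> out k w"
    "successively (\<lambda>x y. (x,y) \<in> E ?m) (x0 # xs @ [x1])" unfolding connecting_paths_def by blast
  have e0: "0 \<le> ?e z" for z using H2_nonneg s_pos[of "cl ?m z"] by simp
  have x0v: "x0 \<in> verts ?m" using xs(3) inn_iff cell_verts by blast
  have x0n: "(w, anc (ht w) (cl ?m x0)) \<in> adj ^^ N2" by (rule not_out[OF x0v inn_out_disjoint[OF xs(3)]])
  have N2reg: "cl ?m z \<in> reg k w" if "(w, anc (ht w) (cl ?m z)) \<in> adj ^^ N2" "z \<in> verts ?m" for z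
    using pow_mono[OF that(1), of N3] cl[OF that(2)] by (simp add: reg_def N3_def)
  have main: "\<exists>ys. (\<Sum>z\<leftarrow>ys. weight k w z) \<le> (\<Sum>z\<leftarrow>xs. weight k w z) \<and> (\<forall>z\<in>set ys. cl ?m z \<in> reg k w) \<and>
    s w \<le> 2 * \<kappa> * (\<Sum>z\<leftarrow>ys. ?e z)"
  proof (cases "\<exists>z\<in>set xs. z \<in> out k w")
    case True
    \<comment> \<open>A path may enter the outer set early and wander where the weight vanishes. Up
      to the first outer vertex all its cells are in \<open>reg k w\<close>, and this part already
      travels the full distance.\<close>
    then obtain as q bs where e: "xs = as @ q # bs" "q \<in> out k w" "\<forall>z\<in>set as. z \<notin> out k w"
      using split_list_first_prop[of xs "\<lambda>z. z \<in> out k w"] by blast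
    have eq: "x0 # xs @ [x1] = (x0 # as @ [q]) @ (bs @ [x1])" using e by simp
    have succ: "successively (\<lambda>x y. (x,y) \<in> E ?m) (x0 # as @ [q])"
      using xs(5) unfolding eq successively_append_iff by blast
    have asv: "set as \<subseteq> verts ?m" "q \<in> verts ?m" using xs(2) e by auto
    have as_near: "(w, anc (ht w) (cl ?m z)) \<in> adj ^^ N2" if "z \<in> set as" for z
      using not_out e(3) asv(1) that by blast
    define pr where "pr = last (x0 # as)"
    have pr: "(w, anc (ht w) (cl ?m pr)) \<in> adj ^^ N2"
      using x0n as_near by (cases "as = []") (auto simp: pr_def)
    have eq2: "x0 # as @ [q] = (x0 # as) @ [q]" by simp
    have "(pr, q) \<in> E ?m" using succ unfolding eq2 successively_append_iff pr_def by simp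
    then have pq: "(cl ?m pr, cl ?m q) \<in> adj ^^ (N + 2)" by (rule edge_cl)
    have hq: "ht (cl ?m q) = ?m" using cl asv by blast
    then have hp: "ht (cl ?m pr) = ?m" using pow_ht[OF pq] by simp
    have "(anc (ht w) (cl ?m pr), anc (ht w) (cl ?m q)) \<in> adj ^^ (N + 2)"
      by (rule adj_pow_anc[OF pq]) (use hp in auto)
    then have "(w, anc (ht w) (cl ?m q)) \<in> adj ^^ (N2 + (N + 2))" by (rule adj_pow_trans[OF pr])
    then have "(w, anc (ht w) (cl ?m q)) \<in> adj ^^ N3" by (simp only: N3_def add.assoc)
    then have qreg: "cl ?m q \<in> reg k w" using hq by (simp add: reg_def)
    have "\<rho> (xx (cl ?m x0)) (xx (cl ?m q)) \<le> (\<Sum>z\<leftarrow>as @ [q]. ?e z)" using path_rho[OF succ] by simp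
    moreover have "s w \<le> \<kappa> * \<rho> (xx (cl ?m x0)) (xx (cl ?m q))" by (rule inn_out_rho[OF k xs(3) e(2)])
    ultimately have "s w \<le> \<kappa> * (\<Sum>z\<leftarrow>as @ [q]. ?e z)"
      using kappa_pos by (meson less_imp_le mult_left_mono order_trans)
    moreover have nn: "0 \<le> (\<Sum>z\<leftarrow>as @ [q]. ?e z)" using e0 by (intro sum_list_nonneg) auto
    moreover have "\<kappa> * (\<Sum>z\<leftarrow>as @ [q]. ?e z) \<le> 2 * \<kappa> * (\<Sum>z\<leftarrow>as @ [q]. ?e z)"
      using nn kappa_pos by (intro mult_right_mono) auto
    ultimately have "s w \<le> 2 * \<kappa> * (\<Sum>z\<leftarrow>as @ [q]. ?e z)" by linarith
    moreover have "0 \<le> (\<Sum>z\<leftarrow>bs. weight k w z)" using weight_nonneg by (intro sum_list_nonneg) auto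
    then have "(\<Sum>z\<leftarrow>as @ [q]. weight k w z) \<le> (\<Sum>z\<leftarrow>xs. weight k w z)" by (simp add: e(1))
    moreover have "\<forall>z\<in>set (as @ [q]). cl ?m z \<in> reg k w" using N2reg as_near asv qreg by auto
    ultimately show ?thesis by blast
  next
    case False
    have eq: "x0 # xs @ [x1] = (x0 # xs) @ [x1]" by simp
    have succ: "successively (\<lambda>x y. (x,y) \<in> E ?m) (x0 # xs)" and le: "(last xs, x1) \<in> E ?m"
      using xs(1,5) unfolding eq successively_append_iff by auto
    have "\<rho> (xx (cl ?m x0)) (xx (cl ?m x1)) \<le> \<rho> (xx (cl ?m x0)) (xx (cl ?m (last xs))) + \<rho> (xx (cl ?m (last xs))) (xx (cl ?m x1))"
      by (rule rho_tri[OF xx_S xx_S xx_S])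
    moreover have "\<rho> (xx (cl ?m x0)) (xx (cl ?m (last xs))) \<le> (\<Sum>z\<leftarrow>xs. ?e z)" using path_rho[OF succ] xs(1) by simp
    moreover have "\<rho> (xx (cl ?m (last xs))) (xx (cl ?m x1)) \<le> ?e (last xs)" by (rule edge_rho(1)[OF le])
    moreover have "?e (last xs) \<le> (\<Sum>z\<leftarrow>xs. ?e z)"
      using xs(1) e0 by (intro member_le_sum_list) auto
    ultimately have "\<rho> (xx (cl ?m x0)) (xx (cl ?m x1)) \<le> 2 * (\<Sum>z\<leftarrow>xs. ?e z)" by linarith
    then have "\<kappa> * \<rho> (xx (cl ?m x0)) (xx (cl ?m x1)) \<le> \<kappa> * (2 * (\<Sum>z\<leftarrow>xs. ?e z))"
      using kappa_pos by (intro mult_left_mono) auto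
    then have "s w \<le> 2 * \<kappa> * (\<Sum>z\<leftarrow>xs. ?e z)" using inn_out_rho[OF k xs(3,4)] by simp
    moreover have "\<forall>z\<in>set xs. cl ?m z \<in> reg k w" using N2reg not_out False xs(2) by blast
    ultimately show ?thesis by blast
  qed
  then obtain ys where ys: "(\<Sum>z\<leftarrow>ys. weight k w z) \<le> (\<Sum>z\<leftarrow>xs. weight k w z)"
    "\<forall>z\<in>set ys. cl ?m z \<in> reg k w" "s w \<le> 2 * \<kappa> * (\<Sum>z\<leftarrow>ys. ?e z)" by blast
  have "(\<Sum>z\<leftarrow>ys. weight k w z) = (\<Sum>z\<leftarrow>ys. 2 * \<kappa> / s w * ?e z)"
    by (rule arg_cong[where f = sum_list], rule map_cong[OF refl]) (use ys(2) in \<open>auto simp: weight_def\<close>)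
  also have "\<dots> = 2 * \<kappa> / s w * (\<Sum>z\<leftarrow>ys. ?e z)" by (rule sum_list_const_mult)
  also have "\<dots> = 2 * \<kappa> * (\<Sum>z\<leftarrow>ys. ?e z) / s w" by simp
  finally have e: "(\<Sum>z\<leftarrow>ys. weight k w z) = 2 * \<kappa> * (\<Sum>z\<leftarrow>ys. ?e z) / s w" .
  have "s w / s w \<le> 2 * \<kappa> * (\<Sum>z\<leftarrow>ys. ?e z) / s w"
    by (rule divide_right_mono[OF ys(3) less_imp_le[OF s_pos]])
  then have "1 \<le> (\<Sum>z\<leftarrow>ys. weight k w z)" unfolding e using s_pos[of w] by simp
  then show "1 \<le> (\<Sum>z\<leftarrow>xs. weight k w z)" using ys(1) by linarith
qed

lemma weight_sum:
  assumes p: "0 < p"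
  shows "(\<Sum>z\<in>verts (ht w + k). weight k w z powr p)
    \<le> real Lc * (\<Sum>v\<in>reg k w. (2 * \<kappa> * H2 * (s v / s w)) powr p)"
proof -
  let ?m = "ht w + k"
  let ?Z = "{z \<in> verts ?m. cl ?m z \<in> reg k w}"
  have "(\<Sum>z\<in>verts ?m. weight k w z powr p) = (\<Sum>z\<in>?Z. weight k w z powr p)"
    by (rule sum.mono_neutral_right[OF finite_verts]) (auto simp: weight_def)
  also have "\<dots> = (\<Sum>z\<in>?Z. (2 * \<kappa> * H2 * (s (cl ?m z) / s w)) powr p)"
    by (rule sum.cong) (auto simp: weight_def)
  also have "\<dots> = (\<Sum>v\<in>reg k w. \<Sum>z\<in>{z \<in> ?Z. cl ?m z = v}. (2 * \<kappa> * H2 * (s (cl ?m z) / s w)) powr p)"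
    by (rule sum.group[symmetric]) (use finite_verts finite_reg in auto)
  also have "\<dots> \<le> (\<Sum>v\<in>reg k w. real Lc * (2 * \<kappa> * H2 * (s v / s w)) powr p)"
  proof (rule sum_mono)
    fix v assume v: "v \<in> reg k w"
    have hv: "ht v = ?m" using v by (simp add: reg_def)
    have "{z \<in> ?Z. cl ?m z = v} \<subseteq> cell ?m v" using cl by blast
    then have "card {z \<in> ?Z. cl ?m z = v} \<le> Lc"
      using finite_cell[OF hv] card_mono order_trans by blast
    then have "real (card {z \<in> ?Z. cl ?m z = v}) * (2 * \<kappa> * H2 * (s v / s w)) powr p
      \<le> real Lc * (2 * \<kappa> * H2 * (s v / s w)) powr p" by (intro mult_right_mono) auto
    moreover have "(\<Sum>z\<in>{z \<in> ?Z. cl ?m z = v}. (2 * \<kappa> * H2 * (s (cl ?m z) / s w)) powr p)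
      = (\<Sum>z\<in>{z \<in> ?Z. cl ?m z = v}. (2 * \<kappa> * H2 * (s v / s w)) powr p)" by (rule sum.cong) auto
    ultimately show "(\<Sum>z\<in>{z \<in> ?Z. cl ?m z = v}. (2 * \<kappa> * H2 * (s (cl ?m z) / s w)) powr p)
      \<le> real Lc * (2 * \<kappa> * H2 * (s v / s w)) powr p" by simp
  qed
  finally show ?thesis by (simp add: sum_distrib_left)
qed

text \<open>The energy is split by writing the \<open>p\<close>-th power of a ratio
  \<open>s v / s w\<close> as its power \<open>p - \<alpha>\<close>, which is uniformly small by
  \<open>reg_shrink\<close>, times its power \<open>\<alpha>\<close>, whose sum is bounded by
  \<open>sum_reg\<close>.\<close>

lemma modulus_small:
  assumes p: "\<alpha> < p" and e: "0 < \<epsilon>"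
  shows "\<exists>k0. \<forall>k\<ge>k0. modulus p k \<le> ennreal \<epsilon>"
proof -
  have p0: "0 < p" using p \<alpha>_pos by linarith
  obtain C5 where C5: "0 < C5" "\<And>k w. (\<Sum>v\<in>reg k w. s v powr \<alpha>) \<le> C5 * s w powr \<alpha>" using sum_reg by blast
  define C where "C = real Lc * (2 * \<kappa> * H2) powr p * C5 + 1"
  have C: "0 < C" using C5 by (auto simp: C_def intro!: add_nonneg_pos)
  define \<delta> where "\<delta> = (\<epsilon> / C) powr (1 / (p - \<alpha>))"
  have \<delta>: "0 < \<delta>" using e C by (simp add: \<delta>_def)
  have \<delta>p: "\<delta> powr (p - \<alpha>) = \<epsilon> / C" using e C p by (simp add: \<delta>_def powr_powr)
  obtain k0 where k0: "\<And>k w v. k \<ge> k0 \<Longrightarrow> v \<in> reg k w \<Longrightarrow> s v \<le> \<delta> * s w" using reg_shrink[OF \<delta>] by blast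
  obtain k1 where k1: "\<And>k. k \<ge> k1 \<Longrightarrow> 4 * c2 * r ^ k < c3 / 2"
    using small_r[of "c3 / 2" "4 * c2"] half_gt_zero[OF c3_pos] by blast
  have "modulus p k \<le> ennreal \<epsilon>" if k: "k \<ge> max k0 k1" for k
    unfolding net_modulus_def
  proof (rule SUP_least)
    fix w
    let ?m = "ht w + k"
    have adm: "admissible k w (weight k w)" using k1[of k] k by (intro weight_admissible) auto
    have "Modulus p (verts ?m) (E ?m) (inn k w) (out k w) \<le> (\<Sum>\<^sub>\<infinity>z\<in>verts ?m. ennreal (weight k w z powr p))"
      unfolding Modulus_def using adm unfolding admissible_def by (intro INF_lower) blast
    also have "\<dots> = ennreal (\<Sum>z\<in>verts ?m. weight k w z powr p)"
      by (simp add: infsum_finite[OF finite_verts] sum_ennreal)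
    also have "\<dots> \<le> ennreal \<epsilon>"
    proof (rule ennreal_leI)
      have "(\<Sum>z\<in>verts ?m. weight k w z powr p) \<le> real Lc * (\<Sum>v\<in>reg k w. (2 * \<kappa> * H2 * (s v / s w)) powr p)"
        by (rule weight_sum[OF p0])
      also have "\<dots> \<le> real Lc * (\<Sum>v\<in>reg k w. (2 * \<kappa> * H2) powr p * (\<delta> powr (p - \<alpha>) * (s v powr \<alpha> / s w powr \<alpha>)))"
      proof (intro mult_left_mono sum_mono)
        fix v assume v: "v \<in> reg k w"
        have q: "0 < s v / s w" "s v / s w \<le> \<delta>" using s_pos[of v] s_pos[of w] k0[OF _ v] k by (auto simp: field_simps)
        have "(2 * \<kappa> * H2 * (s v / s w)) powr p = (2 * \<kappa> * H2) powr p * (s v / s w) powr p"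
          using kappa_pos H2_nonneg q by (intro powr_mult)
        also have "(s v / s w) powr p = (s v / s w) powr (p - \<alpha>) * (s v / s w) powr \<alpha>"
          by (simp add: powr_add[symmetric])
        also have "(s v / s w) powr \<alpha> = s v powr \<alpha> / s w powr \<alpha>"
          using s_pos[of v] s_pos[of w] by (simp add: powr_divide)
        also have "(2 * \<kappa> * H2) powr p * ((s v / s w) powr (p - \<alpha>) * (s v powr \<alpha> / s w powr \<alpha>))
          \<le> (2 * \<kappa> * H2) powr p * (\<delta> powr (p - \<alpha>) * (s v powr \<alpha> / s w powr \<alpha>))"
          using q p by (intro mult_left_mono mult_right_mono powr_mono2) auto
        finally show "(2 * \<kappa> * H2 * (s v / s w)) powr p
          \<le> (2 * \<kappa> * H2) powr p * (\<delta> powr (p - \<alpha>) * (s v powr \<alpha> / s w powr \<alpha>))" .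
      qed simp
      also have "\<dots> = real Lc * (2 * \<kappa> * H2) powr p * \<delta> powr (p - \<alpha>) * ((\<Sum>v\<in>reg k w. s v powr \<alpha>) / s w powr \<alpha>)"
        by (simp add: sum_distrib_left sum_divide_distrib mult.assoc)
      also have "\<dots> \<le> real Lc * (2 * \<kappa> * H2) powr p * \<delta> powr (p - \<alpha>) * C5"
        using C5(2)[of k w] s_pos[of w] by (intro mult_left_mono) (auto simp: field_simps)
      also have "\<dots> = (C - 1) * (\<epsilon> / C)" unfolding \<delta>p[symmetric] by (simp add: C_def mult_ac)
      also have "\<dots> \<le> C * (\<epsilon> / C)" using e C by (intro mult_right_mono) auto
      also have "\<dots> = \<epsilon>" using C by simp
      finally show "(\<Sum>z\<in>verts ?m. weight k w z powr p) \<le> \<epsilon>" .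
    qed
    finally show "Modulus p (verts ?m) (E ?m) (inn k w) (out k w) \<le> ennreal \<epsilon>" .
  qed
  then show ?thesis by blast
qed

lemma limsup_modulus:
  assumes p: "\<alpha> < p" shows "limsup (\<lambda>k. modulus p k) = 0"
proof -
  have "limsup (\<lambda>k. modulus p k) \<le> 0 + ennreal \<epsilon>" if e: "0 < \<epsilon>" for \<epsilon>
  proof -
    have "eventually (\<lambda>k. modulus p k \<le> ennreal \<epsilon>) sequentially"
      unfolding eventually_sequentially by (rule modulus_small[OF p e])
    then show ?thesis by (simp add: Limsup_bounded)
  qed
  then have "limsup (\<lambda>k. modulus p k) \<le> 0"
    by (rule ennreal_le_epsilon)
  then show ?thesis by simp
qed

end

lemma proper_systemE:
  assumes fw: "framework A \<phi> X K d M r c1 c2" and ps: "proper_system A \<phi> X K Am Vm E"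
    and L: "\<And>v. card (hierarchy.adj UNIV (height A \<phi>) K `` {v}) \<le> L"
    and c3: "0 < c3" "\<And>v u x y. \<lbrakk>height A \<phi> u = height A \<phi> v; x \<in> K v; y \<in> K u; d x y < c3 * r ^ height A \<phi> v\<rbrakk>
      \<Longrightarrow> (v,u) \<in> hierarchy.adj UNIV (height A \<phi>) K ^^ M"
    and M: "1 \<le> M" "N1 + M \<le> N2"
  obtains N L0 L1 L2 where "network A \<phi> X K d M r c1 c2 L c3 Am Vm E N L0 L1 L2 N1 N2"
proof -
  interpret framework A \<phi> X K d M r c1 c2 by (rule fw)
  obtain N L0 L1 L2 :: nat where ge: "1 \<le> L1"
    and sub: "\<forall>m. Am m \<subseteq> level A \<phi> m \<and> Vm m \<subseteq> S"
    and ne: "\<forall>m. \<forall>w\<in>level A \<phi> m. net_cell K Am Vm m w \<noteq> {}"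
    and ec: "\<forall>m. \<forall>u\<in>level A \<phi> m. \<forall>v\<in>level A \<phi> m.
           finite (net_edges K Am Vm E m u v) \<and> card (net_edges K Am Vm E m u v) \<le> L0"
    and en: "\<forall>m. \<forall>(x,y)\<in>E m. \<exists>(u,v)\<in>Jh A \<phi> K N m. x \<in> net_cell K Am Vm m u \<and> y \<in> net_cell K Am Vm m v"
    and ep: "\<forall>m. \<forall>(u,v)\<in>Jh A \<phi> K L1 m. \<forall>x\<in>net_cell K Am Vm m u. \<forall>y\<in>net_cell K Am Vm m v.
           \<exists>n\<ge>1. \<exists>(xs :: nat \<Rightarrow> 'a + 'b) (ws :: nat \<Rightarrow> 'a).
             (\<forall>i\<in>{1..n}. ws i \<in> Gam A \<phi> K L2 u) \<and>
             (\<forall>i\<in>{1..<n}. (xs i, xs (i+1)) \<in> net_edges K Am Vm E m (ws i) (ws (i+1))) \<and>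
             xs 1 = x \<and> xs n = y \<and> ws 1 = u \<and> ws n = v"
    using ps unfolding proper_system_def by (elim conjE exE) (rule that)
  have graph: "nondirected_graph (net_verts Am Vm m) (E m)" for m
    using ps unfolding proper_system_def by blast
  have lev_iff: "w \<in> level A \<phi> m \<longleftrightarrow> ht w = m" for w m by (simp add: level_def)
  have Jh_iff: "(u,v) \<in> Jh A \<phi> K i m \<longleftrightarrow> ht u = m \<and> (u,v) \<in> adj ^^ i" for u v i m
  proof
    assume "ht u = m \<and> (u,v) \<in> adj ^^ i"
    moreover have "ht v = ht u" if "(u,v) \<in> adj ^^ i" using adj_pow_C[OF that] by simp
    ultimately show "(u,v) \<in> Jh A \<phi> K i m" by (simp add: Jh_def lev_iff Gam_iff)
  qed (simp add: Jh_def lev_iff Gam_iff)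
  have "network A \<phi> X K d M r c1 c2 L c3 Am Vm E N L0 L1 L2 N1 N2"
  proof (unfold_locales)
    show "card (adj `` {v}) \<le> L" for v by (rule L)
    show "0 < c3" by (rule c3)
    show "(v, u) \<in> adj ^^ M" if "ht u = ht v" "x \<in> K v" "y \<in> K u" "d x y < c3 * r ^ ht v" for u v x y
      by (rule c3(2)[OF that])
    show "nondirected_graph (net_verts Am Vm m) (E m)" for m by (rule graph)
    show "Am m \<subseteq> level A \<phi> m" "Vm m \<subseteq> S" for m using sub by blast+
    show "net_cell K Am Vm m w \<noteq> {}" if "ht w = m" for w m using ne that lev_iff by blast
    show "finite (net_edges K Am Vm E m u v) \<and> card (net_edges K Am Vm E m u v) \<le> L0"
      if "ht u = m" "ht v = m" for u m v using ec that lev_iff by blast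
    show "\<exists>u v. ht u = m \<and> (u, v) \<in> adj ^^ N \<and> x \<in> net_cell K Am Vm m u \<and> y \<in> net_cell K Am Vm m v"
      if "(x, y) \<in> E m" for x y m using en that Jh_iff by fastforce
    show "1 \<le> L1" by (rule ge)
    show "1 \<le> M" "N1 + M \<le> N2" by (rule M)+
    show "(x, y) \<in> {(a, b) \<in> E m. a \<in> (\<Union>w\<in>(adj ^^ L2) `` {u}. net_cell K Am Vm m w) \<and>
        b \<in> (\<Union>w\<in>(adj ^^ L2) `` {u}. net_cell K Am Vm m w)}\<^sup>*"
      if h: "ht u = m" "(u, v) \<in> adj ^^ L1" "x \<in> net_cell K Am Vm m u" "y \<in> net_cell K Am Vm m v" for x y u v m
    proof (rule indexed_path_rtrancl)
      have "(u,v) \<in> Jh A \<phi> K L1 m" using h Jh_iff by blast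
      with ep h have "\<exists>n\<ge>1. \<exists>(xs :: nat \<Rightarrow> 'a + 'b) (ws :: nat \<Rightarrow> 'a).
             (\<forall>i\<in>{1..n}. ws i \<in> Gam A \<phi> K L2 u) \<and>
             (\<forall>i\<in>{1..<n}. (xs i, xs (i+1)) \<in> net_edges K Am Vm E m (ws i) (ws (i+1))) \<and>
             xs 1 = x \<and> xs n = y \<and> ws 1 = u \<and> ws n = v" by blast
      then show "\<exists>n\<ge>1. \<exists>(xs :: nat \<Rightarrow> 'a + 'b) (ws :: nat \<Rightarrow> 'a).
             (\<forall>i\<in>{1..n}. ws i \<in> (adj ^^ L2) `` {u}) \<and>
             (\<forall>i\<in>{1..<n}. (xs i, xs (i+1)) \<in> E m \<and> xs i \<in> net_cell K Am Vm m (ws i)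
                \<and> xs (i+1) \<in> net_cell K Am Vm m (ws (i+1))) \<and>
             xs 1 = x \<and> xs n = y \<and> ws 1 = u \<and> ws n = v"
        by (simp only: Gam_iff Image_singleton_iff net_edges_def mem_Collect_eq case_prod_conv)
    qed
  qed
  then show ?thesis by (rule that)
qed

theorem theorem21p8:
  fixes A :: "'t \<Rightarrow> 't \<Rightarrow> bool" and \<phi> :: 't
    and X :: "'x topology" and K :: "'t \<Rightarrow> 'x set" and d :: "'x \<Rightarrow> 'x \<Rightarrow> real"
    and M_star N1 N2 :: nat and r c1 c2 :: real
    and Am :: "nat \<Rightarrow> 't set" and Vm :: "nat \<Rightarrow> 'x set"
    and E :: "nat \<Rightarrow> (('t + 'x) \<times> ('t + 'x)) set"
  assumes "countable (UNIV :: 't set)" and "infinite (UNIV :: 't set)"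
    and "locally_finite_tree A"
    and "compact_space X" and "metrizable_space X"
    and no_isolated: "\<forall>x\<in>topspace X. \<not> openin X {x}"
    and "tree_partition A \<phi> X K" and "minimal_partition A \<phi> K"
    and bounded_branching: "\<exists>C::nat. \<forall>w. finite (children A \<phi> w) \<and> card (children A \<phi> w) \<le> C"
    and "compatible_metric X d"
    and "M_star \<ge> 1" and "adapted A \<phi> X K M_star d"
    and "exponential A \<phi> (diam_weight K d)"
    and "thick A \<phi> K (diam_weight K d)"
    and "uniformly_finite A \<phi> K (diam_weight K d)"
    and "0 < r" and "r < 1" and "0 < c1" and "0 < c2"
    and self_similar: "\<forall>w. c1 * r ^ height A \<phi> w \<le> diam_weight K d w \<and>
             diam_weight K d w \<le> c2 * r ^ height A \<phi> w"
    and "proper_system A \<phi> X K Am Vm E"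
    and "N2 \<ge> N1 + M_star"
  shows "upper_exponent A \<phi> K Am Vm E N1 N2 = lower_exponent A \<phi> K Am Vm E N1 N2 \<and>
         lower_exponent A \<phi> K Am Vm E N1 N2 = dim_AR (topspace X) d"
proof -
  interpret framework A \<phi> X K d M_star r c1 c2 by unfold_locales (fact assms)+
  obtain L where L: "\<And>v. card (adj `` {v}) \<le> L" by (rule neighbours) (rule that)
  obtain c3 where c3: "0 < c3"
    "\<And>v u x y. \<lbrakk>ht u = ht v; x \<in> K v; y \<in> K u; d x y < c3 * r ^ ht v\<rbrakk> \<Longrightarrow> (v,u) \<in> adj ^^ M_star"
    by (rule separation) (rule that)
  obtain N L0 L1 L2 where net: "network A \<phi> X K d M_star r c1 c2 L c3 Am Vm E N L0 L1 L2 N1 N2"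
    using proper_systemE[OF framework_axioms \<open>proper_system A \<phi> X K Am Vm E\<close> L c3 \<open>M_star \<ge> 1\<close> \<open>N2 \<ge> N1 + M_star\<close>] .
  interpret network A \<phi> X K d M_star r c1 c2 L c3 Am Vm E N L0 L1 L2 N1 N2 by (rule net)
  let ?M = "\<lambda>p k. net_modulus A \<phi> K Am Vm E p k N1 N2"
  \<comment> \<open>The three quantities are compared in a cycle: dimension, lower exponent, upper
    exponent, and back to the dimension.\<close>
  have "lower_exponent A \<phi> K Am Vm E N1 N2 \<le> upper_exponent A \<phi> K Am Vm E N1 N2"
    unfolding lower_exponent_def upper_exponent_def
  proof (rule Inf_superset_mono, safe)
    fix p assume p: "limsup (?M p) = 0" "0 < p"
    have "liminf (?M p) \<le> limsup (?M p)" by (rule Liminf_le_Limsup) simp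
    then show "\<exists>p'. ereal p = ereal p' \<and> 0 < p' \<and> liminf (?M p') = 0" using p by auto
  qed
  moreover have "dim_AR S d \<le> lower_exponent A \<phi> K Am Vm E N1 N2"
    unfolding lower_exponent_def by (rule Inf_greatest) (auto intro: dim_AR_le_lower)
  moreover have "upper_exponent A \<phi> K Am Vm E N1 N2 \<le> dim_AR S d"
    unfolding dim_AR_def
  proof (rule Inf_greatest, safe)
    fix \<alpha> \<rho> \<mu>
    assume \<alpha>: "0 < \<alpha>" and \<rho>: "Metric_space S \<rho>" "quasisymmetric S d \<rho>"
      and \<mu>: "borel_regular (Metric_space.mtopology S \<rho>) \<mu>" "Ahlfors_regular S \<rho> \<mu> \<alpha>"
    obtain h h' :: "real \<Rightarrow> real" where h: "homeomorphism {0..} {0..} h h'" "h 0 = 0"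
      "\<forall>t>0. \<forall>x\<in>S. \<forall>y\<in>S. \<forall>z\<in>S. d x z < t * d x y \<longrightarrow> \<rho> x z < h t * \<rho> x y"
      using \<rho>(2) unfolding quasisymmetric_def by blast
    obtain C1 C2 where C: "0 < C1" "0 < C2" "\<forall>x\<in>S. \<forall>s\<in>{0..mdiam \<rho> S}.
        ennreal (C1 * s powr \<alpha>) \<le> emeasure \<mu> (Metric_space.mball S \<rho> x s) \<and>
        emeasure \<mu> (Metric_space.mball S \<rho> x s) \<le> ennreal (C2 * s powr \<alpha>)"
      using \<mu>(2) unfolding Ahlfors_regular_def by blast
    interpret ahlfors_network A \<phi> X K d M_star r c1 c2 L c3 Am Vm E N L0 L1 L2 N1 N2 \<rho> \<mu> \<alpha> C1 C2 h h'
    proof (rule ahlfors_network.intro[OF net], rule ahlfors_network_axioms.intro)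
      show "\<rho> x z < h t * \<rho> x y"
        if "0 < t" "x \<in> S" "y \<in> S" "z \<in> S" "d x z < t * d x y" for t x y z
        using h(3) that by blast
      show "ennreal (C1 * s powr \<alpha>) \<le> emeasure \<mu> (Metric_space.mball S \<rho> x s) \<and>
          emeasure \<mu> (Metric_space.mball S \<rho> x s) \<le> ennreal (C2 * s powr \<alpha>)"
        if "x \<in> S" "s \<in> {0..mdiam \<rho> S}" for x s
        using C(3) that by blast
    qed (fact \<alpha> \<mu>(1) h(1,2) C(1,2) \<rho>(1))+
    show "upper_exponent A \<phi> K Am Vm E N1 N2 \<le> ereal \<alpha>"
    \<comment> \<open>The modulus is known to vanish only for exponents strictly above
      \<open>\<alpha>\<close>, so the bound is reached as an infimum.\<close>
    proof (rule dense_ge)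
      fix x assume "ereal \<alpha> < x"
      then obtain p where p: "\<alpha> < p" "ereal p < x" using ereal_dense2 by force
      have "upper_exponent A \<phi> K Am Vm E N1 N2 \<le> ereal p"
        unfolding upper_exponent_def using limsup_modulus[OF p(1)] p \<alpha> by (intro Inf_lower) auto
      then show "upper_exponent A \<phi> K Am Vm E N1 N2 \<le> x" using p(2) by order
    qed
  qed
  ultimately show ?thesis by (meson order.antisym order.trans)
qed


end
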